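(* Let $E$ be a row-finite graph with no sinks and let $F$ be a reverse explosion of $E$. Then $C^*(E)$ and $C^*(F)$ are Morita equivalent.
   Context: Graphs. A directed graph $E$ consists of a vertex set $E^0$, an edge set $E^1$ and source and range maps $s,r:E^1\to E^0$. Throughout, "graph" means a countable directed graph without multiple edges (at most one edge from $v$ to $w$ for each ordered pair $(v,w)$; loops allowed) which is connected (any two vertices are joined by an undirected path). $E$ is row-finite if every vertex is the source of only finitely many edges; a sink is a vertex which is the source of no edge. $E^\infty$ is the set of infinite paths $x=x_1x_2\cdots$ in $E$. A vertex $v$ of $E$ is cofinal if for every $x\in E^\infty$ there is a finite path (possibly of length $0$) from $v$ to $s(x_i)$ for some $i$. The reverse graph of $E$ has the same vertices, with all edges reversed. Explosion. Let $G$ be a graph, $v\in G^0$ with $|s^{-1}(v)|>1$, and write $s^{-1}(v)=M_1\cup M_2$ with $M_1,M_2$ disjoint and nonempty. The (vertex) explosion of $G$ at $v$ with respect to this decomposition has vertex set $(G^0\setminus\{v\})\cup\{v',v''\}$ and the following edges: all edges of $G$ with neither source nor range equal to $v$; for each edge of $G$ from a vertex $u\ne v$ to $v$, one edge from $u$ to $v'$ and one from $u$ to $v''$; for each edge in $M_1$ from $v$ to $w\neq v$, an edge from $v'$ to $w$; for each edge in $M_2$ from $v$ to $w\ne v$, an edge from $v''$ to $w$; if the loop at $v$ exists and lies in $M_1$, a loop at $v'$ and an edge from $v'$ to $v''$; if it lies in $M_2$, a loop at $v''$ and an edge from $v''$ to $v'$. Reverse explosion. $F$ is a reverse explosion of $E$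 at a vertex $v$ if the reverse graph of $F$ is an explosion of the reverse graph of $E$ at $v$ and $v$ is cofinal in $E$. Graph algebra. For a row-finite graph $E$, a Cuntz-Krieger $E$-family consists of mutually orthogonal projections $\{P_v: v\in E^0\}$ and partial isometries $\{S_e:e\in E^1\}$ with $S_e^*S_e=P_{r(e)}$ for all $e$, and $P_v=\sum_{s(e)=v}S_eS_e^*$ for every $v\in s(E^1)$. $C^*(E)$ is the universal $C^*$-algebra generated by a Cuntz-Krieger $E$-family. *)

theory Defs
  imports
    "HOL-Analysis.Analysis"
    "HOL-Algebra.Module"
    "Graph_Theory.Digraph_Component"
begin

section \<open>Graphs\<close>

locale countable_graph = nomulti_digraph G for G :: "('v, 'e) pre_digraph" +
  assumes countable_verts: "countable (verts G)"
    and countable_arcs: "countable (arcs G)"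
    and connected: "Digraph_Component.connected G"

definition row_finite :: "('v, 'e) pre_digraph \<Rightarrow> bool" where
  "row_finite G \<longleftrightarrow> (\<forall>v\<in>verts G. finite (out_arcs G v))"

definition no_sinks :: "('v, 'e) pre_digraph \<Rightarrow> bool" where
  "no_sinks G \<longleftrightarrow> (\<forall>v\<in>verts G. out_arcs G v \<noteq> {})"

definition infinite_path :: "('v, 'e) pre_digraph \<Rightarrow> (nat \<Rightarrow> 'e) \<Rightarrow> bool" where
  "infinite_path G x \<longleftrightarrow> (\<forall>i. x i \<in> arcs G \<and> head G (x i) = tail G (x (Suc i)))"

definition cofinal :: "('v, 'e) pre_digraph \<Rightarrow> 'v \<Rightarrow> bool" where
  "cofinal G v \<longleftrightarrow> v \<in> verts G \<and>
     (\<forall>x. infinite_path G x \<longrightarrow> (\<exists>i. v \<rightarrow>\<^sup>*\<^bsub>G\<^esub> tail G (x i)))"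

definition reverse_graph :: "('v, 'e) pre_digraph \<Rightarrow> ('v, 'e) pre_digraph" where
  "reverse_graph G = \<lparr>verts = verts G, arcs = arcs G, tail = head G, head = tail G\<rparr>"

text \<open>
  \<open>H\<close> is the explosion of \<open>G\<close> at \<open>v\<close> with respect to the decomposition of the edges
  leaving \<open>v\<close> into \<open>M1\<close> and \<open>M2\<close>; the vertex \<open>v\<close> is replaced by \<open>v1\<close> and \<open>v2\<close>.
  Since \<open>H\<close> has no multiple edges, its edges are given by their pairs of ends, so that
  the type of edges of \<open>H\<close> is arbitrary.  More than one edge leaves \<open>v\<close>, because \<open>M1\<close>
  and \<open>M2\<close> are disjoint and nonempty.
\<close>

definition explosion_wrt ::
  "('v, 'e) pre_digraph \<Rightarrow> 'v \<Rightarrow> 'e set \<Rightarrow> 'e set \<Rightarrow> 'v \<Rightarrow> 'v \<Rightarrow> ('v, 'f) pre_digraph \<Rightarrow> bool" where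
  "explosion_wrt G v M1 M2 v1 v2 H \<longleftrightarrow>
     v \<in> verts G \<and>
     out_arcs G v = M1 \<union> M2 \<and> M1 \<inter> M2 = {} \<and> M1 \<noteq> {} \<and> M2 \<noteq> {} \<and>
     v1 \<noteq> v2 \<and> v1 \<notin> verts G - {v} \<and> v2 \<notin> verts G - {v} \<and>
     countable_graph H \<and>
     verts H = (verts G - {v}) \<union> {v1, v2} \<and>
     arcs_ends H =
       {(tail G e, head G e) | e. e \<in> arcs G \<and> tail G e \<noteq> v \<and> head G e \<noteq> v} \<union>
       {(tail G e, v1) | e. e \<in> arcs G \<and> tail G e \<noteq> v \<and> head G e = v} \<union>
       {(tail G e, v2) | e. e \<in> arcs G \<and> tail G e \<noteq> v \<and> head G e = v} \<union>
       {(v1, head G e) | e. e \<in> M1 \<and> head G e \<noteq> v} \<union>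
       {(v2, head G e) | e. e \<in> M2 \<and> head G e \<noteq> v} \<union>
       (if \<exists>e\<in>M1. head G e = v then {(v1, v1), (v1, v2)} else {}) \<union>
       (if \<exists>e\<in>M2. head G e = v then {(v2, v2), (v2, v1)} else {})"

definition explosion_at ::
  "('v, 'e) pre_digraph \<Rightarrow> 'v \<Rightarrow> ('v, 'f) pre_digraph \<Rightarrow> bool" where
  "explosion_at G v H \<longleftrightarrow> (\<exists>M1 M2 v1 v2. explosion_wrt G v M1 M2 v1 v2 H)"

definition reverse_explosion :: "('v, 'e) pre_digraph \<Rightarrow> ('v, 'f) pre_digraph \<Rightarrow> bool" where
  "reverse_explosion E F \<longleftrightarrow>
     (\<exists>v. explosion_at (reverse_graph E) v (reverse_graph F) \<and> cofinal E v)"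

section \<open>C*-algebras\<close>

text \<open>
  Complex vector spaces are modules over the ring of complex numbers.  The record
  \<^typ>\<open>('a, 'b) module\<close> extends that of rings; the field \<^const>\<open>one\<close> is left
  unconstrained below, as C*-algebras need not be unital.
\<close>

definition complex_ring :: "complex ring" where
  "complex_ring = \<lparr>carrier = UNIV, mult = (*), one = 1, zero = 0, add = (+)\<rparr>"

record 'a cstar = "(complex, 'a) module" +
  star :: "'a \<Rightarrow> 'a"
  cnorm :: "'a \<Rightarrow> real"

text \<open>Convergence in a carrier \<open>M\<close> with respect to a norm \<open>N\<close>.\<close>

definition norm_converges ::
  "('x, 'm) ring_scheme \<Rightarrow> ('x \<Rightarrow> real) \<Rightarrow> (nat \<Rightarrow> 'x) \<Rightarrow> 'x \<Rightarrow> bool" where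
  "norm_converges M N X L \<longleftrightarrow> (\<lambda>n. N (X n \<ominus>\<^bsub>M\<^esub> L)) \<longlonglongrightarrow> 0"

definition norm_complete :: "('x, 'm) ring_scheme \<Rightarrow> ('x \<Rightarrow> real) \<Rightarrow> bool" where
  "norm_complete M N \<longleftrightarrow>
     (\<forall>X. (\<forall>n. X n \<in> carrier M) \<and>
          (\<forall>e>0. \<exists>k. \<forall>m\<ge>k. \<forall>n\<ge>k. N (X m \<ominus>\<^bsub>M\<^esub> X n) < e) \<longrightarrow>
          (\<exists>L\<in>carrier M. norm_converges M N X L))"

locale cstar_algebra = module complex_ring A for A :: "'a cstar" (structure) +
  assumes mult_closed: "\<lbrakk>x \<in> carrier A; y \<in> carrier A\<rbrakk> \<Longrightarrow> x \<otimes> y \<in> carrier A"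
    and mult_assoc: "\<lbrakk>x \<in> carrier A; y \<in> carrier A; z \<in> carrier A\<rbrakk> \<Longrightarrow>
      (x \<otimes> y) \<otimes> z = x \<otimes> (y \<otimes> z)"
    and distrib_right: "\<lbrakk>x \<in> carrier A; y \<in> carrier A; z \<in> carrier A\<rbrakk> \<Longrightarrow>
      (x \<oplus> y) \<otimes> z = x \<otimes> z \<oplus> y \<otimes> z"
    and distrib_left: "\<lbrakk>x \<in> carrier A; y \<in> carrier A; z \<in> carrier A\<rbrakk> \<Longrightarrow>
      z \<otimes> (x \<oplus> y) = z \<otimes> x \<oplus> z \<otimes> y"
    and smult_mult_left: "\<lbrakk>x \<in> carrier A; y \<in> carrier A\<rbrakk> \<Longrightarrow>
      (c \<odot> x) \<otimes> y = c \<odot> (x \<otimes> y)"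
    and smult_mult_right: "\<lbrakk>x \<in> carrier A; y \<in> carrier A\<rbrakk> \<Longrightarrow>
      x \<otimes> (c \<odot> y) = c \<odot> (x \<otimes> y)"
    and star_closed: "x \<in> carrier A \<Longrightarrow> star A x \<in> carrier A"
    and star_add: "\<lbrakk>x \<in> carrier A; y \<in> carrier A\<rbrakk> \<Longrightarrow>
      star A (x \<oplus> y) = star A x \<oplus> star A y"
    and star_smult: "x \<in> carrier A \<Longrightarrow> star A (c \<odot> x) = cnj c \<odot> star A x"
    and star_mult: "\<lbrakk>x \<in> carrier A; y \<in> carrier A\<rbrakk> \<Longrightarrow>
      star A (x \<otimes> y) = star A y \<otimes> star A x"
    and star_star: "x \<in> carrier A \<Longrightarrow> star A (star A x) = x"
    and cnorm_nonneg: "x \<in> carrier A \<Longrightarrow> 0 \<le> cnorm A x"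
    and cnorm_eq_zero: "x \<in> carrier A \<Longrightarrow> cnorm A x = 0 \<longleftrightarrow> x = \<zero>"
    and cnorm_triangle: "\<lbrakk>x \<in> carrier A; y \<in> carrier A\<rbrakk> \<Longrightarrow>
      cnorm A (x \<oplus> y) \<le> cnorm A x + cnorm A y"
    and cnorm_smult: "x \<in> carrier A \<Longrightarrow> cnorm A (c \<odot> x) = cmod c * cnorm A x"
    and cnorm_mult: "\<lbrakk>x \<in> carrier A; y \<in> carrier A\<rbrakk> \<Longrightarrow>
      cnorm A (x \<otimes> y) \<le> cnorm A x * cnorm A y"
    and cstar_identity: "x \<in> carrier A \<Longrightarrow> cnorm A (star A x \<otimes> x) = (cnorm A x)\<^sup>2"
    and complete: "norm_complete A (cnorm A)"

definition positive :: "'a cstar \<Rightarrow> 'a \<Rightarrow> bool" where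
  "positive A a \<longleftrightarrow> (\<exists>b\<in>carrier A. a = star A b \<otimes>\<^bsub>A\<^esub> b)"

definition closed_subspace :: "'a cstar \<Rightarrow> 'a set \<Rightarrow> bool" where
  "closed_subspace A H \<longleftrightarrow>
     H \<subseteq> carrier A \<and> \<zero>\<^bsub>A\<^esub> \<in> H \<and>
     (\<forall>x\<in>H. \<forall>y\<in>H. x \<oplus>\<^bsub>A\<^esub> y \<in> H) \<and>
     (\<forall>c. \<forall>x\<in>H. c \<odot>\<^bsub>A\<^esub> x \<in> H) \<and>
     (\<forall>X. \<forall>L\<in>carrier A. (\<forall>n. X n \<in> H) \<and> norm_converges A (cnorm A) X L \<longrightarrow> L \<in> H)"

definition cstar_subalgebra :: "'a cstar \<Rightarrow> 'a set \<Rightarrow> bool" where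
  "cstar_subalgebra A H \<longleftrightarrow>
     closed_subspace A H \<and>
     (\<forall>x\<in>H. \<forall>y\<in>H. x \<otimes>\<^bsub>A\<^esub> y \<in> H) \<and>
     (\<forall>x\<in>H. star A x \<in> H)"

definition star_hom :: "'a cstar \<Rightarrow> 'b cstar \<Rightarrow> ('a \<Rightarrow> 'b) \<Rightarrow> bool" where
  "star_hom A B h \<longleftrightarrow>
     (\<forall>x\<in>carrier A. h x \<in> carrier B) \<and>
     (\<forall>x\<in>carrier A. \<forall>y\<in>carrier A. h (x \<oplus>\<^bsub>A\<^esub> y) = h x \<oplus>\<^bsub>B\<^esub> h y) \<and>
     (\<forall>c. \<forall>x\<in>carrier A. h (c \<odot>\<^bsub>A\<^esub> x) = c \<odot>\<^bsub>B\<^esub> h x) \<and>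
     (\<forall>x\<in>carrier A. \<forall>y\<in>carrier A. h (x \<otimes>\<^bsub>A\<^esub> y) = h x \<otimes>\<^bsub>B\<^esub> h y) \<and>
     (\<forall>x\<in>carrier A. h (star A x) = star B (h x))"

section \<open>Graph algebras\<close>

definition projection :: "'a cstar \<Rightarrow> 'a \<Rightarrow> bool" where
  "projection A p \<longleftrightarrow> p \<in> carrier A \<and> star A p = p \<and> p \<otimes>\<^bsub>A\<^esub> p = p"

definition partial_isometry :: "'a cstar \<Rightarrow> 'a \<Rightarrow> bool" where
  "partial_isometry A s \<longleftrightarrow> s \<in> carrier A \<and> s \<otimes>\<^bsub>A\<^esub> star A s \<otimes>\<^bsub>A\<^esub> s = s"

text \<open>
  Only meant for row-finite graphs: \<^const>\<open>finsum\<close> over an infinite set is junk.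
\<close>

definition ck_family ::
  "('v, 'e) pre_digraph \<Rightarrow> 'a cstar \<Rightarrow> ('v \<Rightarrow> 'a) \<Rightarrow> ('e \<Rightarrow> 'a) \<Rightarrow> bool" where
  "ck_family G A P S \<longleftrightarrow>
     (\<forall>v\<in>verts G. projection A (P v)) \<and>
     (\<forall>v\<in>verts G. \<forall>w\<in>verts G. v \<noteq> w \<longrightarrow> P v \<otimes>\<^bsub>A\<^esub> P w = \<zero>\<^bsub>A\<^esub>) \<and>
     (\<forall>e\<in>arcs G. partial_isometry A (S e)) \<and>
     (\<forall>e\<in>arcs G. star A (S e) \<otimes>\<^bsub>A\<^esub> S e = P (head G e)) \<and>
     (\<forall>v\<in>tail G ` arcs G.
        P v = finsum A (\<lambda>e. S e \<otimes>\<^bsub>A\<^esub> star A (S e)) (out_arcs G v))"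

text \<open>
  \<open>A\<close> together with \<open>P\<close>, \<open>S\<close> is the universal C*-algebra generated by a
  Cuntz-Krieger family of \<open>G\<close>, i.e. \<open>A\<close> is the C*-algebra of \<open>G\<close> (determined up to
  isomorphism).

  In the universal property, the C*-algebras \<open>B\<close> are those with elements in
  \<^typ>\<open>nat \<Rightarrow> complex\<close>, since HOL cannot quantify over types.  This is no restriction: a
  Cuntz-Krieger family of a countable graph in any C*-algebra generates a separable
  C*-subalgebra, which has at most continuum many elements and hence is isomorphic to one
  whose carrier is a subset of \<^typ>\<open>nat \<Rightarrow> complex\<close> (with arbitrary operations and norm).
\<close>

definition graph_algebra ::
  "('v, 'e) pre_digraph \<Rightarrow> 'a cstar \<Rightarrow> ('v \<Rightarrow> 'a) \<Rightarrow> ('e \<Rightarrow> 'a) \<Rightarrow> bool" where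
  "graph_algebra G A P S \<longleftrightarrow>
     cstar_algebra A \<and>
     ck_family G A P S \<and>
     (\<forall>H. cstar_subalgebra A H \<and> P ` verts G \<subseteq> H \<and> S ` arcs G \<subseteq> H \<longrightarrow> H = carrier A) \<and>
     (\<forall>(B :: (nat \<Rightarrow> complex) cstar) Q T. cstar_algebra B \<and> ck_family G B Q T \<longrightarrow>
        (\<exists>h. star_hom A B h \<and> (\<forall>v\<in>verts G. h (P v) = Q v) \<and> (\<forall>e\<in>arcs G. h (S e) = T e)))"

section \<open>Morita equivalence\<close>

text \<open>
  An imprimitivity bimodule in the sense of Rieffel: a bimodule \<open>X\<close> over \<open>A\<close> and \<open>B\<close> which is
  a full left Hilbert \<open>A\<close>-module and a full right Hilbert \<open>B\<close>-module, on which both algebras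
  act by adjointable operators, and with compatible inner products.  The inner product
  \<open>linner\<close> is linear in the first and \<open>rinner\<close> in the second variable.  The ring
  multiplication and unit contained in the record are not used.
\<close>

record ('a, 'b, 'x) bimodule = "(complex, 'x) module" +
  lact :: "'a \<Rightarrow> 'x \<Rightarrow> 'x"
  ract :: "'x \<Rightarrow> 'b \<Rightarrow> 'x"
  linner :: "'x \<Rightarrow> 'x \<Rightarrow> 'a"
  rinner :: "'x \<Rightarrow> 'x \<Rightarrow> 'b"

locale left_hilbert_module =
  alg: cstar_algebra A + vs: module complex_ring X
  for A :: "'a cstar" and X :: "('a, 'b, 'x) bimodule" +
  assumes lact_closed: "\<lbrakk>a \<in> carrier A; x \<in> carrier X\<rbrakk> \<Longrightarrow> lact X a x \<in> carrier X"
    and lact_add_left: "\<lbrakk>a \<in> carrier A; a' \<in> carrier A; x \<in> carrier X\<rbrakk> \<Longrightarrow>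
      lact X (a \<oplus>\<^bsub>A\<^esub> a') x = lact X a x \<oplus>\<^bsub>X\<^esub> lact X a' x"
    and lact_add_right: "\<lbrakk>a \<in> carrier A; x \<in> carrier X; y \<in> carrier X\<rbrakk> \<Longrightarrow>
      lact X a (x \<oplus>\<^bsub>X\<^esub> y) = lact X a x \<oplus>\<^bsub>X\<^esub> lact X a y"
    and lact_smult_left: "\<lbrakk>a \<in> carrier A; x \<in> carrier X\<rbrakk> \<Longrightarrow>
      lact X (c \<odot>\<^bsub>A\<^esub> a) x = c \<odot>\<^bsub>X\<^esub> lact X a x"
    and lact_smult_right: "\<lbrakk>a \<in> carrier A; x \<in> carrier X\<rbrakk> \<Longrightarrow>
      lact X a (c \<odot>\<^bsub>X\<^esub> x) = c \<odot>\<^bsub>X\<^esub> lact X a x"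
    and lact_mult: "\<lbrakk>a \<in> carrier A; a' \<in> carrier A; x \<in> carrier X\<rbrakk> \<Longrightarrow>
      lact X (a \<otimes>\<^bsub>A\<^esub> a') x = lact X a (lact X a' x)"
    and linner_closed: "\<lbrakk>x \<in> carrier X; y \<in> carrier X\<rbrakk> \<Longrightarrow> linner X x y \<in> carrier A"
    and linner_add: "\<lbrakk>x \<in> carrier X; y \<in> carrier X; z \<in> carrier X\<rbrakk> \<Longrightarrow>
      linner X (x \<oplus>\<^bsub>X\<^esub> y) z = linner X x z \<oplus>\<^bsub>A\<^esub> linner X y z"
    and linner_smult: "\<lbrakk>x \<in> carrier X; y \<in> carrier X\<rbrakk> \<Longrightarrow>
      linner X (c \<odot>\<^bsub>X\<^esub> x) y = c \<odot>\<^bsub>A\<^esub> linner X x y"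
    and linner_lact: "\<lbrakk>a \<in> carrier A; x \<in> carrier X; y \<in> carrier X\<rbrakk> \<Longrightarrow>
      linner X (lact X a x) y = a \<otimes>\<^bsub>A\<^esub> linner X x y"
    and linner_star: "\<lbrakk>x \<in> carrier X; y \<in> carrier X\<rbrakk> \<Longrightarrow>
      star A (linner X x y) = linner X y x"
    and linner_positive: "x \<in> carrier X \<Longrightarrow> positive A (linner X x x)"
    and linner_definite: "\<lbrakk>x \<in> carrier X; linner X x x = \<zero>\<^bsub>A\<^esub>\<rbrakk> \<Longrightarrow> x = \<zero>\<^bsub>X\<^esub>"
    and lcomplete: "norm_complete X (\<lambda>x. sqrt (cnorm A (linner X x x)))"
    and lfull: "\<lbrakk>closed_subspace A H;
        \<And>x y. \<lbrakk>x \<in> carrier X; y \<in> carrier X\<rbrakk> \<Longrightarrow> linner X x y \<in> H\<rbrakk> \<Longrightarrow> H = carrier A"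

locale right_hilbert_module =
  alg: cstar_algebra B + vs: module complex_ring X
  for B :: "'b cstar" and X :: "('a, 'b, 'x) bimodule" +
  assumes ract_closed: "\<lbrakk>b \<in> carrier B; x \<in> carrier X\<rbrakk> \<Longrightarrow> ract X x b \<in> carrier X"
    and ract_add_right: "\<lbrakk>b \<in> carrier B; b' \<in> carrier B; x \<in> carrier X\<rbrakk> \<Longrightarrow>
      ract X x (b \<oplus>\<^bsub>B\<^esub> b') = ract X x b \<oplus>\<^bsub>X\<^esub> ract X x b'"
    and ract_add_left: "\<lbrakk>b \<in> carrier B; x \<in> carrier X; y \<in> carrier X\<rbrakk> \<Longrightarrow>
      ract X (x \<oplus>\<^bsub>X\<^esub> y) b = ract X x b \<oplus>\<^bsub>X\<^esub> ract X y b"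
    and ract_smult_right: "\<lbrakk>b \<in> carrier B; x \<in> carrier X\<rbrakk> \<Longrightarrow>
      ract X x (c \<odot>\<^bsub>B\<^esub> b) = c \<odot>\<^bsub>X\<^esub> ract X x b"
    and ract_smult_left: "\<lbrakk>b \<in> carrier B; x \<in> carrier X\<rbrakk> \<Longrightarrow>
      ract X (c \<odot>\<^bsub>X\<^esub> x) b = c \<odot>\<^bsub>X\<^esub> ract X x b"
    and ract_mult: "\<lbrakk>b \<in> carrier B; b' \<in> carrier B; x \<in> carrier X\<rbrakk> \<Longrightarrow>
      ract X x (b \<otimes>\<^bsub>B\<^esub> b') = ract X (ract X x b) b'"
    and rinner_closed: "\<lbrakk>x \<in> carrier X; y \<in> carrier X\<rbrakk> \<Longrightarrow> rinner X x y \<in> carrier B"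
    and rinner_add: "\<lbrakk>x \<in> carrier X; y \<in> carrier X; z \<in> carrier X\<rbrakk> \<Longrightarrow>
      rinner X z (x \<oplus>\<^bsub>X\<^esub> y) = rinner X z x \<oplus>\<^bsub>B\<^esub> rinner X z y"
    and rinner_smult: "\<lbrakk>x \<in> carrier X; y \<in> carrier X\<rbrakk> \<Longrightarrow>
      rinner X x (c \<odot>\<^bsub>X\<^esub> y) = c \<odot>\<^bsub>B\<^esub> rinner X x y"
    and rinner_ract: "\<lbrakk>b \<in> carrier B; x \<in> carrier X; y \<in> carrier X\<rbrakk> \<Longrightarrow>
      rinner X x (ract X y b) = rinner X x y \<otimes>\<^bsub>B\<^esub> b"
    and rinner_star: "\<lbrakk>x \<in> carrier X; y \<in> carrier X\<rbrakk> \<Longrightarrow>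
      star B (rinner X x y) = rinner X y x"
    and rinner_positive: "x \<in> carrier X \<Longrightarrow> positive B (rinner X x x)"
    and rinner_definite: "\<lbrakk>x \<in> carrier X; rinner X x x = \<zero>\<^bsub>B\<^esub>\<rbrakk> \<Longrightarrow> x = \<zero>\<^bsub>X\<^esub>"
    and rcomplete: "norm_complete X (\<lambda>x. sqrt (cnorm B (rinner X x x)))"
    and rfull: "\<lbrakk>closed_subspace B H;
        \<And>x y. \<lbrakk>x \<in> carrier X; y \<in> carrier X\<rbrakk> \<Longrightarrow> rinner X x y \<in> H\<rbrakk> \<Longrightarrow> H = carrier B"

locale imprimitivity_bimodule =
  left: left_hilbert_module A X + right: right_hilbert_module B X
  for A :: "'a cstar" and B :: "'b cstar" and X :: "('a, 'b, 'x) bimodule" +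
  assumes act_assoc: "\<lbrakk>a \<in> carrier A; x \<in> carrier X; b \<in> carrier B\<rbrakk> \<Longrightarrow>
      lact X a (ract X x b) = ract X (lact X a x) b"
    and rinner_lact: "\<lbrakk>a \<in> carrier A; x \<in> carrier X; y \<in> carrier X\<rbrakk> \<Longrightarrow>
      rinner X (lact X a x) y = rinner X x (lact X (star A a) y)"
    and linner_ract: "\<lbrakk>b \<in> carrier B; x \<in> carrier X; y \<in> carrier X\<rbrakk> \<Longrightarrow>
      linner X (ract X x b) y = linner X x (ract X y (star B b))"
    and inner_compatible: "\<lbrakk>x \<in> carrier X; y \<in> carrier X; z \<in> carrier X\<rbrakk> \<Longrightarrow>
      lact X (linner X x y) z = ract X x (rinner X y z)"

text \<open>
  The choice of the type \<^typ>\<open>'a \<times> 'b\<close> for the elements of the bimodule is no restriction,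
  as the cardinality of an imprimitivity bimodule over \<open>A\<close> and \<open>B\<close> is at most that of
  \<open>carrier A \<times> carrier B\<close>.
\<close>

definition morita_equivalent :: "'a cstar \<Rightarrow> 'b cstar \<Rightarrow> bool" where
  "morita_equivalent A B \<longleftrightarrow>
     (\<exists>X :: ('a, 'b, 'a \<times> 'b) bimodule. imprimitivity_bimodule A B X)"

end

theory Submission
  imports Defs
begin

text \<open>
  A reverse explosion is an in-splitting: every vertex of \<open>F\<close> lying over \<open>w\<close> emits a copy of the
  edges leaving \<open>w\<close>, and only \<open>v\<close> has two preimages \<open>v1\<close>, \<open>v2\<close>.  In \<open>C*(F)\<close> the projections of
  \<open>v1\<close> and \<open>v2\<close> are equivalent through the partial isometry \<open>U\<close> which sums
  \<open>T\<^sub>f T\<^sub>g\<^sup>*\<close> over the pairs of copies \<open>f\<close>, \<open>g\<close> of an edge leaving \<open>v\<close>.  Using \<open>U\<close> to redirect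
  to \<open>v1\<close> the edges entering \<open>v2\<close> gives a Cuntz-Krieger family of \<open>E\<close>, which generates the full
  corner of \<open>C*(F)\<close> cut out by \<open>1 - Q\<^sub>v\<^sub>2\<close>.  Conversely, two by two matrices over \<open>C*(E)\<close> contain a
  Cuntz-Krieger family of \<open>F\<close>, in which \<open>v2\<close> is represented in the second row and column.
  Composing \<open>C*(E) \<rightarrow> C*(F) \<rightarrow> M\<^sub>2(C*(E))\<close> gives \<open>a \<mapsto> diag(a, 0)\<close>, so the first map is
  isometric and no uniqueness theorem for graph algebras is needed.

  The C*-theory behind this rests on the binomial series of \<open>sqrt (1 - x)\<close> in place of spectral theory.
\<close>

text \<open>C*(F) has no unit when F has infinitely many vertices, yet the corner is cut out by a
  complementary projection. Algebras given by carriers are therefore represented inside algebras of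
  adjointable operators, which form a type with a unit, and closed subalgebras become mere subsets
  of such a type; square roots must then be shown to stay inside subalgebras without unit. Three
  facts rest on these roots: \<open>adj x * x\<close> is positive, homomorphisms are contractive,
  and projections adding up to a projection are orthogonal. The first makes columns of height two a
  Hilbert module, which gives the matrices a C*-norm. The last supplies the orthogonality of the
  ranges of edges with a common source, which the Cuntz-Krieger relations do not list. A second
  obstacle is that the universal property speaks only of C*-algebras with elements in
  \<open>nat \<Rightarrow> complex\<close>: a family living elsewhere is first enclosed in a
  separable closed subalgebra, which is copied into that type. Isometry of the map out of C*(E)
  matters because the left inner product of the bimodule is computed in the corner and must be read
  back in C*(E) with the same norm.\<close>

section \<open>Unital C*-algebras as a type class\<close>

text \<open>
  The complex scalars are given by the real ones and the central element \<open>iu\<close>.  There is no axiom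
  \<open>0 \<noteq> 1\<close>, because the operators on the product of all C*-algebras on a type form the zero
  algebra if that type admits no other C*-algebra.
\<close>

class cstar_unital = real_normed_algebra + banach + monoid_mult +
  fixes adj :: "'a \<Rightarrow> 'a" and iu :: 'a
  assumes adj_add: "adj (x + y) = adj x + adj y"
    and adj_scaleR: "adj (r *\<^sub>R x) = r *\<^sub>R adj x"
    and adj_mult: "adj (x * y) = adj y * adj x"
    and adj_adj [simp]: "adj (adj x) = x"
    and iu_mult_iu: "iu * iu = - 1"
    and iu_commute: "iu * x = x * iu"
    and adj_iu: "adj iu = - iu"
    and norm_adj_mult_self: "norm (adj x * x) = (norm x)\<^sup>2"

context cstar_unital
begin

definition scaleC :: "complex \<Rightarrow> 'a \<Rightarrow> 'a" where
  "scaleC c x = Re c *\<^sub>R x + Im c *\<^sub>R (iu * x)"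

end

lemma adj_zero [simp]: "adj (0::'a::cstar_unital) = 0"
  using adj_scaleR[of 0 "0::'a"] by simp

lemma adj_minus: "adj (- x) = - adj (x::'a::cstar_unital)"
  using adj_scaleR[of "-1" x] by simp

lemma adj_diff: "adj (x - y) = adj x - adj (y::'a::cstar_unital)"
  using adj_add[of x "- y"] by (simp add: adj_minus)

lemma adj_one [simp]: "adj (1::'a::cstar_unital) = 1"
  by (metis adj_adj adj_mult mult_1_left mult_1_right)

lemma adj_sum: "adj (\<Sum>i\<in>I. f i) = (\<Sum>i\<in>I. adj (f i :: 'a::cstar_unital))"
  by (induction I rule: infinite_finite_induct) (simp_all add: adj_add)

lemma norm_adj_le: "norm x \<le> norm (adj (x::'a::cstar_unital))"
proof (cases "norm x = 0")
  case False
  have "norm x * norm x \<le> norm (adj x) * norm x"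
    using norm_adj_mult_self[of x] norm_mult_ineq[of "adj x" x] by (simp add: power2_eq_square)
  then show ?thesis using False by simp
qed simp

lemma norm_adj [simp]: "norm (adj x) = norm (x::'a::cstar_unital)"
  using norm_adj_le[of x] norm_adj_le[of "adj x"] by simp

lemma norm_mult_adj_self: "norm (x * adj x) = (norm (x::'a::cstar_unital))\<^sup>2"
  using norm_adj_mult_self[of "adj x"] by simp

lemma bounded_linear_adj: "bounded_linear (adj :: 'a::cstar_unital \<Rightarrow> 'a)"
  by (rule bounded_linear_intro[where K=1]) (simp_all add: adj_add adj_scaleR)

lemma adj_mult_self_eq_0: "adj x * x = 0 \<longleftrightarrow> x = (0::'a::cstar_unital)"
  using norm_adj_mult_self[of x] by auto

text \<open>The C*-identity makes the norm n of the unit satisfy n = n * n, so n is 0 or 1. The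
  value 0 occurs in the zero algebra, which the class admits.\<close>

lemma norm_one_le: "norm (1::'a::cstar_unital) \<le> 1"
proof -
  have "norm (1::'a) = (norm (1::'a))\<^sup>2"
    using norm_adj_mult_self[of "1::'a"] by simp
  then have "norm (1::'a) * (norm (1::'a) - 1) = 0" by (simp add: power2_eq_square algebra_simps)
  then show ?thesis by auto
qed

lemma norm_power_le_one:
  fixes x :: "'a::cstar_unital"
  assumes "norm x \<le> 1"
  shows "norm (x ^ n) \<le> 1"
proof (induction n)
  case 0 then show ?case by (simp add: norm_one_le)
next
  case (Suc n)
  have "norm (x * x ^ n) \<le> norm x * norm (x ^ n)" by (rule norm_mult_ineq)
  also have "\<dots> \<le> 1 * 1" using assms Suc by (intro mult_mono) auto
  finally show ?case by simp
qed

text \<open>The class assumes homogeneity of the norm for real scalars only. For complex ones it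
  follows from the C*-identity: in \<open>adj (scaleC c x) * scaleC c x\<close> the mixed terms
  cancel because \<open>iu\<close> is central and skew-adjoint.\<close>

lemma norm_scaleC: "norm (scaleC c x) = cmod c * norm (x::'a::cstar_unital)"
proof -
  let ?x = "scaleC c x"
  have "adj ?x * ?x = ((Re c)\<^sup>2 + (Im c)\<^sup>2) *\<^sub>R (adj x * x)"
  proof -
    have i1: "adj x * (iu * x) = iu * (adj x * x)"
      by (metis iu_commute mult.assoc)
    have i3: "iu * (iu * (adj x * x)) = - (adj x * x)"
      by (simp add: iu_mult_iu flip: mult.assoc)
    have ax: "adj ?x = Re c *\<^sub>R adj x - Im c *\<^sub>R (iu * adj x)"
      by (simp add: scaleC_def adj_add adj_scaleR adj_mult adj_iu iu_commute)
    show ?thesis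
      unfolding ax unfolding scaleC_def distrib_left left_diff_distrib
      by (simp add: mult.assoc i1 i3 power2_eq_square scaleR_add_left mult.commute)
  qed
  then have "(norm ?x)\<^sup>2 = (cmod c * norm x)\<^sup>2"
    using norm_adj_mult_self[of ?x] norm_adj_mult_self[of x]
    by (simp add: cmod_power2 power_mult_distrib sum_power2_ge_zero)
  then show ?thesis by (simp add: power2_eq_iff_nonneg)
qed

section \<open>The binomial series of the square root\<close>

text \<open>The Taylor coefficients 1, -1/2, -1/8, ... of sqrt (1 - x) at 0.\<close>

definition sqrt_coeff :: "nat \<Rightarrow> real" where
  "sqrt_coeff n = (1/2 gchoose n) * (- 1) ^ n"

lemma gbinomial_Suc_eq: "(a::real) gchoose Suc n = (a gchoose n) * (a - of_nat n) / of_nat (Suc n)"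
  by (simp add: gbinomial_prod_rev field_simps)

lemma sqrt_coeff_0 [simp]: "sqrt_coeff 0 = 1"
  by (simp add: sqrt_coeff_def)

lemma sqrt_coeff_Suc: "sqrt_coeff (Suc n) = sqrt_coeff n * (real n - 1/2) / real (Suc n)"
  by (simp add: sqrt_coeff_def gbinomial_Suc_eq field_simps)

lemma sqrt_coeff_Suc_le: "sqrt_coeff (Suc n) \<le> 0"
proof (induction n)
  case 0 then show ?case by (simp add: sqrt_coeff_Suc[of 0])
next
  case (Suc n)
  then show ?case
    unfolding sqrt_coeff_Suc[of "Suc n"] by (intro divide_nonpos_nonneg mult_nonpos_nonneg) auto
qed

text \<open>The partial sums are the coefficients of sqrt (1 - x) / (1 - x), that is, of (1 - x) to
  the power -1/2, and those are positive.\<close>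

lemma sum_sqrt_coeff_nonneg: "0 \<le> (\<Sum>i\<le>m. sqrt_coeff i)"
proof -
  have "0 \<le> (-1) ^ m * ((-1/2::real) gchoose m)"
  proof (induction m)
    case (Suc m)
    have "(-1) ^ Suc m * ((-1/2::real) gchoose Suc m)
        = ((-1) ^ m * ((-1/2::real) gchoose m)) * (real m + 1/2) / real (Suc m)"
      unfolding gbinomial_Suc_eq by (simp add: field_simps)
    also have "\<dots> \<ge> 0" by (rule divide_nonneg_nonneg[OF mult_nonneg_nonneg[OF Suc]]) auto
    finally show ?case .
  qed simp
  then show ?thesis
    unfolding sqrt_coeff_def gbinomial_sum_lower_neg by simp
qed

text \<open>Vandermonde's identity for 1/2 + 1/2 = 1: the square of the series has to be 1 -
  x.\<close>

lemma sqrt_coeff_convolution: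
  "(\<Sum>i\<le>k. sqrt_coeff i * sqrt_coeff (k - i)) = (if k = 0 then 1 else if k = 1 then -1 else 0)"
proof -
  have "(\<Sum>i\<le>k. sqrt_coeff i * sqrt_coeff (k - i))
      = (-1) ^ k * (\<Sum>i\<in>{0..k}. (1/2 gchoose i) * (1/2 gchoose (k - i)))"
    unfolding sum_distrib_left
  proof (rule sum.cong)
    fix i assume "i \<in> {0..k}"
    then have "(-1::real) ^ k = (-1) ^ i * (-1) ^ (k - i)" by (simp flip: power_add)
    then show "sqrt_coeff i * sqrt_coeff (k - i)
        = (-1) ^ k * ((1/2 gchoose i) * (1/2 gchoose (k - i)))"
      by (simp add: sqrt_coeff_def)
  qed auto
  also have "\<dots> = (-1) ^ k * (1 gchoose k)" by (simp add: gbinomial_Vandermonde)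
  also have "(1::real) gchoose k = of_nat (1 choose k)"
    by (metis binomial_gbinomial of_nat_1)
  finally show ?thesis by (cases k) (auto simp: binomial_eq_0)
qed

lemma sum_abs_sqrt_coeff: "(\<Sum>i\<le>m. \<bar>sqrt_coeff i\<bar>) = 2 - (\<Sum>i\<le>m. sqrt_coeff i)"
proof (induction m)
  case (Suc m)
  then show ?case using sqrt_coeff_Suc_le[of m] by simp
qed simp

text \<open>All coefficients but the first are nonpositive, so the absolute values add up to 2 minus
  a nonnegative partial sum. Hence the series converges on the whole closed unit ball, norm 1
  included.\<close>

lemma summable_abs_sqrt_coeff: "summable (\<lambda>n. \<bar>sqrt_coeff n\<bar>)"
proof (rule bounded_imp_summable)
  show "(\<Sum>i\<le>m. \<bar>sqrt_coeff i\<bar>) \<le> 2" for m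
    using sum_sqrt_coeff_nonneg[of m] by (simp add: sum_abs_sqrt_coeff)
qed auto

lemma summable_sqrt_coeff: "summable sqrt_coeff"
  using summable_abs_sqrt_coeff by (rule summable_rabs_cancel)

lemma summable_norm_sqrt_series:
  fixes x :: "'a::cstar_unital"
  assumes "norm x \<le> 1"
  shows "summable (\<lambda>n. norm (sqrt_coeff n *\<^sub>R x ^ n))"
proof (rule summable_comparison_test'[OF summable_abs_sqrt_coeff])
  show "norm (norm (sqrt_coeff n *\<^sub>R x ^ n)) \<le> \<bar>sqrt_coeff n\<bar>" for n
    using mult_left_le[OF norm_power_le_one[OF assms, of n], of "\<bar>sqrt_coeff n\<bar>"] by simp
qed

section \<open>The square root of 1 - x in a C*-algebra\<close>

definition sqrt_one_minus :: "'a \<Rightarrow> 'a::cstar_unital" where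
  "sqrt_one_minus x = (\<Sum>n. sqrt_coeff n *\<^sub>R x ^ n)"

lemma sqrt_one_minus_sums:
  fixes x :: "'a::cstar_unital"
  assumes "norm x \<le> 1"
  shows "(\<lambda>n. sqrt_coeff n *\<^sub>R x ^ n) sums sqrt_one_minus x"
  unfolding sqrt_one_minus_def
  using summable_norm_cancel[OF summable_norm_sqrt_series[OF assms]] by (rule summable_sums)

lemma sqrt_one_minus_square:
  fixes x :: "'a::cstar_unital"
  assumes "norm x \<le> 1"
  shows "sqrt_one_minus x * sqrt_one_minus x = 1 - x"
proof -
  let ?a = "\<lambda>n. sqrt_coeff n *\<^sub>R x ^ n"
  have "(\<lambda>k. \<Sum>i\<le>k. ?a i * ?a (k - i)) sums (sqrt_one_minus x * sqrt_one_minus x)"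
    unfolding sqrt_one_minus_def
    by (rule Cauchy_product_sums) (rule summable_norm_sqrt_series[OF assms])+
  moreover have "(\<Sum>i\<le>k. ?a i * ?a (k - i))
      = (if k = 0 then 1 else if k = 1 then -1 else 0) *\<^sub>R x ^ k" for k
  proof -
    have "(\<Sum>i\<le>k. ?a i * ?a (k - i)) = (\<Sum>i\<le>k. (sqrt_coeff i * sqrt_coeff (k - i)) *\<^sub>R x ^ k)"
      by (rule sum.cong) (auto simp flip: power_add)
    also have "\<dots> = (\<Sum>i\<le>k. sqrt_coeff i * sqrt_coeff (k - i)) *\<^sub>R x ^ k"
      by (simp add: scaleR_left.sum)
    finally show ?thesis by (simp add: sqrt_coeff_convolution)
  qed
  ultimately have "(\<lambda>k. (if k = 0 then 1 else if k = 1 then -1 else 0) *\<^sub>R x ^ k)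
      sums (sqrt_one_minus x * sqrt_one_minus x)"
    by simp
  moreover have "(\<lambda>k. (if k = 0 then 1 else if k = 1 then -1 else 0) *\<^sub>R x ^ k)
      sums (\<Sum>k\<in>{0,1}. (if k = 0 then 1 else if k = 1 then -1 else 0::real) *\<^sub>R x ^ k)"
    by (rule sums_finite) auto
  ultimately show ?thesis using sums_unique2 by fastforce
qed

text \<open>The sum is the value of the series at x = 1, whose square is 1 - 1 = 0.\<close>

lemma sums_sqrt_coeff: "sqrt_coeff sums 0"
proof -
  have "(\<lambda>k. \<Sum>i\<le>k. sqrt_coeff i * sqrt_coeff (k - i)) sums (suminf sqrt_coeff * suminf sqrt_coeff)"
    by (rule Cauchy_product_sums) (simp_all add: summable_abs_sqrt_coeff)
  moreover have "(\<lambda>k. if k = 0 then 1 else if k = 1 then -1 else 0)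
      sums (\<Sum>k\<in>{0,1::nat}. (if k = 0 then 1 else if k = 1 then -1 else 0::real))"
    by (rule sums_finite) auto
  ultimately have "suminf sqrt_coeff * suminf sqrt_coeff = 0"
    using sums_unique2 by (fastforce simp: sqrt_coeff_convolution)
  then show ?thesis using summable_sums[OF summable_sqrt_coeff] by simp
qed

lemma sqrt_one_minus_commute:
  fixes x :: "'a::cstar_unital"
  assumes x: "norm x \<le> 1" and y: "x * y = y * x"
  shows "sqrt_one_minus x * y = y * sqrt_one_minus x"
proof -
  have "x ^ n * y = y * x ^ n" for n
    by (induction n) (simp_all add: y mult.assoc, metis y mult.assoc)
  then have "(\<lambda>n. (sqrt_coeff n *\<^sub>R x ^ n) * y) = (\<lambda>n. y * (sqrt_coeff n *\<^sub>R x ^ n))"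
    by simp
  then show ?thesis
    using sums_mult2[OF sqrt_one_minus_sums[OF x], of y] sums_mult[OF sqrt_one_minus_sums[OF x], of y]
      sums_unique2 by metis
qed

lemma adj_sqrt_one_minus:
  fixes x :: "'a::cstar_unital"
  assumes x: "norm x \<le> 1" and "adj x = x"
  shows "adj (sqrt_one_minus x) = sqrt_one_minus x"
proof -
  have "adj (x ^ n) = x ^ n" for n
    by (induction n) (simp_all add: adj_mult assms power_commutes)
  then have "(\<lambda>n. adj (sqrt_coeff n *\<^sub>R x ^ n)) = (\<lambda>n. sqrt_coeff n *\<^sub>R x ^ n)"
    by (simp add: adj_scaleR)
  then show ?thesis
    using bounded_linear.sums[OF bounded_linear_adj sqrt_one_minus_sums[OF x]]
      sqrt_one_minus_sums[OF x] sums_unique2 by metis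
qed

text \<open>By \<open>sums_sqrt_coeff\<close> the coefficients after the first add up to -1. They
  all have the same sign, so with powers of norm at most 1 the tail of the series has norm at most
  1.\<close>

lemma norm_one_minus_sqrt_one_minus:
  fixes x :: "'a::cstar_unital"
  assumes "norm x \<le> 1"
  shows "norm (1 - sqrt_one_minus x) \<le> 1"
proof -
  have s: "(\<lambda>n. sqrt_coeff (Suc n) *\<^sub>R x ^ Suc n) sums (sqrt_one_minus x - 1)"
    using sqrt_one_minus_sums[OF assms] by (subst sums_Suc_iff) simp
  have t: "(\<lambda>n. - sqrt_coeff (Suc n)) sums 1"
    using sums_minus[of "\<lambda>n. sqrt_coeff (Suc n)" "-1"] sums_sqrt_coeff by (simp add: sums_Suc_iff)
  have "norm (\<Sum>n. sqrt_coeff (Suc n) *\<^sub>R x ^ Suc n) \<le> (\<Sum>n. - sqrt_coeff (Suc n))"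
  proof (rule norm_suminf_le)
    show "norm (sqrt_coeff (Suc n) *\<^sub>R x ^ Suc n) \<le> - sqrt_coeff (Suc n)" for n
      using mult_left_mono[OF norm_power_le_one[OF assms, of "Suc n"], of "- sqrt_coeff (Suc n)"]
        sqrt_coeff_Suc_le[of n] by simp
  qed (use t in \<open>simp add: sums_iff\<close>)
  then show ?thesis using s t by (simp add: sums_iff norm_minus_commute)
qed

section \<open>Positive elements\<close>

definition selfadj :: "'a::cstar_unital \<Rightarrow> bool" where
  "selfadj x \<longleftrightarrow> adj x = x"

text \<open>A self-adjoint root is demanded by definition; that every \<open>adj x * x\<close> has
  one is the theorem \<open>pos_adj_mult_self\<close>.\<close>

definition pos :: "'a::cstar_unital \<Rightarrow> bool" where
  "pos x \<longleftrightarrow> (\<exists>k. selfadj k \<and> x = k * k)"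

lemma pos_selfadj: "pos x \<Longrightarrow> selfadj x"
  by (auto simp: pos_def selfadj_def adj_mult)

lemma selfadj_arith:
  "selfadj x \<Longrightarrow> selfadj y \<Longrightarrow> selfadj (x + y)"
  "selfadj x \<Longrightarrow> selfadj y \<Longrightarrow> selfadj (x - y)"
  "selfadj x \<Longrightarrow> selfadj (r *\<^sub>R x)"
  "selfadj (0::'a::cstar_unital)" "selfadj (1::'a::cstar_unital)"
  for x y :: "'a::cstar_unital"
  by (simp_all add: selfadj_def adj_add adj_diff adj_scaleR)

lemma norm_square_selfadj: "selfadj k \<Longrightarrow> norm (k * k) = (norm k)\<^sup>2"
  using norm_adj_mult_self[of k] by (simp add: selfadj_def)

text \<open>The element \<open>k + iu * l\<close> is unitary and has \<open>k\<close> as its real part.\<close>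

lemma norm_le_one_of_squares:
  fixes k l :: "'a::cstar_unital"
  assumes k: "selfadj k" and l: "selfadj l" and c: "k * l = l * k" and s: "k * k + l * l = 1"
  shows "norm k \<le> 1"
proof -
  define u where "u = k + iu * l"
  have au: "adj u = k - iu * l"
    using k l by (simp add: u_def adj_add adj_mult adj_iu selfadj_def iu_commute)
  have kil: "k * (iu * l) = iu * (l * k)" by (metis c iu_commute mult.assoc)
  have ill: "iu * (l * (iu * l)) = - (l * l)"
  proof -
    have "l * (iu * l) = iu * (l * l)" by (metis iu_commute mult.assoc)
    then show ?thesis by (simp add: iu_mult_iu flip: mult.assoc)
  qed
  have "adj u * u = k * k + l * l"
    unfolding au unfolding u_def distrib_left left_diff_distrib by (simp add: mult.assoc kil ill)
  then have "adj u * u = 1" by (simp add: s)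
  then have "(norm u)\<^sup>2 \<le> 1\<^sup>2" using norm_adj_mult_self[of u] norm_one_le[where 'a='a] by simp
  then have u1: "norm u \<le> 1" by (simp only: abs_le_square_iff[symmetric] abs_norm_cancel abs_one)
  have "k = (1/2) *\<^sub>R (u + adj u)"
    unfolding au by (simp add: u_def scaleR_2[symmetric])
  then have "norm k = (1/2) * norm (u + adj u)" by simp
  also have "\<dots> \<le> 1" using norm_triangle_ineq[of u "adj u"] u1 by simp
  finally show ?thesis .
qed

text \<open>Write x = k * k and let l be the root of 1 - x. Then l commutes with k and l * l + k * k
  = 1, so \<open>norm_le_one_of_squares\<close> bounds l, and 1 - x is l * l.\<close>

lemma pos_norm_one_minus_le:
  fixes x :: "'a::cstar_unital"
  assumes "pos x" "norm x \<le> 1"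
  shows "norm (1 - x) \<le> 1"
proof -
  obtain k where k: "selfadj k" "x = k * k" using assms unfolding pos_def by blast
  define l where "l = sqrt_one_minus x"
  have x: "adj x = x" using pos_selfadj[OF assms(1)] by (simp add: selfadj_def)
  have l: "selfadj l" using adj_sqrt_one_minus[OF assms(2) x] by (simp add: l_def selfadj_def)
  have ll: "l * l = 1 - x" by (simp add: l_def sqrt_one_minus_square assms)
  have "l * k = k * l"
    unfolding l_def by (rule sqrt_one_minus_commute[OF assms(2)]) (simp add: k mult.assoc)
  then have "norm l \<le> 1"
    by (intro norm_le_one_of_squares[of l k]) (auto simp: k l ll)
  then have "(norm l)\<^sup>2 \<le> 1" by (simp add: power_le_one)
  then show ?thesis using norm_square_selfadj[OF l] unfolding ll by simp
qed

section \<open>Closed subalgebras, square roots and sums of positive elements\<close>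

definition closed_subalgebra :: "'a::cstar_unital set \<Rightarrow> bool" where
  "closed_subalgebra K \<longleftrightarrow> closed K \<and> 0 \<in> K \<and> (\<forall>x\<in>K. \<forall>y\<in>K. x + y \<in> K) \<and>
     (\<forall>c. \<forall>x\<in>K. scaleC c x \<in> K) \<and> (\<forall>x\<in>K. \<forall>y\<in>K. x * y \<in> K) \<and> (\<forall>x\<in>K. adj x \<in> K)"

lemma closed_subalgebraD:
  assumes "closed_subalgebra K"
  shows "closed K" "0 \<in> K" "x \<in> K \<Longrightarrow> y \<in> K \<Longrightarrow> x + y \<in> K" "x \<in> K \<Longrightarrow> scaleC c x \<in> K"
    "x \<in> K \<Longrightarrow> y \<in> K \<Longrightarrow> x * y \<in> K" "x \<in> K \<Longrightarrow> adj x \<in> K" "x \<in> K \<Longrightarrow> r *\<^sub>R x \<in> K"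
    "x \<in> K \<Longrightarrow> - x \<in> K" "x \<in> K \<Longrightarrow> y \<in> K \<Longrightarrow> x - y \<in> K"
proof -
  show 1: "closed K" "0 \<in> K" "x \<in> K \<Longrightarrow> y \<in> K \<Longrightarrow> x + y \<in> K" "x \<in> K \<Longrightarrow> scaleC c x \<in> K"
    "x \<in> K \<Longrightarrow> y \<in> K \<Longrightarrow> x * y \<in> K" "x \<in> K \<Longrightarrow> adj x \<in> K" for x y c
    using assms unfolding closed_subalgebra_def by blast+
  have 2: "x \<in> K \<Longrightarrow> r *\<^sub>R x \<in> K" for r x
    using 1(4)[of x "complex_of_real r"] by (simp add: scaleC_def)
  show "x \<in> K \<Longrightarrow> r *\<^sub>R x \<in> K" by (rule 2)
  have 3: "x \<in> K \<Longrightarrow> - x \<in> K" for x using 2[of x "-1"] by simp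
  show "x \<in> K \<Longrightarrow> - x \<in> K" by (rule 3)
  show "x \<in> K \<Longrightarrow> y \<in> K \<Longrightarrow> x - y \<in> K" using 1(3)[of x "- y"] 3 by simp
qed

lemma closed_subalgebra_sum:
  assumes "closed_subalgebra K" "\<And>i. i \<in> I \<Longrightarrow> f i \<in> K"
  shows "sum f I \<in> K"
  using assms(2) by (induction I rule: infinite_finite_induct)
    (auto simp: closed_subalgebraD[OF assms(1)])

text \<open>For \<open>K\<close> not containing the unit, \<open>sqrt_one_minus (1 - x)\<close> still lies in \<open>K\<close>, because
  the coefficients of the series add up to \<open>0\<close>.\<close>

lemma sqrt_one_minus_closed:
  fixes x :: "'a::cstar_unital"
  assumes K: "closed_subalgebra K" and x: "x \<in> K" "norm (1 - x) \<le> 1"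
  shows "sqrt_one_minus (1 - x) \<in> K"
proof -
  note Kd = closed_subalgebraD[OF K]
  let ?s = "\<lambda>m. (\<Sum>n\<le>m. sqrt_coeff n *\<^sub>R (1 - x) ^ n) - (\<Sum>n\<le>m. sqrt_coeff n) *\<^sub>R (1::'a)"
  have p: "(1 - x) ^ n - 1 \<in> K" for n
  proof (induction n)
    case (Suc n)
    have "(1 - x) ^ Suc n - 1 = ((1 - x) ^ n - 1) - x * ((1 - x) ^ n - 1) - x"
      by (simp add: algebra_simps)
    then show ?case using Kd(9)[OF Kd(9)[OF Suc Kd(5)[OF x(1) Suc]] x(1)] by (simp only:)
  qed (simp add: Kd)
  have "?s m = (\<Sum>n\<le>m. sqrt_coeff n *\<^sub>R ((1 - x) ^ n - 1))" for m
    by (simp add: scaleR_diff_right sum_subtractf scaleR_left.sum)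
  moreover have "(\<Sum>n\<le>m. sqrt_coeff n *\<^sub>R ((1 - x) ^ n - 1)) \<in> K" for m
    by (intro closed_subalgebra_sum[OF K] Kd(7) p)
  ultimately have "?s m \<in> K" for m by (simp only:)
  moreover have "?s \<longlonglongrightarrow> sqrt_one_minus (1 - x) - 0 *\<^sub>R 1"
    using sqrt_one_minus_sums[OF x(2)] sums_sqrt_coeff
    by (intro tendsto_intros) (auto simp: sums_def_le)
  ultimately show ?thesis using closed_sequentially[OF Kd(1), of ?s] by simp
qed

text \<open>Removing the constant term of the series leaves positive powers of x only, so no unit of
  K is involved.\<close>

lemma one_minus_sqrt_one_minus_closed:
  fixes x :: "'a::cstar_unital"
  assumes K: "closed_subalgebra K" and x: "x \<in> K" "norm x \<le> 1"
  shows "1 - sqrt_one_minus x \<in> K"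
proof -
  note Kd = closed_subalgebraD[OF K]
  have p: "x ^ Suc n \<in> K" for n
  proof (induction n)
    case (Suc n) then show ?case using Kd(5)[OF x(1) Suc] by simp
  qed (simp add: x)
  have "(\<lambda>n. sqrt_coeff (Suc n) *\<^sub>R x ^ Suc n) sums (sqrt_one_minus x - 1)"
    using sqrt_one_minus_sums[OF x(2)] by (subst sums_Suc_iff) simp
  moreover have "(\<Sum>n<m. sqrt_coeff (Suc n) *\<^sub>R x ^ Suc n) \<in> K" for m
    by (intro closed_subalgebra_sum[OF K] Kd(7) p)
  ultimately have "sqrt_one_minus x - 1 \<in> K"
    using closed_sequentially[OF Kd(1), of "\<lambda>m. \<Sum>n<m. sqrt_coeff (Suc n) *\<^sub>R x ^ Suc n"]
    unfolding sums_def by (simp only:)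
  then show ?thesis using Kd(8) by fastforce
qed

lemma pos_scaleR:
  assumes "pos x" "0 \<le> r"
  shows "pos (r *\<^sub>R x)"
proof -
  obtain k where k: "selfadj k" "x = k * k" using assms unfolding pos_def by blast
  have "r *\<^sub>R x = (sqrt r *\<^sub>R k) * (sqrt r *\<^sub>R k)" using assms k by simp
  then show ?thesis unfolding pos_def using selfadj_arith(3)[OF k(1)] by blast
qed

lemma pos_zero: "pos 0"
  unfolding pos_def using selfadj_arith(4) by force

lemma pos_of_norm_one_minus:
  fixes x :: "'a::cstar_unital"
  assumes "selfadj x" "norm (1 - x) \<le> 1"
  shows "pos x"
  unfolding pos_def
  using assms by (intro exI[of _ "sqrt_one_minus (1 - x)"])
    (simp add: selfadj_def sqrt_one_minus_square adj_sqrt_one_minus adj_diff)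

text \<open>Replaces the existence of a root by a norm inequality. Such inequalities can be added,
  which yields \<open>pos_add\<close>; an arbitrary bound t is allowed because the bounds of two
  elements add up to a bound of their sum.\<close>

lemma pos_iff_norm:
  fixes x :: "'a::cstar_unital"
  assumes "selfadj x" "norm x \<le> t" "0 < t"
  shows "pos x \<longleftrightarrow> norm (t *\<^sub>R 1 - x) \<le> t"
proof -
  let ?y = "(1/t) *\<^sub>R x"
  have eq: "t *\<^sub>R 1 - x = t *\<^sub>R (1 - ?y)" using assms by (simp add: scaleR_diff_right)
  have "norm (t *\<^sub>R 1 - x) = t * norm (1 - ?y)" unfolding eq using assms(3) by simp
  then have n: "norm (t *\<^sub>R 1 - x) \<le> t \<longleftrightarrow> norm (1 - ?y) \<le> 1" using assms by simp
  have "pos x \<longleftrightarrow> pos ?y"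
    using pos_scaleR[of x "1/t"] pos_scaleR[of ?y t] assms by auto
  also have "\<dots> \<longleftrightarrow> norm (1 - ?y) \<le> 1"
    using pos_norm_one_minus_le[of ?y] pos_of_norm_one_minus[of ?y] assms selfadj_arith(3)[OF assms(1), of "1/t"]
    by (auto simp: field_simps)
  finally show ?thesis using n by simp
qed

lemma pos_add:
  fixes x y :: "'a::cstar_unital"
  assumes "pos x" "pos y"
  shows "pos (x + y)"
proof -
  define s t where "s = norm x + 1" and "t = norm y + 1"
  have st: "0 < s" "norm x \<le> s" "0 < t" "norm y \<le> t"
    by (simp_all add: s_def t_def add_nonneg_pos)
  have 1: "norm (s *\<^sub>R 1 - x) \<le> s" "norm (t *\<^sub>R 1 - y) \<le> t"
    using pos_iff_norm[OF pos_selfadj[OF assms(1)] st(2,1)] pos_iff_norm[OF pos_selfadj[OF assms(2)] st(4,3)] assms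
    by auto
  have "(s + t) *\<^sub>R 1 - (x + y) = (s *\<^sub>R 1 - x) + (t *\<^sub>R 1 - y)"
    by (simp add: scaleR_add_left)
  then have "norm ((s + t) *\<^sub>R 1 - (x + y)) \<le> s + t"
    using order_trans[OF norm_triangle_ineq add_mono[OF 1]] by (simp only:)
  moreover have "norm (x + y) \<le> s + t" using st norm_triangle_ineq[of x y] by simp
  ultimately show ?thesis
    using pos_iff_norm[of "x + y" "s + t"] st assms by (simp add: selfadj_arith pos_selfadj)
qed

lemma pos_sum: "(\<And>i. i \<in> I \<Longrightarrow> pos (f i)) \<Longrightarrow> pos (sum f I)"
  by (induction I rule: infinite_finite_induct) (auto simp: pos_zero pos_add)

text \<open>After rescaling to norm at most 1, the root is a limit of polynomials in x without
  constant term. This gives the last two properties: it commutes with whatever commutes with x, and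
  it lies in every closed subalgebra containing x, even in one without unit.\<close>

lemma pos_sqrt:
  fixes x :: "'a::cstar_unital"
  assumes "pos x"
  obtains k where "pos k" "selfadj k" "k * k = x" "\<And>y. x * y = y * x \<Longrightarrow> k * y = y * k"
    "\<And>K. closed_subalgebra K \<Longrightarrow> x \<in> K \<Longrightarrow> k \<in> K"
proof -
  define t where "t = norm x + 1"
  have t: "0 < t" "norm x \<le> t" by (simp_all add: t_def add_nonneg_pos)
  define z where "z = (1/t) *\<^sub>R x"
  have z: "pos z" using assms t by (simp add: z_def pos_scaleR)
  have zn: "norm z \<le> 1" using t by (simp add: z_def)
  have nz: "norm (1 - z) \<le> 1" using pos_norm_one_minus_le[OF z zn] .
  define w where "w = sqrt_one_minus (1 - z)"
  have sz: "adj (1 - z) = 1 - z" using pos_selfadj[OF z] by (simp add: selfadj_def adj_diff)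
  have sw: "selfadj w" using adj_sqrt_one_minus[OF nz sz] by (simp add: selfadj_def w_def)
  have ww: "w * w = z" using sqrt_one_minus_square[OF nz] by (simp add: w_def)
  have pw: "pos w" using pos_of_norm_one_minus[OF sw] norm_one_minus_sqrt_one_minus[OF nz]
    by (simp add: w_def)
  let ?k = "sqrt t *\<^sub>R w"
  show thesis
  proof
    show "pos ?k" using pw t by (simp add: pos_scaleR)
    show "selfadj ?k" using sw by (rule selfadj_arith)
    show "?k * ?k = x" using t ww by (simp add: z_def)
  next
    fix y assume "x * y = y * x"
    then have "w * y = y * w"
      unfolding w_def by (intro sqrt_one_minus_commute[OF nz]) (simp add: z_def algebra_simps)
    then show "?k * y = y * ?k" by simp
  next
    fix K :: "'a set" assume K: "closed_subalgebra K" "x \<in> K"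
    then have "z \<in> K" by (simp add: z_def closed_subalgebraD)
    then have "w \<in> K" unfolding w_def using K nz sqrt_one_minus_closed by blast
    then show "?k \<in> K" using K by (simp add: closed_subalgebraD)
  qed
qed

text \<open>The root of each factor commutes with whatever commutes with that factor, hence the two
  roots commute, and their product is a self-adjoint root of a * b.\<close>

lemma pos_mult_commute:
  fixes a b :: "'a::cstar_unital"
  assumes "pos a" "pos b" "a * b = b * a"
  shows "pos (a * b)"
proof -
  obtain k where k: "selfadj k" "k * k = a" "\<And>y. a * y = y * a \<Longrightarrow> k * y = y * k"
    using pos_sqrt[OF assms(1)] by metis
  obtain l where l: "selfadj l" "l * l = b" "\<And>y. b * y = y * b \<Longrightarrow> l * y = y * l"
    using pos_sqrt[OF assms(2)] by metis
  have kl: "k * l = l * k" using k(3)[of b] l(3)[of k] assms(3) by metis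
  have "(k * l) * (k * l) = k * (l * k) * l" by (simp add: mult.assoc)
  also have "\<dots> = (k * k) * (l * l)" unfolding kl[symmetric] by (simp add: mult.assoc)
  finally have "a * b = (k * l) * (k * l)" by (simp only: k(2) l(2))
  moreover have "selfadj (k * l)" using k(1) l(1) kl by (simp add: selfadj_def adj_mult)
  ultimately show ?thesis unfolding pos_def by blast
qed

lemma norm_le_one_of_pos:
  fixes a :: "'a::cstar_unital"
  assumes "pos a" "pos (1 - a)"
  shows "norm a \<le> 1"
proof -
  obtain k where k: "selfadj k" "a = k * k" using assms unfolding pos_def by blast
  obtain l where l: "selfadj l" "l * l = 1 - a" "\<And>y. (1 - a) * y = y * (1 - a) \<Longrightarrow> l * y = y * l"
    using pos_sqrt[OF assms(2)] by metis
  have "l * k = k * l"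
    by (rule l(3)) (simp add: k(2) left_diff_distrib right_diff_distrib mult.assoc)
  then have "norm k \<le> 1"
    by (intro norm_le_one_of_squares[of k l]) (simp_all add: k(1) l(1,2) flip: k(2))
  then have "(norm k)\<^sup>2 \<le> 1" by (simp add: power_le_one)
  then show ?thesis using norm_square_selfadj[OF k(1)] unfolding k(2) by simp
qed

lemma pos_norm_minus:
  fixes b :: "'a::cstar_unital"
  assumes "selfadj b" "norm b \<le> t"
  shows "pos (t *\<^sub>R 1 - b)"
proof (cases "t = 0")
  case True then show ?thesis using assms by (simp add: pos_zero)
next
  case False
  then have t: "0 < t" using assms norm_ge_zero[of b] by linarith
  have "pos (1 - (1/t) *\<^sub>R b)"
    using assms t by (intro pos_of_norm_one_minus selfadj_arith) auto
  then have "pos (t *\<^sub>R (1 - (1/t) *\<^sub>R b))" using t by (simp add: pos_scaleR)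
  then show ?thesis using t by (simp add: scaleR_diff_right)
qed

text \<open>If t dominates b, it dominates a, and \<open>norm_le_one_of_pos\<close> applied to a / t
  turns this into a bound on the norm. Taking t strictly above \<open>norm b\<close> permits the
  division when b = 0.\<close>

lemma pos_norm_mono:
  fixes a b :: "'a::cstar_unital"
  assumes a: "pos a" and ba: "pos (b - a)"
  shows "norm a \<le> norm b"
proof (rule dense_ge)
  fix t assume "norm b < t"
  then have t: "norm b \<le> t" "0 < t" using norm_ge_zero[of b] by linarith+
  have "selfadj b" using pos_selfadj[OF pos_add[OF a ba]] by simp
  then have "pos (t *\<^sub>R 1 - b)" using pos_norm_minus t by blast
  then have "pos (t *\<^sub>R 1 - a)" using pos_add[OF _ ba] by fastforce
  then have "pos ((1/t) *\<^sub>R (t *\<^sub>R 1 - a))" using t pos_scaleR[of _ "1/t"] by simp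
  then have "pos (1 - (1/t) *\<^sub>R a)" using t by (simp add: scaleR_diff_right)
  then have "norm ((1/t) *\<^sub>R a) \<le> 1" using a t by (intro norm_le_one_of_pos) (simp_all add: pos_scaleR)
  then show "norm a \<le> t" using t by (simp add: field_simps)
qed

lemma pos_add_eq_0:
  fixes a b :: "'a::cstar_unital"
  assumes "pos a" "pos b" "a + b = 0"
  shows "a = 0"
proof -
  have "norm a \<le> norm (0::'a)"
    by (rule pos_norm_mono) (use assms in \<open>auto simp: add_eq_0_iff\<close>)
  then show ?thesis by simp
qed

section \<open>Positivity of \<open>adj x * x\<close>\<close>

text \<open>If \<open>y * adj y\<close> is positive and \<open>adj y * y = - q\<^sup>2\<close>, then
  \<open>(1 - y * adj y / t) ^ n * y = y * (1 + q\<^sup>2 / t) ^ n\<close> stays bounded in \<open>n\<close>, whereas the norm of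
  the right hand side grows unless \<open>q\<close> vanishes.\<close>

lemma neg_square_eq_0:
  fixes y q :: "'a::cstar_unital"
  assumes q: "selfadj q" and yy: "adj y * y = - (q * q)" and p: "pos (y * adj y)"
  shows "y = 0"
proof -
  define t where "t = norm (y * adj y) + 1"
  have t: "0 < t" "norm (y * adj y) \<le> t" by (simp_all add: t_def add_nonneg_pos)
  define g where "g = (1/t) *\<^sub>R (q * q)"
  have "pos (q * q)" using q unfolding pos_def by blast
  then have pg: "pos g" using t unfolding g_def by (intro pos_scaleR) auto
  have sg: "adj g = g" using pos_selfadj[OF pg] by (simp add: selfadj_def)
  have yyg: "adj y * y = - (t *\<^sub>R g)" using t by (simp add: g_def yy)
  define w where "w = 1 - (1/t) *\<^sub>R (y * adj y)"
  have nw: "norm w \<le> 1"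
    unfolding w_def using t p by (intro pos_norm_one_minus_le pos_scaleR) auto
  have wy: "w ^ n * y = y * (1 + g) ^ n" for n
  proof (induction n)
    case (Suc n)
    have "w * y = y * (1 + g)"
      using t by (simp add: w_def distrib_left left_diff_distrib mult.assoc yyg)
    then show ?case by (metis Suc mult.assoc power_Suc power_Suc2)
  qed simp
  have ag: "adj ((1 + g) ^ n) = (1 + g) ^ n" for n
    by (induction n) (simp_all add: adj_mult adj_add sg power_commutes)
  have gc: "g * (1 + g) ^ n = (1 + g) ^ n * g" for n
    by (rule power_commuting_commutes[symmetric]) (simp add: distrib_left distrib_right)
  have bound: "t * norm (g * (1 + g) ^ (2 * n)) \<le> (norm y)\<^sup>2" for n
  proof -
    have "norm (y * (1 + g) ^ n) \<le> norm (w ^ n) * norm y"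
      unfolding wy[symmetric] by (rule norm_mult_ineq)
    also have "\<dots> \<le> 1 * norm y" by (intro mult_right_mono norm_power_le_one nw) simp
    finally have "(norm (y * (1 + g) ^ n))\<^sup>2 \<le> (norm y)\<^sup>2" by (simp add: power_mono)
    moreover have "adj (y * (1 + g) ^ n) * (y * (1 + g) ^ n) = (1 + g) ^ n * (adj y * y) * (1 + g) ^ n"
      by (simp add: adj_mult ag mult.assoc)
    moreover have "\<dots> = - (t *\<^sub>R (g * (1 + g) ^ (2 * n)))"
      by (simp add: yyg mult_2 power_add) (metis gc mult.assoc)
    ultimately show ?thesis
      using norm_adj_mult_self[of "y * (1 + g) ^ n"] t by simp
  qed
  \<comment> \<open>A Bernoulli inequality: positivity of Z m says that g (1 + g)^m dominates g + m
    g^2. Since \<open>bound\<close> keeps the norm of the former below a constant, g * g must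
    vanish.\<close>
  define Z where "Z m = g * (1 + g) ^ m - g - real m *\<^sub>R (g * g)" for m
  have Zc: "pos (Z m) \<and> g * Z m = Z m * g" for m
  proof (induction m)
    case 0 then show ?case by (simp add: Z_def pos_zero)
  next
    case (Suc m)
    have "Z (Suc m) = Z m + g * Z m + real m *\<^sub>R (g * (g * g))"
      by (simp add: Z_def distrib_left distrib_right right_diff_distrib scaleR_add_left mult.assoc)
    moreover have "pos (g * Z m)" using Suc pg by (intro pos_mult_commute) auto
    moreover have gg: "pos (g * g)" using pg by (intro pos_mult_commute) auto
    moreover have "pos (real m *\<^sub>R (g * (g * g)))"
      by (rule pos_scaleR[OF pos_mult_commute[OF pg gg]]) (simp_all add: mult.assoc)
    ultimately have "pos (Z (Suc m))" using Suc by (simp add: pos_add)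
    moreover have "g * Z (Suc m) = Z (Suc m) * g"
    proof -
      have "g * ((1 + g) ^ Suc m * g) = (g * (1 + g) ^ Suc m) * g" by (simp only: mult.assoc)
      also have "\<dots> = (1 + g) ^ Suc m * (g * g)" by (simp only: gc mult.assoc)
      finally show ?thesis
        by (simp add: Z_def right_diff_distrib left_diff_distrib gc mult.assoc del: power_Suc)
    qed
    ultimately show ?case by blast
  qed
  have "real n * norm (g * g) \<le> (norm y)\<^sup>2 / t" for n
  proof -
    have "norm (real (2 * n) *\<^sub>R (g * g)) \<le> norm (g * (1 + g) ^ (2 * n))"
    proof (rule pos_norm_mono)
      have gg: "pos (g * g)" using pg by (intro pos_mult_commute) auto
      then show "pos (real (2 * n) *\<^sub>R (g * g))" by (intro pos_scaleR) auto
      have "g * (1 + g) ^ (2 * n) - real (2 * n) *\<^sub>R (g * g) = Z (2 * n) + g" by (simp add: Z_def)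
      then show "pos (g * (1 + g) ^ (2 * n) - real (2 * n) *\<^sub>R (g * g))"
        using Zc[of "2 * n"] pg by (simp add: pos_add)
    qed
    moreover have "norm (g * (1 + g) ^ (2 * n)) \<le> (norm y)\<^sup>2 / t"
      using bound[of n] t by (simp add: field_simps)
    moreover have "real n * norm (g * g) \<le> norm (real (2 * n) *\<^sub>R (g * g))"
      unfolding norm_scaleR by (rule mult_right_mono) auto
    ultimately show ?thesis by (meson order_trans)
  qed
  then have "norm (g * g) = 0"
    by (metis ex_less_of_nat_mult not_le norm_ge_zero order_le_less)
  then have "norm g = 0" using norm_adj_mult_self[of g] sg by simp
  then show ?thesis using yyg by (simp add: adj_mult_self_eq_0)
qed

text \<open>The negative part of h = \<open>adj x * x\<close> has to vanish. Let y be x times twice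
  that part. Then \<open>adj y * y\<close> is minus a square, while \<open>y * adj y\<close> is
  positive, because the sum of the two is twice the sum of the squares of the real and imaginary
  parts of y. So \<open>neg_square_eq_0\<close> applies to y.\<close>

lemma pos_adj_mult_self: "pos (adj x * (x::'a::cstar_unital))"
proof -
  define h where "h = adj x * x"
  have sh: "selfadj h" by (simp add: h_def selfadj_def adj_mult)
  then have "pos (h * h)" unfolding pos_def by blast
  then obtain a where a: "pos a" "selfadj a" "a * a = h * h" "\<And>y. h * h * y = y * (h * h) \<Longrightarrow> a * y = y * a"
    using pos_sqrt by metis
  obtain m where m: "selfadj m" "m * m = a" "\<And>y. a * y = y * a \<Longrightarrow> m * y = y * m"
    using pos_sqrt[OF a(1)] by metis
  have ah: "a * h = h * a" by (rule a(4)) (simp add: mult.assoc)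
  \<comment> \<open>As a is the absolute value of h, this is twice the negative part of h. The
    relation \<open>hn\<close> says that h acts as - a on it.\<close>
  define n where "n = a - h"
  have sn: "adj n = n" using sh a(2) by (simp add: n_def selfadj_def adj_diff)
  have an: "a * n = n * a" by (simp add: n_def right_diff_distrib left_diff_distrib ah)
  have hn: "h * n = - (a * n)" by (simp add: n_def right_diff_distrib a(3) ah)
  have nn: "n * n = a * n + a * n" unfolding n_def left_diff_distrib using hn by (simp add: n_def)
  define q where "q = m * n"
  have mn: "m * n = n * m" by (rule m(3)) (rule an)
  have sq: "selfadj q" using sn mn m(1) by (simp add: q_def selfadj_def adj_mult)
  have qq: "q * q = n * (a * n)"
  proof -
    have "q * q = n * m * (m * n)" unfolding q_def by (simp only: mn)
    then show ?thesis by (simp add: mult.assoc flip: m(2))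
  qed
  define y where "y = x * n"
  have yy: "adj y * y = - (q * q)"
  proof -
    have "adj y * y = n * (h * n)" by (simp add: y_def h_def adj_mult sn mult.assoc)
    then show ?thesis by (simp add: hn qq)
  qed
  \<comment> \<open>b and c are the real and imaginary parts: y = b + iu * c.\<close>
  define b where "b = (1/2) *\<^sub>R (y + adj y)"
  define c where "c = (1/2) *\<^sub>R (iu * (adj y - y))"
  have sb: "selfadj b" by (simp add: b_def selfadj_def adj_scaleR adj_add add.commute)
  have sc: "selfadj c"
    by (simp add: c_def selfadj_def adj_scaleR adj_diff adj_mult adj_iu iu_commute algebra_simps)
  have cc: "c * c = (1/4) *\<^sub>R (- ((adj y - y) * (adj y - y)))"
  proof -
    let ?d = "adj y - y"
    have "?d * (iu * ?d) = iu * (?d * ?d)" by (metis iu_commute mult.assoc)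
    then have "(iu * ?d) * (iu * ?d) = (iu * iu) * (?d * ?d)" by (simp add: mult.assoc)
    then show ?thesis by (simp add: c_def iu_mult_iu)
  qed
  have bb: "b * b = (1/4) *\<^sub>R ((y + adj y) * (y + adj y))"
    unfolding b_def mult_scaleR_left mult_scaleR_right by simp
  have "2 *\<^sub>R (b * b + c * c) = (1/2) *\<^sub>R ((y + adj y) * (y + adj y) - (adj y - y) * (adj y - y))"
    unfolding cc bb by (simp add: scaleR_add_right scaleR_diff_right del: distrib_left distrib_right)
  also have "\<dots> = (1/2) *\<^sub>R (2 *\<^sub>R (adj y * y + y * adj y))"
    by (simp add: algebra_simps scaleR_2)
  finally have bc: "adj y * y + y * adj y = 2 *\<^sub>R (b * b + c * c)" by simp
  have "pos (2 *\<^sub>R (b * b + c * c) + q * q)"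
    using sb sc sq by (intro pos_add pos_scaleR) (auto simp: pos_def)
  then have "pos (y * adj y)" unfolding bc[symmetric] yy by simp
  then have "y = 0" by (rule neg_square_eq_0[OF sq yy])
  then have "q * q = 0" using yy by simp
  then have "n * (n * n) = 0" by (simp add: nn qq distrib_left)
  then have "n * n = 0"
    using adj_mult_self_eq_0[of "n * n"] by (simp add: adj_mult sn mult.assoc)
  then have "n = 0" using adj_mult_self_eq_0[of n] by (simp add: sn)
  then show ?thesis using a(1) by (simp add: n_def h_def)
qed

lemma pos_conj:
  fixes a b :: "'a::cstar_unital"
  assumes "pos a"
  shows "pos (adj b * a * b)"
proof -
  obtain k where "selfadj k" "a = k * k" using assms unfolding pos_def by blast
  then have "adj b * a * b = adj (k * b) * (k * b)" by (simp add: adj_mult selfadj_def mult.assoc)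
  then show ?thesis by (simp add: pos_adj_mult_self)
qed

section \<open>Homomorphisms\<close>

text \<open>Relative to a subset, because the homomorphisms of interest are defined on copies of
  algebras without unit inside a unital type.\<close>

definition is_star_hom :: "'a::cstar_unital set \<Rightarrow> ('a \<Rightarrow> 'b::cstar_unital) \<Rightarrow> bool" where
  "is_star_hom K h \<longleftrightarrow> (\<forall>x\<in>K. \<forall>y\<in>K. h (x + y) = h x + h y) \<and> (\<forall>c. \<forall>x\<in>K. h (scaleC c x) = scaleC c (h x)) \<and>
     (\<forall>x\<in>K. \<forall>y\<in>K. h (x * y) = h x * h y) \<and> (\<forall>x\<in>K. h (adj x) = adj (h x))"

lemma is_star_homD:
  assumes "is_star_hom K h" "closed_subalgebra K"
  shows "x \<in> K \<Longrightarrow> y \<in> K \<Longrightarrow> h (x + y) = h x + h y"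
    "x \<in> K \<Longrightarrow> h (scaleC c x) = scaleC c (h x)"
    "x \<in> K \<Longrightarrow> y \<in> K \<Longrightarrow> h (x * y) = h x * h y"
    "x \<in> K \<Longrightarrow> h (adj x) = adj (h x)"
    "x \<in> K \<Longrightarrow> h (r *\<^sub>R x) = r *\<^sub>R h x"
    "h 0 = 0"
    "x \<in> K \<Longrightarrow> h (- x) = - h x"
    "x \<in> K \<Longrightarrow> y \<in> K \<Longrightarrow> h (x - y) = h x - h y"
proof -
  note Kd = closed_subalgebraD[OF assms(2)]
  show 1: "x \<in> K \<Longrightarrow> y \<in> K \<Longrightarrow> h (x + y) = h x + h y"
    "x \<in> K \<Longrightarrow> h (scaleC c x) = scaleC c (h x)"
    "x \<in> K \<Longrightarrow> y \<in> K \<Longrightarrow> h (x * y) = h x * h y"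
    "x \<in> K \<Longrightarrow> h (adj x) = adj (h x)" for x y c
    using assms unfolding is_star_hom_def by blast+
  have 2: "x \<in> K \<Longrightarrow> h (r *\<^sub>R x) = r *\<^sub>R h x" for r x
    using 1(2)[of x "complex_of_real r"] by (simp add: scaleC_def)
  show "x \<in> K \<Longrightarrow> h (r *\<^sub>R x) = r *\<^sub>R h x" by (rule 2)
  show "h 0 = 0" using 2[of 0 0] Kd by simp
  have 3: "x \<in> K \<Longrightarrow> h (- x) = - h x" for x using 2[of x "-1"] by simp
  show "x \<in> K \<Longrightarrow> h (- x) = - h x" by (rule 3)
  show "x \<in> K \<Longrightarrow> y \<in> K \<Longrightarrow> h (x - y) = h x - h y" using 1(1)[of x "- y"] 3 Kd(8) by simp
qed

text \<open>For self-adjoint a of norm at most 1 the element f = 1 - sqrt (1 - a * a) lies in K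
  although 1 may not, so h f makes sense, and the squares of h a and 1 - h f add up to 1. Thus h a
  is the real part of a unitary. The C*-identity reduces general x to
  \<open>adj x * x\<close>.\<close>

lemma star_hom_contractive:
  fixes h :: "'a::cstar_unital \<Rightarrow> 'b::cstar_unital"
  assumes h: "is_star_hom K h" and K: "closed_subalgebra K" and x: "x \<in> K"
  shows "norm (h x) \<le> norm x"
proof -
  note Kd = closed_subalgebraD[OF K] and hd = is_star_homD[OF h K]
  have sa: "norm (h a) \<le> 1" if a: "a \<in> K" "selfadj a" "norm a \<le> 1" for a
  proof -
    have aa: "a * a \<in> K" "norm (a * a) \<le> 1"
      using a Kd by (auto simp: norm_square_selfadj power_le_one)
    define f where "f = 1 - sqrt_one_minus (a * a)"
    have f: "f \<in> K" unfolding f_def by (rule one_minus_sqrt_one_minus_closed[OF K aa])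
    have saa: "adj (a * a) = a * a" using a by (simp add: selfadj_def adj_mult)
    have sf: "adj f = f" by (simp add: f_def adj_diff adj_sqrt_one_minus[OF aa(2) saa])
    have "(1 - f) * (1 - f) = 1 - a * a" by (simp add: f_def sqrt_one_minus_square[OF aa(2)])
    then have "f * f - f - f = - (a * a)" by (simp add: algebra_simps)
    then have "h (f * f - f - f) = h (- (a * a))" by simp
    then have ff: "h f * h f - h f - h f = - (h a * h a)" using f a Kd by (simp add: hd)
    have "sqrt_one_minus (a * a) * a = a * sqrt_one_minus (a * a)"
      by (rule sqrt_one_minus_commute[OF aa(2)]) (simp add: mult.assoc)
    then have "f * a = a * f" by (simp add: f_def algebra_simps)
    then have "h (f * a) = h (a * f)" by simp
    then have fa: "h f * h a = h a * h f" using f a by (simp add: hd)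
    show ?thesis
    proof (rule norm_le_one_of_squares[of "h a" "1 - h f"])
      show "selfadj (h a)" using a hd(4)[of a] by (simp add: selfadj_def)
      show "selfadj (1 - h f)" using f sf hd(4)[of f] by (simp add: selfadj_def adj_diff)
      show "h a * (1 - h f) = (1 - h f) * h a" using fa by (simp add: algebra_simps)
      have "(1 - h f) * (1 - h f) = 1 + (h f * h f - h f - h f)" by (simp add: algebra_simps)
      then show "h a * h a + (1 - h f) * (1 - h f) = 1" by (simp add: ff)
    qed
  qed
  show ?thesis
  proof (cases "x = 0")
    case False
    define a where "a = (1 / (norm x)\<^sup>2) *\<^sub>R (adj x * x)"
    have "norm (h a) \<le> 1"
      by (rule sa) (use x Kd False in \<open>auto simp: a_def selfadj_def adj_scaleR adj_mult norm_adj_mult_self\<close>)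
    also have "h a = (1 / (norm x)\<^sup>2) *\<^sub>R (adj (h x) * h x)"
      unfolding a_def using x Kd by (simp add: hd)
    finally have "(norm (h x))\<^sup>2 \<le> (norm x)\<^sup>2"
      using False by (simp add: norm_adj_mult_self field_simps)
    then show ?thesis by (simp add: power2_le_iff_abs_le)
  qed (simp add: hd)
qed

lemma star_hom_dist:
  fixes h :: "'a::cstar_unital \<Rightarrow> 'b::cstar_unital"
  assumes h: "is_star_hom K h" and K: "closed_subalgebra K" and "x \<in> K" "y \<in> K"
  shows "dist (h x) (h y) \<le> dist x y"
  using star_hom_contractive[OF h K, of "x - y"] assms
  by (simp add: dist_norm is_star_homD(8)[OF h K] closed_subalgebraD(9)[OF K])

lemma star_hom_continuous_on:
  fixes h :: "'a::cstar_unital \<Rightarrow> 'b::cstar_unital"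
  assumes h: "is_star_hom K h" and K: "closed_subalgebra K"
  shows "continuous_on K h"
  unfolding continuous_on_iff using star_hom_dist[OF h K] by (meson le_less_trans)

lemma closed_subalgebra_vimage:
  fixes h :: "'a::cstar_unital \<Rightarrow> 'b::cstar_unital"
  assumes h: "is_star_hom K h" and K: "closed_subalgebra K" and L: "closed_subalgebra L"
  shows "closed_subalgebra {x \<in> K. h x \<in> L}"
proof -
  have "closed {x \<in> K. h x \<in> L}"
    using continuous_closed_preimage[OF star_hom_continuous_on[OF h K] closed_subalgebraD(1)[OF K]
        closed_subalgebraD(1)[OF L]]
    by (simp add: vimage_def Int_def)
  then show ?thesis
    unfolding closed_subalgebra_def
    by (auto simp: closed_subalgebraD[OF K] closed_subalgebraD[OF L] is_star_homD[OF h K])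
qed

text \<open>Reduces the equality of two homomorphisms to generators, just as
  \<open>closed_subalgebra_vimage\<close> reduces an inclusion of the image to generators.\<close>

lemma closed_subalgebra_equalizer:
  fixes h g :: "'a::cstar_unital \<Rightarrow> 'b::cstar_unital"
  assumes h: "is_star_hom K h" and g: "is_star_hom K g" and K: "closed_subalgebra K"
  shows "closed_subalgebra {x \<in> K. h x = g x}"
proof -
  have "continuous_on K (\<lambda>x. h x - g x)"
    by (intro continuous_on_diff star_hom_continuous_on h g K)
  then have "closed {x \<in> K. h x - g x \<in> {0}}"
    using continuous_closed_preimage[OF _ closed_subalgebraD(1)[OF K], of "\<lambda>x. h x - g x" "{0}"]
    by (simp add: vimage_def Int_def)
  then have "closed {x \<in> K. h x = g x}" by simp
  then show ?thesis
    unfolding closed_subalgebra_def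
    by (auto simp: closed_subalgebraD[OF K] is_star_homD[OF h K] is_star_homD[OF g K])
qed

section \<open>Adjointable operators\<close>

text \<open>
  A Hilbert C*-module, whose inner product takes its values in the module itself: the
  algebra of scalars is embedded in the module in all instances below.  The operator \<open>J\<close> is
  multiplication by the imaginary unit.
\<close>

class hmod = banach +
  fixes ip :: "'a \<Rightarrow> 'a \<Rightarrow> 'a" and J :: "'a \<Rightarrow> 'a"
  assumes ip_add_left: "ip (x + y) z = ip x z + ip y z"
    and ip_add_right: "ip z (x + y) = ip z x + ip z y"
    and ip_scaleR_left: "ip (r *\<^sub>R x) y = r *\<^sub>R ip x y"
    and ip_scaleR_right: "ip x (r *\<^sub>R y) = r *\<^sub>R ip x y"
    and ip_J_left: "ip (J x) y = - J (ip x y)"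
    and ip_J_right: "ip x (J y) = J (ip x y)"
    and J_add: "J (x + y) = J x + J y"
    and J_scaleR: "J (r *\<^sub>R x) = r *\<^sub>R J x"
    and J_J: "J (J x) = - x"
    and norm_ip_self: "norm (ip x x) = (norm x)\<^sup>2"
    and norm_ip_le: "norm (ip x y) \<le> norm x * norm y"

lemma bounded_bilinear_ip: "bounded_bilinear (ip :: 'h::hmod \<Rightarrow> 'h \<Rightarrow> 'h)"
  by (rule bounded_bilinear.intro)
    (auto simp: ip_add_left ip_add_right ip_scaleR_left ip_scaleR_right intro!: exI[of _ 1] norm_ip_le)

lemmas ip_minus_left = bounded_bilinear.minus_left[OF bounded_bilinear_ip]
lemmas ip_minus_right = bounded_bilinear.minus_right[OF bounded_bilinear_ip]
lemmas ip_diff_left = bounded_bilinear.diff_left[OF bounded_bilinear_ip]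
lemmas ip_diff_right = bounded_bilinear.diff_right[OF bounded_bilinear_ip]
lemmas ip_zero_left = bounded_bilinear.zero_left[OF bounded_bilinear_ip]
lemmas ip_zero_right = bounded_bilinear.zero_right[OF bounded_bilinear_ip]
lemmas tendsto_ip = bounded_bilinear.tendsto[OF bounded_bilinear_ip]

lemma ip_self_eq_0: "ip x x = 0 \<longleftrightarrow> x = (0::'h::hmod)"
  using norm_ip_self[of x] by auto

lemma ip_eqI: "(\<And>y. ip x y = ip z y) \<Longrightarrow> x = (z::'h::hmod)"
  using ip_self_eq_0[of "x - z"] by (simp add: ip_diff_left)

lemma J_minus: "J (- x) = - J (x::'h::hmod)"
  using J_scaleR[of "-1" x] by simp

lemma norm_J [simp]: "norm (J x) = norm (x::'h::hmod)"
proof -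
  have "(norm (J x))\<^sup>2 = (norm x)\<^sup>2"
    unfolding norm_ip_self[symmetric] by (simp add: ip_J_left ip_J_right J_J J_minus)
  then show ?thesis by (simp add: power2_eq_iff_nonneg)
qed

lemma bounded_linear_J: "bounded_linear (J :: 'h::hmod \<Rightarrow> 'h)"
  by (rule bounded_linear_intro[where K=1]) (simp_all add: J_add J_scaleR)

text \<open>A bounded operator on a Hilbert module may fail to have an adjoint, so the adjoint is
  carried along. Both identities are demanded because the class \<open>hmod\<close> has no axiom
  relating \<open>ip x y\<close> to \<open>ip y x\<close>.\<close>

definition adjoint_pair :: "('h::hmod \<Rightarrow>\<^sub>L 'h) \<times> ('h \<Rightarrow>\<^sub>L 'h) \<Rightarrow> bool" where
  "adjoint_pair p \<longleftrightarrow> (\<forall>x y. ip (blinfun_apply (fst p) x) y = ip x (blinfun_apply (snd p) y)) \<and>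
     (\<forall>x y. ip (blinfun_apply (snd p) x) y = ip x (blinfun_apply (fst p) y))"

lemma adjoint_pair_norm_le:
  fixes T T' :: "'h::hmod \<Rightarrow>\<^sub>L 'h"
  assumes "adjoint_pair (T, T')"
  shows "norm T' \<le> norm T"
proof (rule norm_blinfun_bound)
  fix y
  let ?z = "blinfun_apply T' y"
  have "(norm ?z)\<^sup>2 = norm (ip (blinfun_apply T ?z) y)"
    using assms by (simp add: norm_ip_self[symmetric] adjoint_pair_def)
  also have "\<dots> \<le> norm (blinfun_apply T ?z) * norm y" by (rule norm_ip_le)
  also have "\<dots> \<le> norm T * norm ?z * norm y" by (intro mult_right_mono norm_blinfun) auto
  finally have "norm ?z * norm ?z \<le> norm ?z * (norm T * norm y)"
    by (simp add: power2_eq_square mult_ac)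
  then show "norm ?z \<le> norm T * norm y"
    by (cases "norm ?z = 0") (auto simp: mult_le_cancel_left)
qed simp

typedef (overloaded) 'h adjop = "{p :: ('h::hmod \<Rightarrow>\<^sub>L 'h) \<times> ('h \<Rightarrow>\<^sub>L 'h). adjoint_pair p}"
  morphisms pair_of adjop_of_pair
  by (intro exI[of _ 0]) (simp add: adjoint_pair_def ip_zero_left ip_zero_right)

setup_lifting type_definition_adjop

lemma norm_snd_adjoint_pair:
  assumes "adjoint_pair p" shows "norm (snd p) = norm (fst p)"
  using adjoint_pair_norm_le[of "fst p" "snd p"] adjoint_pair_norm_le[of "snd p" "fst p"] assms
  by (auto simp: adjoint_pair_def)

instantiation adjop :: (hmod) real_normed_algebra
begin

lift_definition zero_adjop :: "'a adjop" is 0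
  by (simp add: adjoint_pair_def ip_zero_left ip_zero_right)
lift_definition plus_adjop :: "'a adjop \<Rightarrow> 'a adjop \<Rightarrow> 'a adjop" is "(+)"
  by (simp add: adjoint_pair_def blinfun.add_left ip_add_left ip_add_right)
lift_definition uminus_adjop :: "'a adjop \<Rightarrow> 'a adjop" is "uminus"
  by (simp add: adjoint_pair_def blinfun.minus_left ip_minus_left ip_minus_right)
lift_definition minus_adjop :: "'a adjop \<Rightarrow> 'a adjop \<Rightarrow> 'a adjop" is "(-)"
  by (simp add: adjoint_pair_def blinfun.diff_left ip_diff_left ip_diff_right)
lift_definition scaleR_adjop :: "real \<Rightarrow> 'a adjop \<Rightarrow> 'a adjop" is "scaleR"
  by (simp add: adjoint_pair_def blinfun.scaleR_left ip_scaleR_left ip_scaleR_right)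
lift_definition times_adjop :: "'a adjop \<Rightarrow> 'a adjop \<Rightarrow> 'a adjop"
  is "\<lambda>p q. (fst p o\<^sub>L fst q, snd q o\<^sub>L snd p)"
  by (simp add: adjoint_pair_def)
lift_definition norm_adjop :: "'a adjop \<Rightarrow> real" is "\<lambda>p. norm (fst p)" .
definition dist_adjop :: "'a adjop \<Rightarrow> 'a adjop \<Rightarrow> real" where "dist_adjop x y = norm (x - y)"
definition sgn_adjop :: "'a adjop \<Rightarrow> 'a adjop" where "sgn_adjop x = inverse (norm x) *\<^sub>R x"
definition uniformity_adjop :: "('a adjop \<times> 'a adjop) filter" where
  "uniformity_adjop = (INF e\<in>{0 <..}. principal {(x, y). dist x y < e})"
definition open_adjop :: "'a adjop set \<Rightarrow> bool" where
  "open_adjop U = (\<forall>x\<in>U. \<forall>\<^sub>F (x', y) in uniformity. x' = x \<longrightarrow> y \<in> U)"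

instance
proof
  fix x y z :: "'a adjop" and a b :: real
  show "x + y + z = x + (y + z)" by transfer (rule add.assoc)
  show "x + y = y + x" by transfer (rule add.commute)
  show "0 + x = x" by transfer simp
  show "- x + x = 0" by transfer simp
  show "x - y = x + - y" by transfer simp
  show "a *\<^sub>R (x + y) = a *\<^sub>R x + a *\<^sub>R y" by transfer (rule scaleR_add_right)
  show "(a + b) *\<^sub>R x = a *\<^sub>R x + b *\<^sub>R x" by transfer (rule scaleR_add_left)
  show "a *\<^sub>R b *\<^sub>R x = (a * b) *\<^sub>R x" by transfer simp
  show "1 *\<^sub>R x = x" by transfer simp
  show "x * y * z = x * (y * z)" by transfer (auto intro!: blinfun_eqI)
  show "(x + y) * z = x * z + y * z"
    by transfer (simp add: bounded_bilinear.add_left[OF bounded_bilinear_blinfun_compose]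
        bounded_bilinear.add_right[OF bounded_bilinear_blinfun_compose])
  show "x * (y + z) = x * y + x * z"
    by transfer (simp add: bounded_bilinear.add_left[OF bounded_bilinear_blinfun_compose]
        bounded_bilinear.add_right[OF bounded_bilinear_blinfun_compose])
  show "a *\<^sub>R x * y = a *\<^sub>R (x * y)"
    by transfer (simp add: bounded_bilinear.scaleR_left[OF bounded_bilinear_blinfun_compose]
        bounded_bilinear.scaleR_right[OF bounded_bilinear_blinfun_compose] scaleR_prod_def)
  show "x * a *\<^sub>R y = a *\<^sub>R (x * y)"
    by transfer (simp add: bounded_bilinear.scaleR_left[OF bounded_bilinear_blinfun_compose]
        bounded_bilinear.scaleR_right[OF bounded_bilinear_blinfun_compose] scaleR_prod_def)
  show "dist x y = norm (x - y)" by (rule dist_adjop_def)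
  show "sgn x = inverse (norm x) *\<^sub>R x" by (rule sgn_adjop_def)
  show "uniformity = (INF e\<in>{0 <..}. principal {(x, y). dist (x::'a adjop) y < e})"
    by (rule uniformity_adjop_def)
  show "open U = (\<forall>x\<in>U. \<forall>\<^sub>F (x', y) in uniformity. x' = x \<longrightarrow> y \<in> U)" for U :: "'a adjop set"
    by (rule open_adjop_def)
  show "norm x = 0 \<longleftrightarrow> x = 0"
  proof transfer
    fix x :: "('a \<Rightarrow>\<^sub>L 'a) \<times> ('a \<Rightarrow>\<^sub>L 'a)" assume "adjoint_pair x"
    then show "norm (fst x) = 0 \<longleftrightarrow> x = 0"
      using norm_snd_adjoint_pair[of x] by (auto simp: prod_eq_iff)
  qed
  show "norm (x + y) \<le> norm x + norm y" by transfer (simp add: norm_triangle_ineq)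
  show "norm (a *\<^sub>R x) = \<bar>a\<bar> * norm x" by transfer simp
  show "norm (x * y) \<le> norm x * norm y" by transfer (simp add: norm_blinfun_compose)
qed

end

lift_definition adjop_one :: "'h::hmod adjop" is "(id_blinfun, id_blinfun)"
  by (simp add: adjoint_pair_def)
lift_definition adjop_star :: "'h::hmod adjop \<Rightarrow> 'h adjop" is "\<lambda>p. (snd p, fst p)"
  by (simp add: adjoint_pair_def)
lift_definition adjop_iu :: "'h::hmod adjop" is "(Blinfun J, - Blinfun J)"
  by (simp add: adjoint_pair_def bounded_linear_Blinfun_apply bounded_linear_J blinfun.minus_left
      ip_J_left ip_J_right ip_minus_left ip_minus_right)

instantiation adjop :: (hmod) cstar_unital
begin

definition one_adjop :: "'a adjop" where "one_adjop = adjop_one"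
definition adj_adjop :: "'a adjop \<Rightarrow> 'a adjop" where "adj_adjop = adjop_star"
definition iu_adjop :: "'a adjop" where "iu_adjop = adjop_iu"

instance
proof
  fix x y z :: "'a adjop" and r :: real
  show "1 * x = x" unfolding one_adjop_def by transfer (auto intro!: prod_eqI blinfun_eqI)
  show "x * 1 = x" unfolding one_adjop_def by transfer (auto intro!: prod_eqI blinfun_eqI)
  show "adj (x + y) = adj x + adj y" unfolding adj_adjop_def by transfer simp
  show "adj (r *\<^sub>R x) = r *\<^sub>R adj x"
    unfolding adj_adjop_def by transfer (simp add: scaleR_prod_def)
  show "adj (x * y) = adj y * adj x" unfolding adj_adjop_def by transfer simp
  show "adj (adj x) = x" unfolding adj_adjop_def by transfer simp
  show "iu * iu = (- 1 :: 'a adjop)"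
    unfolding one_adjop_def iu_adjop_def by transfer (auto intro!: blinfun_eqI simp: bounded_linear_Blinfun_apply bounded_linear_J
        blinfun.bilinear_simps J_J J_minus)
  \<comment> \<open>An operator with an adjoint commutes with J automatically: both sides reduce to
    \<open>- J (ip u (T' v))\<close>. This makes \<open>iu\<close> central.\<close>
  have J: "ip (blinfun_apply T (J u)) v = ip (J (blinfun_apply T u)) v"
    if "\<forall>x y. ip (blinfun_apply T x) y = ip x (blinfun_apply T' y)" for T T' :: "'a \<Rightarrow>\<^sub>L 'a" and u v
    using that by (simp add: ip_J_left)
  show "iu * x = x * iu"
    unfolding iu_adjop_def
  proof transfer
    fix x :: "('a \<Rightarrow>\<^sub>L 'a) \<times> ('a \<Rightarrow>\<^sub>L 'a)" assume x: "adjoint_pair x"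
    have "blinfun_apply (fst x) (J u) = J (blinfun_apply (fst x) u)" for u
      by (rule ip_eqI, rule J[of _ "snd x"]) (use x in \<open>simp add: adjoint_pair_def\<close>)
    moreover have "blinfun_apply (snd x) (J u) = J (blinfun_apply (snd x) u)" for u
      by (rule ip_eqI, rule J[of _ "fst x"]) (use x in \<open>simp add: adjoint_pair_def\<close>)
    ultimately show "(fst (Blinfun J, - Blinfun J) o\<^sub>L fst x, snd x o\<^sub>L snd (Blinfun J, - Blinfun J))
      = (fst x o\<^sub>L fst (Blinfun J, - Blinfun J), snd (Blinfun J, - Blinfun J) o\<^sub>L snd x)"
      by (auto intro!: blinfun_eqI simp: bounded_linear_Blinfun_apply bounded_linear_J
        blinfun.bilinear_simps)
  qed
  show "adj iu = (- iu :: 'a adjop)" unfolding adj_adjop_def iu_adjop_def by transfer simp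
  show "norm (adj x * x) = (norm x)\<^sup>2"
    unfolding adj_adjop_def
  proof transfer
    fix x :: "('a \<Rightarrow>\<^sub>L 'a) \<times> ('a \<Rightarrow>\<^sub>L 'a)" assume x: "adjoint_pair x"
    obtain T T' where T: "x = (T, T')" by (cases x)
    \<comment> \<open>The nontrivial half of the C*-identity: the square of the norm of T u is the
      norm of the inner product of u with T' (T u), which Cauchy-Schwarz estimates.\<close>
    have "norm T \<le> sqrt (norm (T' o\<^sub>L T))"
    proof (rule norm_blinfun_bound)
      fix u
      have "(norm (blinfun_apply T u))\<^sup>2 = norm (ip u (blinfun_apply (T' o\<^sub>L T) u))"
        using x T by (simp add: norm_ip_self[symmetric] adjoint_pair_def)
      also have "\<dots> \<le> norm u * norm (blinfun_apply (T' o\<^sub>L T) u)" by (rule norm_ip_le)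
      also have "\<dots> \<le> norm u * (norm (T' o\<^sub>L T) * norm u)" by (intro mult_left_mono norm_blinfun) auto
      also have "\<dots> = (sqrt (norm (T' o\<^sub>L T)) * norm u)\<^sup>2" by (simp add: power_mult_distrib power2_eq_square)
      finally show "norm (blinfun_apply T u) \<le> sqrt (norm (T' o\<^sub>L T)) * norm u"
        by (rule power2_le_imp_le) simp
    qed simp
    then have "(norm T)\<^sup>2 \<le> (sqrt (norm (T' o\<^sub>L T)))\<^sup>2" by (intro power_mono) auto
    then have "(norm T)\<^sup>2 \<le> norm (T' o\<^sub>L T)" by simp
    moreover have "norm (T' o\<^sub>L T) \<le> norm T' * norm T" by (rule norm_blinfun_compose)
    moreover have "norm T' = norm T" using norm_snd_adjoint_pair[OF x] T by simp
    ultimately show "norm (fst (fst (snd x, fst x) o\<^sub>L fst x, snd x o\<^sub>L snd (snd x, fst x))) = (norm (fst x))\<^sup>2"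
      using T by (simp add: power2_eq_square)
  qed
  fix X :: "nat \<Rightarrow> 'a adjop" assume "Cauchy X"
  define p where "p n = pair_of (X n)" for n
  have ap: "adjoint_pair (p n)" for n using pair_of[of "X n"] by (simp add: p_def)
  have nX: "norm (X m - X n) = norm (fst (p m) - fst (p n))" for m n
    unfolding p_def by transfer simp
  have nS: "norm (snd (p m) - snd (p n)) = norm (fst (p m) - fst (p n))" for m n
    using norm_snd_adjoint_pair[of "p m - p n"] pair_of[of "X m - X n"]
    by (simp add: p_def minus_adjop.rep_eq)
  have "Cauchy (\<lambda>n. fst (p n))" "Cauchy (\<lambda>n. snd (p n))"
    using \<open>Cauchy X\<close> by (simp_all add: Cauchy_iff nX nS)
  then obtain T T' where T: "(\<lambda>n. fst (p n)) \<longlonglongrightarrow> T" and T': "(\<lambda>n. snd (p n)) \<longlonglongrightarrow> T'"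
    by (auto simp: Cauchy_convergent_iff convergent_def)
  have Tx: "(\<lambda>n. blinfun_apply (fst (p n)) x) \<longlonglongrightarrow> blinfun_apply T x"
    "(\<lambda>n. blinfun_apply (snd (p n)) x) \<longlonglongrightarrow> blinfun_apply T' x" for x
    by (intro blinfun.tendsto T T' tendsto_const)+
  have "adjoint_pair (T, T')"
    unfolding adjoint_pair_def fst_conv snd_conv
  proof (intro conjI allI)
    fix x y
    show "ip (blinfun_apply T x) y = ip x (blinfun_apply T' y)"
      by (rule LIMSEQ_unique[OF tendsto_ip[OF Tx(1) tendsto_const]])
        (use ap in \<open>simp add: adjoint_pair_def tendsto_ip[OF tendsto_const Tx(2)]\<close>)
    show "ip (blinfun_apply T' x) y = ip x (blinfun_apply T y)"
      by (rule LIMSEQ_unique[OF tendsto_ip[OF Tx(2) tendsto_const]])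
        (use ap in \<open>simp add: adjoint_pair_def tendsto_ip[OF tendsto_const Tx(1)]\<close>)
  qed
  then have "norm (X n - adjop_of_pair (T, T')) = norm (fst (p n) - T)" for n
    by (simp add: norm_adjop.rep_eq minus_adjop.rep_eq adjop_of_pair_inverse p_def)
  then have "X \<longlonglongrightarrow> adjop_of_pair (T, T')"
    using T by (simp add: LIMSEQ_iff)
  then show "convergent X" by (auto simp: convergent_def)
qed

end

lift_definition adjop_apply :: "'h::hmod adjop \<Rightarrow> 'h \<Rightarrow> 'h" is "\<lambda>p. blinfun_apply (fst p)" .

text \<open>An operator determines its adjoint: the norm of \<open>adjop\<close> sees only the first
  component of a pair, and norm 0 forces the whole pair to vanish.\<close>

lemma adjop_eqI:
  assumes "\<And>u. adjop_apply x u = adjop_apply y u"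
  shows "x = y"
proof -
  have "fst (pair_of (x - y)) = fst (pair_of x) - fst (pair_of y)"
    by (simp add: minus_adjop.rep_eq)
  moreover have "fst (pair_of x) = fst (pair_of y)"
    using assms by (intro blinfun_eqI) (simp add: adjop_apply.rep_eq)
  ultimately have "norm (x - y) = 0" by (simp add: norm_adjop.rep_eq)
  then show ?thesis by simp
qed

lemma adjop_apply_simps:
  "adjop_apply (x + y) u = adjop_apply x u + adjop_apply y u"
  "adjop_apply (x * y) u = adjop_apply x (adjop_apply y u)"
  "adjop_apply (r *\<^sub>R x) u = r *\<^sub>R adjop_apply x u"
  "adjop_apply iu u = J u"
  "adjop_apply (0::'h::hmod adjop) u = 0"
proof -
  show "adjop_apply (x + y) u = adjop_apply x u + adjop_apply y u"
    by transfer (simp add: blinfun.add_left)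
  show "adjop_apply (x * y) u = adjop_apply x (adjop_apply y u)" by transfer simp
  show "adjop_apply (r *\<^sub>R x) u = r *\<^sub>R adjop_apply x u"
    by transfer (simp add: blinfun.scaleR_left)
  show "adjop_apply iu u = J u"
    unfolding iu_adjop_def by transfer (simp add: bounded_linear_Blinfun_apply bounded_linear_J)
  show "adjop_apply (0::'h adjop) u = 0" by transfer simp
qed

lemma norm_adjop_apply: "norm (adjop_apply x u) \<le> norm x * norm u"
  by transfer (simp add: norm_blinfun)

lemma norm_adjop_le:
  "0 \<le> c \<Longrightarrow> (\<And>u. norm (adjop_apply x u) \<le> c * norm u) \<Longrightarrow> norm x \<le> c"
  by transfer (rule norm_blinfun_bound)

definition make_adjop :: "('h::hmod \<Rightarrow> 'h) \<Rightarrow> ('h \<Rightarrow> 'h) \<Rightarrow> 'h adjop" where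
  "make_adjop T T' = adjop_of_pair (Blinfun T, Blinfun T')"

lemma make_adjop:
  assumes "bounded_linear T" "bounded_linear T'"
    and "\<And>x y. ip (T x) y = ip x (T' y)" "\<And>x y. ip (T' x) y = ip x (T y)"
  shows adjop_apply_make: "adjop_apply (make_adjop T T') u = T u"
    and adj_make_adjop: "adj (make_adjop T T') = make_adjop T' T"
proof -
  have "adjoint_pair (Blinfun T, Blinfun T')" "adjoint_pair (Blinfun T', Blinfun T)"
    using assms by (simp_all add: adjoint_pair_def bounded_linear_Blinfun_apply)
  then show "adjop_apply (make_adjop T T') u = T u" "adj (make_adjop T T') = make_adjop T' T"
    using assms
    by (simp_all add: make_adjop_def adjop_apply.rep_eq adjop_of_pair_inverse
        bounded_linear_Blinfun_apply adj_adjop_def adjop_star.abs_eq eq_onp_def)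
qed

section \<open>Embedding C*-algebras into types\<close>

lemma complex_ring_simps [simp]:
  "carrier complex_ring = UNIV" "a \<otimes>\<^bsub>complex_ring\<^esub> b = a * b" "\<one>\<^bsub>complex_ring\<^esub> = 1"
  "\<zero>\<^bsub>complex_ring\<^esub> = 0" "a \<oplus>\<^bsub>complex_ring\<^esub> b = a + b"
  by (simp_all add: complex_ring_def)

lemma cring_complex_ring: "cring complex_ring"
proof (rule cringI)
  show "abelian_group complex_ring"
  proof (rule abelian_groupI)
    show "\<exists>y\<in>carrier complex_ring. y \<oplus>\<^bsub>complex_ring\<^esub> x = \<zero>\<^bsub>complex_ring\<^esub>" for x
      by (auto intro: exI[of _ "- x"])
  qed auto
  show "comm_monoid complex_ring"
    by (rule comm_monoidI) auto
qed (auto simp: distrib_right)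

context cstar_algebra
begin

lemma smult_one' [simp]: "x \<in> carrier A \<Longrightarrow> 1 \<odot> x = x"
  using smult_one by simp

lemma smult_smult: "x \<in> carrier A \<Longrightarrow> c \<odot> (d \<odot> x) = (c * d) \<odot> x"
  using smult_assoc1[of c d x] by simp

lemma smult_add_left: "x \<in> carrier A \<Longrightarrow> (c + d) \<odot> x = c \<odot> x \<oplus> d \<odot> x"
proof -
  assume x: "x \<in> carrier A"
  have "(c \<oplus>\<^bsub>complex_ring\<^esub> d) \<odot> x = c \<odot> x \<oplus> d \<odot> x" by (rule smult_l_distr) (simp_all add: x)
  then show ?thesis by (simp only: complex_ring_simps)
qed

lemma smult_zero_left [simp]: "x \<in> carrier A \<Longrightarrow> 0 \<odot> x = \<zero>"
  using smult_l_null by simp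

lemma uminus_eq_smult: "x \<in> carrier A \<Longrightarrow> \<ominus> x = (- 1) \<odot> x"
  using smult_add_left[of x "-1" 1] by (intro minus_equality) simp_all

lemma minus_eq_smult: "x \<in> carrier A \<Longrightarrow> y \<in> carrier A \<Longrightarrow> x \<ominus> y = x \<oplus> (- 1) \<odot> y"
  by (simp add: a_minus_def uminus_eq_smult)

lemma minus_zero [simp]: "x \<in> carrier A \<Longrightarrow> x \<ominus> \<zero> = x"
  by (simp add: minus_eq_smult)

lemma cnorm_zero [simp]: "cnorm A \<zero> = 0"
  by (simp add: cnorm_eq_zero)

lemma zero_mult [simp]: "x \<in> carrier A \<Longrightarrow> \<zero> \<otimes> x = \<zero>"
  using smult_mult_left[of \<zero> x 0] by (simp add: mult_closed)

lemma mult_zero [simp]: "x \<in> carrier A \<Longrightarrow> x \<otimes> \<zero> = \<zero>"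
  using smult_mult_right[of x \<zero> 0] by (simp add: mult_closed)

lemma star_zero [simp]: "star A \<zero> = \<zero>"
  using star_smult[of \<zero> 0] by (simp add: star_closed)

lemma cnorm_star_le: "x \<in> carrier A \<Longrightarrow> cnorm A x \<le> cnorm A (star A x)"
proof (cases "cnorm A x = 0")
  case False
  assume x: "x \<in> carrier A"
  have "cnorm A x * cnorm A x \<le> cnorm A (star A x) * cnorm A x"
    using cstar_identity[OF x] cnorm_mult[OF star_closed[OF x] x] by (simp add: power2_eq_square)
  then show ?thesis using False cnorm_nonneg[OF x] by simp
qed (simp add: cnorm_nonneg star_closed)

lemma cnorm_star [simp]: "x \<in> carrier A \<Longrightarrow> cnorm A (star A x) = cnorm A x"
  using cnorm_star_le[of x] cnorm_star_le[of "star A x"] by (simp add: star_closed star_star)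

lemma cnorm_minus_commute: "x \<in> carrier A \<Longrightarrow> y \<in> carrier A \<Longrightarrow> cnorm A (x \<ominus> y) = cnorm A (y \<ominus> x)"
proof -
  assume xy: "x \<in> carrier A" "y \<in> carrier A"
  have "y \<ominus> x = (- 1) \<odot> (x \<ominus> y)"
    using xy by (simp add: minus_eq_smult smult_r_distr smult_smult a_comm)
  then show ?thesis using xy cnorm_smult[of "x \<ominus> y" "-1"] by simp
qed

lemma cnorm_diff_triangle:
  assumes "x \<in> carrier A" "y \<in> carrier A" "z \<in> carrier A"
  shows "cnorm A (x \<ominus> z) \<le> cnorm A (x \<ominus> y) + cnorm A (y \<ominus> z)"
proof -

  have "x \<ominus> z = (x \<ominus> y) \<oplus> (y \<ominus> z)"
    using assms by (simp add: a_minus_def a_assoc r_neg2 r_neg1)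
  then show ?thesis using cnorm_triangle[of "x \<ominus> y" "y \<ominus> z"] assms by simp
qed

end

text \<open>
  The bounded families indexed by all C*-algebras on the type \<^typ>\<open>'a\<close>, with operations
  componentwise.  A type definition cannot depend on a given C*-algebra; taking the product of all
  of them gives a single type on which each of them acts.
\<close>

definition cfamilies :: "('a cstar \<Rightarrow> 'a) set" where
  "cfamilies = {x. (\<forall>A. cstar_algebra A \<longrightarrow> x A \<in> carrier A) \<and> (\<forall>A. \<not> cstar_algebra A \<longrightarrow> x A = undefined) \<and>
     (\<exists>K. \<forall>A. cstar_algebra A \<longrightarrow> cnorm A (x A) \<le> K)}"

text \<open>The value at records that are not C*-algebras is fixed, so that a family is determined
  by its genuine coordinates, as in \<open>cprod_eqI\<close>.\<close>

definition on_cstar :: "('a cstar \<Rightarrow> 'a) \<Rightarrow> 'a cstar \<Rightarrow> 'a" where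
  "on_cstar f = (\<lambda>A. if cstar_algebra A then f A else undefined)"

lemma on_cstar_in_cfamilies:
  assumes "\<And>A. cstar_algebra A \<Longrightarrow> f A \<in> carrier A" "\<And>A. cstar_algebra A \<Longrightarrow> cnorm A (f A) \<le> K"
  shows "on_cstar f \<in> cfamilies"
  using assms unfolding cfamilies_def on_cstar_def by auto

lemma zero_in_cfamilies: "on_cstar (\<lambda>A. \<zero>\<^bsub>A\<^esub>) \<in> cfamilies"
proof (rule on_cstar_in_cfamilies[where K=0])
  fix A :: "'a cstar" assume "cstar_algebra A"
  then interpret cstar_algebra A .
  show "\<zero>\<^bsub>A\<^esub> \<in> carrier A" "cnorm A \<zero>\<^bsub>A\<^esub> \<le> 0" by simp_all
qed

typedef 'a cprod = "cfamilies :: ('a cstar \<Rightarrow> 'a) set"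
  morphisms coord family
  using zero_in_cfamilies by blast

lemma coord_carrier: "cstar_algebra A \<Longrightarrow> coord x A \<in> carrier A"
  using coord[of x] by (simp add: cfamilies_def)

lemma cprod_eqI:
  assumes "\<And>A. cstar_algebra A \<Longrightarrow> coord x A = coord y A"
  shows "x = y"
proof -
  have "coord x A = coord y A" for A
    using assms coord[of x] coord[of y] unfolding cfamilies_def by (cases "cstar_algebra A") auto
  then have "coord x = coord y" by (rule ext)
  then show ?thesis by (simp only: coord_inject)
qed

lemma coord_family:
  assumes "\<And>A. cstar_algebra A \<Longrightarrow> f A \<in> carrier A" "\<And>A. cstar_algebra A \<Longrightarrow> cnorm A (f A) \<le> K"
    "cstar_algebra A"
  shows "coord (family (on_cstar f)) A = f A"
  using family_inverse[OF on_cstar_in_cfamilies[of f K]] assms by (simp add: on_cstar_def)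

text \<open>Inserting 0 makes the set nonempty without exhibiting a C*-algebra on the type.\<close>

definition cprod_norm :: "'a cprod \<Rightarrow> real" where
  "cprod_norm x = Sup (insert 0 ((\<lambda>A. cnorm A (coord x A)) ` {A. cstar_algebra A}))"

lemma cnorm_coord_le:
  assumes "cstar_algebra A"
  shows "cnorm A (coord x A) \<le> cprod_norm x"
proof -
  obtain K where "\<forall>A. cstar_algebra A \<longrightarrow> cnorm A (coord x A) \<le> K"
    using coord[of x] unfolding cfamilies_def by blast
  then have "bdd_above (insert 0 ((\<lambda>A. cnorm A (coord x A)) ` {A. cstar_algebra A}))"
    by (intro bdd_aboveI[of _ "max 0 K"]) auto
  then show ?thesis unfolding cprod_norm_def using assms by (intro cSup_upper) auto
qed

lemma cprod_norm_le:
  "0 \<le> c \<Longrightarrow> (\<And>A. cstar_algebra A \<Longrightarrow> cnorm A (coord x A) \<le> c) \<Longrightarrow> cprod_norm x \<le> c"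
  unfolding cprod_norm_def by (rule cSup_least) auto

lemma cprod_norm_nonneg: "0 \<le> cprod_norm (x :: 'a cprod)"
proof -
  obtain K where "\<forall>A. cstar_algebra A \<longrightarrow> cnorm A (coord x A) \<le> K"
    using coord[of x] unfolding cfamilies_def by blast
  then have "bdd_above (insert 0 ((\<lambda>A. cnorm A (coord x A)) ` {A. cstar_algebra A}))"
    by (intro bdd_aboveI[of _ "max 0 K"]) auto
  then show ?thesis unfolding cprod_norm_def by (intro cSup_upper) auto
qed

instantiation cprod :: (type) real_vector
begin

definition zero_cprod :: "'a cprod" where
  "zero_cprod = family (on_cstar (\<lambda>A. \<zero>\<^bsub>A\<^esub>))"
definition plus_cprod :: "'a cprod \<Rightarrow> 'a cprod \<Rightarrow> 'a cprod" where
  "plus_cprod x y = family (on_cstar (\<lambda>A. coord x A \<oplus>\<^bsub>A\<^esub> coord y A))"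
definition scaleR_cprod :: "real \<Rightarrow> 'a cprod \<Rightarrow> 'a cprod" where
  "scaleR_cprod r x = family (on_cstar (\<lambda>A. complex_of_real r \<odot>\<^bsub>A\<^esub> coord x A))"
definition uminus_cprod :: "'a cprod \<Rightarrow> 'a cprod" where
  "uminus_cprod x = (-1) *\<^sub>R x"
definition minus_cprod :: "'a cprod \<Rightarrow> 'a cprod \<Rightarrow> 'a cprod" where
  "minus_cprod x y = x + - y"

lemma coord_zero: "cstar_algebra A \<Longrightarrow> coord 0 A = \<zero>\<^bsub>A\<^esub>"
  unfolding zero_cprod_def family_inverse[OF zero_in_cfamilies] by (simp add: on_cstar_def)

lemma coord_add: "cstar_algebra A \<Longrightarrow> coord (x + y) A = coord x A \<oplus>\<^bsub>A\<^esub> coord y A"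
  unfolding plus_cprod_def
proof (rule coord_family)
  fix A :: "'a cstar" assume A: "cstar_algebra A"
  then interpret cstar_algebra A .
  show "coord x A \<oplus>\<^bsub>A\<^esub> coord y A \<in> carrier A" using A by (simp add: coord_carrier)
  show "cnorm A (coord x A \<oplus>\<^bsub>A\<^esub> coord y A) \<le> cprod_norm x + cprod_norm y"
    using cnorm_triangle[OF coord_carrier[OF A] coord_carrier[OF A], of x y]
      cnorm_coord_le[OF A, of x] cnorm_coord_le[OF A, of y] by linarith
qed

lemma coord_scaleR: "cstar_algebra A \<Longrightarrow> coord (r *\<^sub>R x) A = complex_of_real r \<odot>\<^bsub>A\<^esub> coord x A"
  unfolding scaleR_cprod_def
proof (rule coord_family)
  fix A :: "'a cstar" assume A: "cstar_algebra A"
  then interpret cstar_algebra A .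
  show "complex_of_real r \<odot>\<^bsub>A\<^esub> coord x A \<in> carrier A" using A by (simp add: coord_carrier)
  show "cnorm A (complex_of_real r \<odot>\<^bsub>A\<^esub> coord x A) \<le> \<bar>r\<bar> * cprod_norm x"
    using cnorm_coord_le[OF A, of x] by (simp add: cnorm_smult coord_carrier A mult_left_mono)
qed

instance
proof
  fix x y z :: "'a cprod" and a b :: real
  show "x - y = x + - y" by (rule minus_cprod_def)
  have "x + y + z = x + (y + z) \<and> x + y = y + x \<and> 0 + x = x \<and> - x + x = 0 \<and>
    a *\<^sub>R (x + y) = a *\<^sub>R x + a *\<^sub>R y \<and> (a + b) *\<^sub>R x = a *\<^sub>R x + b *\<^sub>R x \<and>
    a *\<^sub>R b *\<^sub>R x = (a * b) *\<^sub>R x \<and> 1 *\<^sub>R x = x"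
  proof (intro conjI; rule cprod_eqI)
    fix A :: "'a cstar" assume A: "cstar_algebra A"
    then interpret cstar_algebra A .
    note c = coord_carrier[OF A] coord_zero[OF A] coord_add[OF A] coord_scaleR[OF A]
    show "coord (x + y + z) A = coord (x + (y + z)) A" by (simp add: c a_assoc)
    show "coord (x + y) A = coord (y + x) A" by (simp add: c a_comm)
    show "coord (0 + x) A = coord x A" by (simp add: c)
    show "coord (- x + x) A = coord 0 A"
      using uminus_eq_smult[of "coord x A"] l_neg[of "coord x A"] by (simp add: uminus_cprod_def c)
    show "coord (a *\<^sub>R (x + y)) A = coord (a *\<^sub>R x + a *\<^sub>R y) A" by (simp add: c smult_r_distr)
    show "coord ((a + b) *\<^sub>R x) A = coord (a *\<^sub>R x + b *\<^sub>R x) A" by (simp add: c smult_add_left)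
    show "coord (a *\<^sub>R b *\<^sub>R x) A = coord ((a * b) *\<^sub>R x) A" by (simp add: c smult_smult)
    show "coord (1 *\<^sub>R x) A = coord x A" by (simp add: c)
  qed
  then show "x + y + z = x + (y + z)" "x + y = y + x" "0 + x = x" "- x + x = 0"
    "a *\<^sub>R (x + y) = a *\<^sub>R x + a *\<^sub>R y" "(a + b) *\<^sub>R x = a *\<^sub>R x + b *\<^sub>R x"
    "a *\<^sub>R b *\<^sub>R x = (a * b) *\<^sub>R x" "1 *\<^sub>R x = x"
    by blast+
qed

end

lemma coord_diff:
  assumes A: "cstar_algebra A"
  shows "coord (x - y) A = coord x A \<ominus>\<^bsub>A\<^esub> coord y A"
proof -
  interpret cstar_algebra A by (rule A)
  have "coord (x - y) A = coord (x + (-1) *\<^sub>R y) A" by simp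
  also have "\<dots> = coord x A \<oplus>\<^bsub>A\<^esub> complex_of_real (-1) \<odot>\<^bsub>A\<^esub> coord y A"
    by (simp only: coord_add[OF A] coord_scaleR[OF A])
  finally show ?thesis by (simp add: minus_eq_smult coord_carrier[OF A])
qed

instantiation cprod :: (type) real_normed_vector
begin

definition norm_cprod :: "'a cprod \<Rightarrow> real" where "norm_cprod = cprod_norm"
definition dist_cprod :: "'a cprod \<Rightarrow> 'a cprod \<Rightarrow> real" where "dist_cprod x y = norm (x - y)"
definition sgn_cprod :: "'a cprod \<Rightarrow> 'a cprod" where "sgn_cprod x = inverse (norm x) *\<^sub>R x"
definition uniformity_cprod :: "('a cprod \<times> 'a cprod) filter" where
  "uniformity_cprod = (INF e\<in>{0 <..}. principal {(x, y). dist x y < e})"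
definition open_cprod :: "'a cprod set \<Rightarrow> bool" where
  "open_cprod U = (\<forall>x\<in>U. \<forall>\<^sub>F (x', y) in uniformity. x' = x \<longrightarrow> y \<in> U)"

instance
proof
  fix x y :: "'a cprod" and a :: real
  show "dist x y = norm (x - y)" by (rule dist_cprod_def)
  show "sgn x = inverse (norm x) *\<^sub>R x" by (rule sgn_cprod_def)
  show "uniformity = (INF e\<in>{0 <..}. principal {(x, y). dist (x::'a cprod) y < e})"
    by (rule uniformity_cprod_def)
  show "open U = (\<forall>x\<in>U. \<forall>\<^sub>F (x', y) in uniformity. x' = x \<longrightarrow> y \<in> U)" for U :: "'a cprod set"
    by (rule open_cprod_def)
  show "norm x = 0 \<longleftrightarrow> x = 0"
  proof
    assume 0: "norm x = 0"
    show "x = 0"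
    proof (rule cprod_eqI)
      fix A :: "'a cstar" assume A: "cstar_algebra A"
      then interpret cstar_algebra A .
      have "cnorm A (coord x A) = 0"
        using cnorm_coord_le[OF A, of x] cnorm_nonneg[OF coord_carrier[OF A], of x] 0
        by (simp add: norm_cprod_def)
      then show "coord x A = coord 0 A"
        by (simp add: cnorm_eq_zero coord_carrier[OF A] coord_zero[OF A])
    qed
  next
    have "cprod_norm (0::'a cprod) \<le> 0"
    proof (rule cprod_norm_le)
      fix A :: "'a cstar" assume A: "cstar_algebra A"
      then interpret cstar_algebra A .
      show "cnorm A (coord 0 A) \<le> 0" by (simp add: coord_zero[OF A])
    qed simp
    moreover assume "x = 0"
    ultimately show "norm x = 0" using cprod_norm_nonneg[of x] by (simp add: norm_cprod_def)
  qed
  show "norm (x + y) \<le> norm x + norm y"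
    unfolding norm_cprod_def
  proof (rule cprod_norm_le)
    fix A :: "'a cstar" assume A: "cstar_algebra A"
    then interpret cstar_algebra A .
    show "cnorm A (coord (x + y) A) \<le> cprod_norm x + cprod_norm y"
      using cnorm_triangle[OF coord_carrier[OF A] coord_carrier[OF A], of x y]
        cnorm_coord_le[OF A, of x] cnorm_coord_le[OF A, of y] by (simp add: coord_add[OF A])
  qed (simp add: cprod_norm_nonneg)
  have le: "norm (a *\<^sub>R x) \<le> \<bar>a\<bar> * norm x" for a and x :: "'a cprod"
    unfolding norm_cprod_def
  proof (rule cprod_norm_le)
    fix A :: "'a cstar" assume A: "cstar_algebra A"
    then interpret cstar_algebra A .
    show "cnorm A (coord (a *\<^sub>R x) A) \<le> \<bar>a\<bar> * cprod_norm x"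
      using cnorm_coord_le[OF A, of x]
      by (simp add: coord_scaleR[OF A] cnorm_smult coord_carrier[OF A] mult_left_mono)
  qed (simp add: cprod_norm_nonneg)
  show "norm (a *\<^sub>R x) = \<bar>a\<bar> * norm x"
  proof (cases "a = 0")
    case True
    then show ?thesis using le[of 0 x] cprod_norm_nonneg[of "0 *\<^sub>R x"] by (simp add: norm_cprod_def)
  next
    case False
    have "norm x \<le> \<bar>inverse a\<bar> * norm (a *\<^sub>R x)" using le[of "inverse a" "a *\<^sub>R x"] False by simp
    then have "\<bar>a\<bar> * norm x \<le> norm (a *\<^sub>R x)" using False by (simp add: field_simps)
    then show ?thesis using le[of a x] by simp
  qed
qed

end

lemma cnorm_coord_le_norm: "cstar_algebra A \<Longrightarrow> cnorm A (coord x A) \<le> norm x"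
  unfolding norm_cprod_def by (rule cnorm_coord_le)

lemma norm_cprod_le:
  "0 \<le> c \<Longrightarrow> (\<And>A. cstar_algebra A \<Longrightarrow> cnorm A (coord x A) \<le> c) \<Longrightarrow> norm x \<le> c"
  unfolding norm_cprod_def by (rule cprod_norm_le)

instance cprod :: (type) banach
proof
  fix X :: "nat \<Rightarrow> 'a cprod" assume X: "Cauchy X"
  have "\<exists>L. L \<in> carrier A \<and> norm_converges A (cnorm A) (\<lambda>n. coord (X n) A) L"
    if A: "cstar_algebra A" for A :: "'a cstar"
  proof -
    have "\<exists>k. \<forall>m\<ge>k. \<forall>n\<ge>k. cnorm A (coord (X m) A \<ominus>\<^bsub>A\<^esub> coord (X n) A) < e" if "0 < e" for e
      using CauchyD[OF X that] cnorm_coord_le_norm[OF A] unfolding coord_diff[OF A, symmetric]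
      by (meson le_less_trans)
    then show ?thesis
      using cstar_algebra.complete[OF A] coord_carrier[OF A] unfolding norm_complete_def
      by (metis (no_types, lifting))
  qed
  then have "\<exists>L. \<forall>A::'a cstar. cstar_algebra A \<longrightarrow>
      L A \<in> carrier A \<and> norm_converges A (cnorm A) (\<lambda>n. coord (X n) A) (L A)"
    by (intro choice) blast
  then obtain L where L: "\<And>A::'a cstar. cstar_algebra A \<Longrightarrow> L A \<in> carrier A"
    "\<And>A. cstar_algebra A \<Longrightarrow> (\<lambda>n. cnorm A (coord (X n) A \<ominus>\<^bsub>A\<^esub> L A)) \<longlonglongrightarrow> 0"
    unfolding norm_converges_def by blast
  \<comment> \<open>The limits L are taken in each coordinate separately. This estimate is uniform
    in A, and so yields both the boundedness of the family L and convergence in the supremum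
    norm.\<close>
  have est: "cnorm A (coord (X n) A \<ominus>\<^bsub>A\<^esub> L A) \<le> e"
    if A: "cstar_algebra A" and N: "\<forall>m\<ge>N. \<forall>n\<ge>N. norm (X m - X n) < e" and n: "n \<ge> N" for A N n e
  proof (rule field_le_epsilon)
    interpret cstar_algebra A by (rule A)
    fix d :: real assume "0 < d"
    then have "\<forall>\<^sub>F m in sequentially. cnorm A (coord (X m) A \<ominus>\<^bsub>A\<^esub> L A) < d"
      using L(2)[OF A] by (rule order_tendstoD(2)[rotated])
    then obtain M where M: "\<And>m. m \<ge> M \<Longrightarrow> cnorm A (coord (X m) A \<ominus>\<^bsub>A\<^esub> L A) < d"
      unfolding eventually_sequentially by blast
    let ?m = "max M N"
    have "cnorm A (coord (X n) A \<ominus>\<^bsub>A\<^esub> L A)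
        \<le> cnorm A (coord (X n - X ?m) A) + cnorm A (coord (X ?m) A \<ominus>\<^bsub>A\<^esub> L A)"
      unfolding coord_diff[OF A] by (intro cnorm_diff_triangle coord_carrier[OF A] L A)
    also have "\<dots> \<le> e + d"
    proof (rule add_mono)
      have "norm (X n - X ?m) < e" using N n by simp
      then show "cnorm A (coord (X n - X ?m) A) \<le> e"
        using cnorm_coord_le_norm[OF A, of "X n - X ?m"] by linarith
      show "cnorm A (coord (X ?m) A \<ominus>\<^bsub>A\<^esub> L A) \<le> d" using M[of ?m] by simp
    qed
    finally show "cnorm A (coord (X n) A \<ominus>\<^bsub>A\<^esub> L A) \<le> e + d" .
  qed
  obtain N where N: "\<forall>m\<ge>N. \<forall>n\<ge>N. norm (X m - X n) < 1" using CauchyD[OF X, of 1] by auto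
  have Lc: "coord (family (on_cstar L)) A = L A" if "cstar_algebra A" for A
  proof (rule coord_family[OF L(1) _ that])
    fix A :: "'a cstar" assume A: "cstar_algebra A"
    then interpret cstar_algebra A .
    have "cnorm A (L A) = cnorm A (L A \<ominus>\<^bsub>A\<^esub> \<zero>\<^bsub>A\<^esub>)" using L(1)[OF A] by simp
    also have "\<dots> \<le> cnorm A (L A \<ominus>\<^bsub>A\<^esub> coord (X N) A) + cnorm A (coord (X N) A \<ominus>\<^bsub>A\<^esub> \<zero>\<^bsub>A\<^esub>)"
      by (intro cnorm_diff_triangle coord_carrier[OF A] L A) simp
    also have "cnorm A (L A \<ominus>\<^bsub>A\<^esub> coord (X N) A) = cnorm A (coord (X N) A \<ominus>\<^bsub>A\<^esub> L A)"
      by (intro cnorm_minus_commute coord_carrier[OF A] L A)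
    also have "coord (X N) A \<ominus>\<^bsub>A\<^esub> \<zero>\<^bsub>A\<^esub> = coord (X N) A" by (simp add: coord_carrier[OF A])
    finally show "cnorm A (L A) \<le> 1 + norm (X N)"
      using est[OF A N order_refl] cnorm_coord_le_norm[OF A, of "X N"] by linarith
  qed
  have "X \<longlonglongrightarrow> family (on_cstar L)"
  proof (rule LIMSEQ_I)
    fix r :: real assume "0 < r"
    then obtain N where N: "\<forall>m\<ge>N. \<forall>n\<ge>N. norm (X m - X n) < r / 2"
      using CauchyD[OF X, of "r / 2"] by auto
    have "norm (X n - family (on_cstar L)) \<le> r / 2" if "n \<ge> N" for n
      using \<open>0 < r\<close> est[OF _ N that]
      by (intro norm_cprod_le) (simp_all add: coord_diff Lc)
    then show "\<exists>no. \<forall>n\<ge>no. norm (X n - family (on_cstar L)) < r"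
      using \<open>0 < r\<close> by (intro exI[of _ N]) fastforce
  qed
  then show "convergent X" by (auto simp: convergent_def)
qed

instantiation cprod :: (type) hmod
begin

text \<open>Each C*-algebra is a Hilbert module over itself; this is its inner product in every
  coordinate.\<close>

definition ip_cprod :: "'a cprod \<Rightarrow> 'a cprod \<Rightarrow> 'a cprod" where
  "ip_cprod x y = family (on_cstar (\<lambda>A. star A (coord x A) \<otimes>\<^bsub>A\<^esub> coord y A))"
definition J_cprod :: "'a cprod \<Rightarrow> 'a cprod" where
  "J_cprod x = family (on_cstar (\<lambda>A. \<i> \<odot>\<^bsub>A\<^esub> coord x A))"

lemma coord_ip: "cstar_algebra A \<Longrightarrow> coord (ip x y) A = star A (coord x A) \<otimes>\<^bsub>A\<^esub> coord y A"
  unfolding ip_cprod_def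
proof (rule coord_family)
  fix A :: "'a cstar" assume A: "cstar_algebra A"
  then interpret cstar_algebra A .
  note c = coord_carrier[OF A]
  show "star A (coord x A) \<otimes>\<^bsub>A\<^esub> coord y A \<in> carrier A" by (intro mult_closed star_closed c)
  have "cnorm A (star A (coord x A) \<otimes>\<^bsub>A\<^esub> coord y A) \<le> cnorm A (coord x A) * cnorm A (coord y A)"
    using cnorm_mult[of "star A (coord x A)" "coord y A"] by (simp add: c star_closed)
  also have "\<dots> \<le> norm x * norm y"
    by (intro mult_mono cnorm_coord_le_norm A cnorm_nonneg c) simp
  finally show "cnorm A (star A (coord x A) \<otimes>\<^bsub>A\<^esub> coord y A) \<le> norm x * norm y" .
qed

lemma coord_J: "cstar_algebra A \<Longrightarrow> coord (J x) A = \<i> \<odot>\<^bsub>A\<^esub> coord x A"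
  unfolding J_cprod_def
proof (rule coord_family)
  fix A :: "'a cstar" assume A: "cstar_algebra A"
  then interpret cstar_algebra A .
  show "\<i> \<odot>\<^bsub>A\<^esub> coord x A \<in> carrier A" by (simp add: coord_carrier[OF A])
  show "cnorm A (\<i> \<odot>\<^bsub>A\<^esub> coord x A) \<le> norm x"
    using cnorm_coord_le_norm[OF A, of x] by (simp add: cnorm_smult coord_carrier[OF A])
qed

instance
proof
  fix x y z :: "'a cprod" and r :: real
  have m: "- x = (-1) *\<^sub>R x" for x :: "'a cprod" by simp
  have "ip (x + y) z = ip x z + ip y z \<and> ip z (x + y) = ip z x + ip z y \<and>
    ip (r *\<^sub>R x) y = r *\<^sub>R ip x y \<and> ip x (r *\<^sub>R y) = r *\<^sub>R ip x y \<and>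
    ip (J x) y = (-1) *\<^sub>R J (ip x y) \<and> ip x (J y) = J (ip x y) \<and>
    J (x + y) = J x + J y \<and> J (r *\<^sub>R x) = r *\<^sub>R J x \<and> J (J x) = (-1) *\<^sub>R x"
  proof (intro conjI; rule cprod_eqI)
    fix A :: "'a cstar" assume A: "cstar_algebra A"
    then interpret cstar_algebra A .
    note c = coord_carrier[OF A] coord_zero[OF A] coord_add[OF A] coord_scaleR[OF A]
      coord_ip[OF A] coord_J[OF A]
    note s = star_closed mult_closed star_add star_smult distrib_left distrib_right smult_mult_left
      smult_mult_right smult_smult smult_r_distr
    show "coord (ip (x + y) z) A = coord (ip x z + ip y z) A" by (simp add: c s)
    show "coord (ip z (x + y)) A = coord (ip z x + ip z y) A" by (simp add: c s)
    show "coord (ip (r *\<^sub>R x) y) A = coord (r *\<^sub>R ip x y) A" by (simp add: c s)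
    show "coord (ip x (r *\<^sub>R y)) A = coord (r *\<^sub>R ip x y) A" by (simp add: c s)
    show "coord (ip (J x) y) A = coord ((-1) *\<^sub>R J (ip x y)) A"
      unfolding c by (simp add: c s)
    show "coord (ip x (J y)) A = coord (J (ip x y)) A" by (simp add: c s)
    show "coord (J (x + y)) A = coord (J x + J y) A" by (simp add: c s)
    show "coord (J (r *\<^sub>R x)) A = coord (r *\<^sub>R J x) A" by (simp add: c s mult.commute)
    show "coord (J (J x)) A = coord ((-1) *\<^sub>R x) A" unfolding c by (simp add: c s)
  qed
  then show "ip (x + y) z = ip x z + ip y z" "ip z (x + y) = ip z x + ip z y"
    "ip (r *\<^sub>R x) y = r *\<^sub>R ip x y" "ip x (r *\<^sub>R y) = r *\<^sub>R ip x y"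
    "ip (J x) y = - J (ip x y)" "ip x (J y) = J (ip x y)"
    "J (x + y) = J x + J y" "J (r *\<^sub>R x) = r *\<^sub>R J x" "J (J x) = - x"
    unfolding m by blast+
  show le: "norm (ip x y) \<le> norm x * norm y"
  proof (rule norm_cprod_le)
    fix A :: "'a cstar" assume A: "cstar_algebra A"
    then interpret cstar_algebra A .
    note c = coord_carrier[OF A]
    have "cnorm A (star A (coord x A) \<otimes>\<^bsub>A\<^esub> coord y A) \<le> cnorm A (coord x A) * cnorm A (coord y A)"
      using cnorm_mult[of "star A (coord x A)" "coord y A"] by (simp add: c star_closed)
    also have "\<dots> \<le> norm x * norm y"
      by (intro mult_mono cnorm_coord_le_norm A cnorm_nonneg c) simp
    finally show "cnorm A (coord (ip x y) A) \<le> norm x * norm y" by (simp add: coord_ip[OF A])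
  qed simp
  have "norm x \<le> sqrt (norm (ip x x))"
  proof (rule norm_cprod_le)
    fix A :: "'a cstar" assume A: "cstar_algebra A"
    then interpret cstar_algebra A .
    note c = coord_carrier[OF A]
    have "(cnorm A (coord x A))\<^sup>2 = cnorm A (coord (ip x x) A)"
      using cstar_identity[OF c, of x] by (simp add: coord_ip[OF A])
    also have "\<dots> \<le> norm (ip x x)" by (rule cnorm_coord_le_norm[OF A])
    finally show "cnorm A (coord x A) \<le> sqrt (norm (ip x x))" by (rule real_le_rsqrt)
  qed simp
  then have "(norm x)\<^sup>2 \<le> norm (ip x x)" by (metis norm_ge_zero real_sqrt_le_mono real_sqrt_pow2 power_mono)
  moreover have "norm (ip x x) \<le> (norm x)\<^sup>2"
  proof (rule norm_cprod_le)
    fix A :: "'a cstar" assume A: "cstar_algebra A"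
    then interpret cstar_algebra A .
    note c = coord_carrier[OF A]
    have "cnorm A (coord (ip x x) A) = (cnorm A (coord x A))\<^sup>2"
      using cstar_identity[OF c, of x] by (simp add: coord_ip[OF A])
    also have "\<dots> \<le> (norm x)\<^sup>2" by (intro power_mono cnorm_coord_le_norm[OF A] cnorm_nonneg c)
    finally show "cnorm A (coord (ip x x) A) \<le> (norm x)\<^sup>2" .
  qed simp
  ultimately show "norm (ip x x) = (norm x)\<^sup>2" by (rule antisym[rotated])
qed

end

definition cprod_single :: "'a cstar \<Rightarrow> 'a \<Rightarrow> 'a cprod" where
  "cprod_single A a = family (on_cstar (\<lambda>B. if B = A then a else \<zero>\<^bsub>B\<^esub>))"

lemma coord_single:
  assumes "cstar_algebra A" "a \<in> carrier A" "cstar_algebra B"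
  shows "coord (cprod_single A a) B = (if B = A then a else \<zero>\<^bsub>B\<^esub>)"
  unfolding cprod_single_def
proof (rule coord_family[OF _ _ assms(3), where K = "cnorm A a"])
  fix B :: "'a cstar" assume B: "cstar_algebra B"
  then interpret cstar_algebra B .
  show "(if B = A then a else \<zero>\<^bsub>B\<^esub>) \<in> carrier B" using assms by simp
  show "cnorm B (if B = A then a else \<zero>\<^bsub>B\<^esub>) \<le> cnorm A a"
    using assms cstar_algebra.cnorm_nonneg[OF assms(1,2)] by simp
qed

lemma norm_single:
  assumes A: "cstar_algebra A" "a \<in> carrier A"
  shows "norm (cprod_single A a) = cnorm A a"
proof (rule antisym)
  show "cnorm A a \<le> norm (cprod_single A a)"
    using cnorm_coord_le_norm[OF A(1), of "cprod_single A a"] by (simp add: coord_single A)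
  show "norm (cprod_single A a) \<le> cnorm A a"
  proof (rule norm_cprod_le)
    show "0 \<le> cnorm A a" by (rule cstar_algebra.cnorm_nonneg[OF A])
    then show "cnorm B (coord (cprod_single A a) B) \<le> cnorm A a" if B: "cstar_algebra B" for B :: "'a cstar"
      using cstar_algebra.cnorm_zero[OF B] by (simp add: coord_single A B)
  qed
qed

section \<open>The left regular representation\<close>

definition left_mult :: "'a cstar \<Rightarrow> 'a \<Rightarrow> 'a cprod \<Rightarrow> 'a cprod" where
  "left_mult A a x = cprod_single A (a \<otimes>\<^bsub>A\<^esub> coord x A)"

text \<open>A acts on its own coordinate and annihilates all others. The identity operator provides
  a unit for A even if A has none.\<close>

definition cembed :: "'a cstar \<Rightarrow> 'a \<Rightarrow> 'a cprod adjop" where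
  "cembed A a = make_adjop (left_mult A a) (left_mult A (star A a))"

context cstar_algebra
begin

lemma cstar_A: "cstar_algebra A" ..

lemma coord_A: "coord x A \<in> carrier A"
  by (rule coord_carrier[OF cstar_A])

lemmas coord_rules = coord_A coord_single[OF cstar_A] coord_zero coord_add coord_scaleR coord_ip coord_J

lemma bounded_linear_left_mult:
  assumes a: "a \<in> carrier A"
  shows "bounded_linear (left_mult A a)"
proof (rule bounded_linear_intro[where K="cnorm A a"])
  show "left_mult A a (x + y) = left_mult A a x + left_mult A a y" for x y
  proof (rule cprod_eqI)
    fix B :: "'a cstar" assume B: "cstar_algebra B"
    then interpret B: cstar_algebra B .
    show "coord (left_mult A a (x + y)) B = coord (left_mult A a x + left_mult A a y) B"
      using a by (auto simp: left_mult_def coord_rules B cstar_A mult_closed distrib_left)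
  qed
  show "left_mult A a (r *\<^sub>R x) = r *\<^sub>R left_mult A a x" for r x
  proof (rule cprod_eqI)
    fix B :: "'a cstar" assume B: "cstar_algebra B"
    then interpret B: cstar_algebra B .
    show "coord (left_mult A a (r *\<^sub>R x)) B = coord (r *\<^sub>R left_mult A a x) B"
      using a by (auto simp: left_mult_def coord_rules B cstar_A mult_closed smult_mult_right)
  qed
  show "norm (left_mult A a x) \<le> norm x * cnorm A a" for x
  proof -
    have "norm (left_mult A a x) \<le> cnorm A a * cnorm A (coord x A)"
      using a by (simp add: left_mult_def norm_single cstar_A mult_closed coord_A cnorm_mult)
    also have "\<dots> \<le> cnorm A a * norm x"
      by (intro mult_left_mono cnorm_coord_le_norm cstar_A cnorm_nonneg a)
    finally show ?thesis by (simp add: mult.commute)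
  qed
qed

lemma ip_left_mult:
  assumes a: "a \<in> carrier A"
  shows "ip (left_mult A a x) y = ip x (left_mult A (star A a) y)"
proof (rule cprod_eqI)
  fix B :: "'a cstar" assume B: "cstar_algebra B"
  then interpret B: cstar_algebra B .
  show "coord (ip (left_mult A a x) y) B = coord (ip x (left_mult A (star A a) y)) B"
    using a by (auto simp: left_mult_def coord_rules B cstar_A mult_closed star_closed star_mult
        mult_assoc coord_carrier[OF B] B.star_closed)
qed

lemma cembed_apply: "a \<in> carrier A \<Longrightarrow> adjop_apply (cembed A a) x = left_mult A a x"
  unfolding cembed_def
  by (rule adjop_apply_make)
    (simp_all add: bounded_linear_left_mult star_closed ip_left_mult star_star)

lemma cembed_star: "a \<in> carrier A \<Longrightarrow> cembed A (star A a) = adj (cembed A a)"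
  unfolding cembed_def
  by (subst adj_make_adjop)
    (simp_all add: bounded_linear_left_mult star_closed ip_left_mult star_star)

lemma cembed_add:
  assumes ab: "a \<in> carrier A" "b \<in> carrier A"
  shows "cembed A (a \<oplus> b) = cembed A a + cembed A b"
proof (rule adjop_eqI, rule cprod_eqI)
  fix x and B :: "'a cstar" assume B: "cstar_algebra B"
  then interpret B: cstar_algebra B .
  show "coord (adjop_apply (cembed A (a \<oplus> b)) x) B = coord (adjop_apply (cembed A a + cembed A b) x) B"
    using ab by (auto simp: adjop_apply_simps cembed_apply left_mult_def coord_rules B cstar_A
        mult_closed distrib_right)
qed

lemma cembed_mult:
  assumes ab: "a \<in> carrier A" "b \<in> carrier A"
  shows "cembed A (a \<otimes> b) = cembed A a * cembed A b"
proof (rule adjop_eqI)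
  fix x
  show "adjop_apply (cembed A (a \<otimes> b)) x = adjop_apply (cembed A a * cembed A b) x"
    using ab by (simp add: adjop_apply_simps cembed_apply left_mult_def coord_rules cstar_A
        mult_closed mult_assoc)
qed

lemma cembed_smult:
  assumes a: "a \<in> carrier A"
  shows "cembed A (c \<odot> a) = scaleC c (cembed A a)"
proof (rule adjop_eqI, rule cprod_eqI)
  fix x and B :: "'a cstar" assume B: "cstar_algebra B"
  then interpret B: cstar_algebra B .
  define z where "z = a \<otimes> coord x A"
  have z: "z \<in> carrier A" using a by (simp add: z_def mult_closed coord_A)
  have "c = complex_of_real (Re c) + complex_of_real (Im c) * \<i>" by (simp add: complex_eq_iff)
  then have "c \<odot> z = (complex_of_real (Re c) + complex_of_real (Im c) * \<i>) \<odot> z" by metis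
  also have "\<dots> = complex_of_real (Re c) \<odot> z \<oplus> complex_of_real (Im c) \<odot> (\<i> \<odot> z)"
    by (simp only: smult_add_left[OF z] smult_smult[OF z])
  finally show "coord (adjop_apply (cembed A (c \<odot> a)) x) B = coord (adjop_apply (scaleC c (cembed A a)) x) B"
    using a unfolding z_def
    by (auto simp: scaleC_def adjop_apply_simps cembed_apply left_mult_def coord_rules B cstar_A
        mult_closed smult_mult_left)
qed

lemma norm_cembed:
  assumes a: "a \<in> carrier A"
  shows "norm (cembed A a) = cnorm A a"
proof (rule antisym)
  show "norm (cembed A a) \<le> cnorm A a"
  proof (rule norm_adjop_le)
    fix u
    have "norm (left_mult A a u) \<le> cnorm A a * cnorm A (coord u A)"
      using a by (simp add: left_mult_def norm_single cstar_A mult_closed coord_A cnorm_mult)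
    also have "\<dots> \<le> cnorm A a * norm u"
      by (intro mult_left_mono cnorm_coord_le_norm cstar_A cnorm_nonneg a)
    finally show "norm (adjop_apply (cembed A a) u) \<le> cnorm A a * norm u"
      using a by (simp add: cembed_apply)
  qed (rule cnorm_nonneg[OF a])
  \<comment> \<open>The vector \<open>star A a\<close> attains the norm, by the C*-identity for
    \<open>a \<otimes> star A a\<close>.\<close>
  let ?u = "cprod_single A (star A a)"
  have "(cnorm A a)\<^sup>2 = cnorm A (a \<otimes> star A a)"
    using cstar_identity[OF star_closed[OF a]] a by (simp add: star_star)
  also have "\<dots> = norm (adjop_apply (cembed A a) ?u)"
    using a by (simp add: cembed_apply left_mult_def coord_rules cstar_A star_closed norm_single mult_closed)
  also have "\<dots> \<le> norm (cembed A a) * cnorm A a"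
    using norm_adjop_apply[of "cembed A a" ?u] a by (simp add: norm_single cstar_A star_closed)
  finally have "cnorm A a * cnorm A a \<le> norm (cembed A a) * cnorm A a" by (simp add: power2_eq_square)
  then show "cnorm A a \<le> norm (cembed A a)"
    using cnorm_nonneg[OF a] by (cases "cnorm A a = 0") auto
qed

end

section \<open>Two by two matrices\<close>

text \<open>A fresh type rather than pairs, since pairs carry the Euclidean combination of the two
  norms, whereas a Hilbert module needs the norm of the sum of \<open>adj a * a\<close> over the
  entries a, under a square root.\<close>

datatype 'm hvec = HVec (vfst: 'm) (vsnd: 'm)

definition hinner :: "'m::cstar_unital hvec \<Rightarrow> 'm hvec \<Rightarrow> 'm" where
  "hinner x y = adj (vfst x) * vfst y + adj (vsnd x) * vsnd y"

instantiation hvec :: (cstar_unital) real_vector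
begin

definition zero_hvec :: "'a hvec" where "zero_hvec = HVec 0 0"
definition plus_hvec :: "'a hvec \<Rightarrow> 'a hvec \<Rightarrow> 'a hvec" where
  "plus_hvec x y = HVec (vfst x + vfst y) (vsnd x + vsnd y)"
definition minus_hvec :: "'a hvec \<Rightarrow> 'a hvec \<Rightarrow> 'a hvec" where
  "minus_hvec x y = HVec (vfst x - vfst y) (vsnd x - vsnd y)"
definition uminus_hvec :: "'a hvec \<Rightarrow> 'a hvec" where
  "uminus_hvec x = HVec (- vfst x) (- vsnd x)"
definition scaleR_hvec :: "real \<Rightarrow> 'a hvec \<Rightarrow> 'a hvec" where
  "scaleR_hvec r x = HVec (r *\<^sub>R vfst x) (r *\<^sub>R vsnd x)"

lemmas hvec_defs = zero_hvec_def plus_hvec_def minus_hvec_def uminus_hvec_def scaleR_hvec_def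

instance
  by standard (simp_all add: hvec_defs scaleR_add_right scaleR_add_left)

end

lemma hvec_eqI: "vfst x = vfst y \<Longrightarrow> vsnd x = vsnd y \<Longrightarrow> x = y"
  by (cases x; cases y) simp

lemma hvec_sel:
  "vfst (x + y) = vfst x + vfst y" "vsnd (x + y) = vsnd x + vsnd y"
  "vfst (x - y) = vfst x - vfst y" "vsnd (x - y) = vsnd x - vsnd y"
  "vfst (r *\<^sub>R x) = r *\<^sub>R vfst x" "vsnd (r *\<^sub>R x) = r *\<^sub>R vsnd x"
  "vfst (- x) = - vfst x" "vsnd (- x) = - vsnd x"
  "vfst 0 = (0::'m)" "vsnd 0 = (0::'m)"
  for x y :: "'m::cstar_unital hvec"
  by (simp_all add: hvec_defs)

lemma pos_hinner: "pos (hinner x x)"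
  unfolding hinner_def by (intro pos_add pos_adj_mult_self)

text \<open>A summand of a sum of positive elements has no larger norm. Here positivity of
  \<open>adj x * x\<close> enters; definiteness of the norm and completeness of the columns depend
  on it.\<close>

lemma norm_vfst_le: "(norm (vfst x))\<^sup>2 \<le> norm (hinner x x)"
  unfolding norm_adj_mult_self[symmetric]
  by (rule pos_norm_mono) (simp_all add: hinner_def pos_adj_mult_self)

lemma norm_vsnd_le: "(norm (vsnd x))\<^sup>2 \<le> norm (hinner x x)"
  unfolding norm_adj_mult_self[symmetric]
  by (rule pos_norm_mono) (simp_all add: hinner_def pos_adj_mult_self)

lemma hinner_add_left: "hinner (x + y) z = hinner x z + hinner y z"
  by (simp add: hinner_def hvec_sel adj_add distrib_right add_ac)

lemma hinner_add_right: "hinner z (x + y) = hinner z x + hinner z y"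
  by (simp add: hinner_def hvec_sel distrib_left add_ac)

lemma hinner_scaleR_left: "hinner (r *\<^sub>R x) y = r *\<^sub>R hinner x y"
  by (simp add: hinner_def hvec_sel adj_scaleR scaleR_add_right)

lemma hinner_scaleR_right: "hinner x (r *\<^sub>R y) = r *\<^sub>R hinner x y"
  by (simp add: hinner_def hvec_sel scaleR_add_right)

lemma hinner_adj: "adj (hinner x y) = hinner y x"
  by (simp add: hinner_def adj_add adj_mult)

definition hvec_norm :: "'m::cstar_unital hvec \<Rightarrow> real" where
  "hvec_norm x = sqrt (norm (hinner x x))"

lemma hvec_norm_square: "(hvec_norm x)\<^sup>2 = norm (hinner x x)"
  by (simp add: hvec_norm_def)

lemma hvec_norm_nonneg: "0 \<le> hvec_norm x"
  by (simp add: hvec_norm_def)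

text \<open>Noncommutative form of minimizing a square: with b = \<open>hinner x y\<close>, s the
  squared norm of x and z = x b - s y, the element \<open>hinner z z\<close> is positive, and so is
  \<open>adj b * (s *\<^sub>R 1 - hinner x x) * b\<close>. In their sum the terms with
  \<open>hinner x x\<close> cancel, and s times \<open>adj b * b\<close> turns out to be dominated
  by s^2 times \<open>hinner y y\<close>.\<close>

lemma hinner_cauchy_schwarz: "norm (hinner x y) \<le> hvec_norm x * hvec_norm y"
proof (cases "hvec_norm x = 0")
  case True
  then have "norm (hinner x x) = 0" by (simp add: hvec_norm_def)
  then have "vfst x = 0" "vsnd x = 0" using norm_vfst_le[of x] norm_vsnd_le[of x] by simp_all
  then show ?thesis by (simp add: hinner_def hvec_norm_nonneg)
next
  case False
  define s where "s = (hvec_norm x)\<^sup>2"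
  have s: "0 < s" using False hvec_norm_nonneg[of x] by (simp add: s_def)
  define b g h where "b = hinner x y" and "g = hinner x x" and "h = hinner y y"
  define z where "z = HVec (vfst x * b - s *\<^sub>R vfst y) (vsnd x * b - s *\<^sub>R vsnd y)"
  have 1: "hinner z z = adj b * g * b - s *\<^sub>R (adj b * b) - s *\<^sub>R (adj b * b) + (s * s) *\<^sub>R h"
  proof -
    have e1: "adj b * g * b = adj b * (adj (vfst x) * (vfst x * b)) + adj b * (adj (vsnd x) * (vsnd x * b))"
      by (simp add: g_def hinner_def distrib_left distrib_right mult.assoc)
    have e2: "adj b * b = adj b * (adj (vfst x) * vfst y) + adj b * (adj (vsnd x) * vsnd y)"
      by (subst (2) b_def) (simp add: hinner_def distrib_left)
    have e3: "adj b * b = adj (vfst y) * (vfst x * b) + adj (vsnd y) * (vsnd x * b)"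
    proof -
      have "adj b = adj (vfst y) * vfst x + adj (vsnd y) * vsnd x"
        by (simp add: b_def hinner_adj) (simp add: hinner_def)
      then show ?thesis by (simp add: distrib_right mult.assoc)
    qed
    have "hinner z z = adj b * (adj (vfst x) * (vfst x * b)) + adj b * (adj (vsnd x) * (vsnd x * b))
      - s *\<^sub>R (adj b * (adj (vfst x) * vfst y) + adj b * (adj (vsnd x) * vsnd y))
      - s *\<^sub>R (adj (vfst y) * (vfst x * b) + adj (vsnd y) * (vsnd x * b))
      + (s * s) *\<^sub>R (adj (vfst y) * vfst y + adj (vsnd y) * vsnd y)"
      by (simp add: hinner_def z_def adj_diff adj_mult adj_scaleR left_diff_distrib right_diff_distrib
          mult.assoc scaleR_add_right scaleR_diff_right)
    then show ?thesis unfolding e1[symmetric] e2[symmetric] e3[symmetric] by (simp add: h_def hinner_def)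
  qed
  have 2: "pos (adj b * (s *\<^sub>R 1 - g) * b)"
    by (rule pos_conj, rule pos_norm_minus)
      (use pos_selfadj[OF pos_hinner[of x]] in \<open>simp_all add: g_def s_def hvec_norm_square\<close>)
  have eq: "hinner z z + adj b * (s *\<^sub>R 1 - g) * b = (s * s) *\<^sub>R h - s *\<^sub>R (adj b * b)"
    unfolding 1 right_diff_distrib left_diff_distrib by simp
  have "norm (s *\<^sub>R (adj b * b)) \<le> norm ((s * s) *\<^sub>R h)"
  proof (rule pos_norm_mono)
    show "pos (s *\<^sub>R (adj b * b))" using s by (intro pos_scaleR pos_adj_mult_self) simp
    show "pos ((s * s) *\<^sub>R h - s *\<^sub>R (adj b * b))"
      using pos_add[OF pos_hinner[of z] 2] unfolding eq .
  qed
  then have "s * (norm b)\<^sup>2 \<le> s * (s * norm h)" using s by (simp add: norm_adj_mult_self mult.assoc)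
  then have "(norm b)\<^sup>2 \<le> s * norm h" using s by simp
  also have "\<dots> = (hvec_norm x * hvec_norm y)\<^sup>2"
    by (simp add: s_def h_def power_mult_distrib hvec_norm_square)
  finally show ?thesis
    unfolding b_def by (rule power2_le_imp_le) (simp add: hvec_norm_nonneg)
qed

instantiation hvec :: (cstar_unital) real_normed_vector
begin

definition norm_hvec :: "'a hvec \<Rightarrow> real" where "norm_hvec = hvec_norm"
definition dist_hvec :: "'a hvec \<Rightarrow> 'a hvec \<Rightarrow> real" where "dist_hvec x y = norm (x - y)"
definition sgn_hvec :: "'a hvec \<Rightarrow> 'a hvec" where "sgn_hvec x = inverse (norm x) *\<^sub>R x"
definition uniformity_hvec :: "('a hvec \<times> 'a hvec) filter" where
  "uniformity_hvec = (INF e\<in>{0 <..}. principal {(x, y). dist x y < e})"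
definition open_hvec :: "'a hvec set \<Rightarrow> bool" where
  "open_hvec U = (\<forall>x\<in>U. \<forall>\<^sub>F (x', y) in uniformity. x' = x \<longrightarrow> y \<in> U)"

instance
proof
  fix x y :: "'a hvec" and a :: real
  show "dist x y = norm (x - y)" by (rule dist_hvec_def)
  show "sgn x = inverse (norm x) *\<^sub>R x" by (rule sgn_hvec_def)
  show "uniformity = (INF e\<in>{0 <..}. principal {(x, y). dist (x::'a hvec) y < e})"
    by (rule uniformity_hvec_def)
  show "open U = (\<forall>x\<in>U. \<forall>\<^sub>F (x', y) in uniformity. x' = x \<longrightarrow> y \<in> U)" for U :: "'a hvec set"
    by (rule open_hvec_def)
  show "norm x = 0 \<longleftrightarrow> x = 0"
  proof
    assume "norm x = 0"
    then have "norm (hinner x x) = 0" by (simp add: norm_hvec_def hvec_norm_def)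
    then have "vfst x = 0" "vsnd x = 0" using norm_vfst_le[of x] norm_vsnd_le[of x] by simp_all
    then show "x = 0" by (intro hvec_eqI) (simp_all add: hvec_sel)
  qed (simp add: norm_hvec_def hvec_norm_def hinner_def hvec_sel)
  have "(norm (x + y))\<^sup>2 = norm (hinner x x + hinner x y + hinner y x + hinner y y)"
    by (simp add: norm_hvec_def hvec_norm_square hinner_add_left hinner_add_right add_ac)
  also have "\<dots> \<le> norm (hinner x x) + norm (hinner x y) + norm (hinner y x) + norm (hinner y y)"
    by (intro order_trans[OF norm_triangle_ineq] add_mono order_refl)
  also have "\<dots> \<le> (norm x)\<^sup>2 + norm x * norm y + norm y * norm x + (norm y)\<^sup>2"
    unfolding norm_hvec_def hvec_norm_square by (intro add_mono order_refl hinner_cauchy_schwarz)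
  also have "\<dots> = (norm x + norm y)\<^sup>2" by (simp add: power2_sum)
  finally show "norm (x + y) \<le> norm x + norm y"
    by (rule power2_le_imp_le) (simp add: norm_hvec_def hvec_norm_nonneg)
  have "hvec_norm (a *\<^sub>R x) = sqrt (a * a) * hvec_norm x"
    by (simp add: hvec_norm_def hinner_scaleR_left hinner_scaleR_right real_sqrt_mult mult.assoc)
  then show "norm (a *\<^sub>R x) = \<bar>a\<bar> * norm x" by (simp add: norm_hvec_def)
qed

end

lemma norm_hvec_square: "(norm x)\<^sup>2 = norm (hinner x x)"
  by (simp add: norm_hvec_def hvec_norm_square)

lemma norm_vfst: "norm (vfst x) \<le> norm x" and norm_vsnd: "norm (vsnd x) \<le> norm x"
  using norm_vfst_le[of x] norm_vsnd_le[of x] unfolding norm_hvec_square[symmetric]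
  by (simp_all only: power2_le_iff_abs_le norm_ge_zero abs_norm_cancel)

lemma norm_HVec_zero [simp]: "norm (HVec a 0) = norm a" "norm (HVec 0 a) = norm a"
  by (simp_all add: norm_hvec_def hvec_norm_def hinner_def norm_adj_mult_self)

lemma norm_HVec_le: "norm (HVec a b) \<le> norm a + norm b"
  using norm_triangle_ineq[of "HVec a 0" "HVec 0 b"] by (simp add: hvec_defs)

instance hvec :: (cstar_unital) banach
proof
  fix X :: "nat \<Rightarrow> 'a hvec" assume X: "Cauchy X"
  have 1: "norm (vfst (X m) - vfst (X n)) \<le> norm (X m - X n)" for m n
    using norm_vfst[of "X m - X n"] by (simp add: hvec_sel)
  have 2: "norm (vsnd (X m) - vsnd (X n)) \<le> norm (X m - X n)" for m n
    using norm_vsnd[of "X m - X n"] by (simp add: hvec_sel)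
  have "Cauchy (\<lambda>n. vfst (X n))" "Cauchy (\<lambda>n. vsnd (X n))"
    unfolding Cauchy_iff using CauchyD[OF X] 1 2 by (meson le_less_trans)+
  then obtain a b where ab: "(\<lambda>n. vfst (X n)) \<longlonglongrightarrow> a" "(\<lambda>n. vsnd (X n)) \<longlonglongrightarrow> b"
    by (auto simp: Cauchy_convergent_iff convergent_def)
  have "(\<lambda>n. norm (vfst (X n) - a) + norm (vsnd (X n) - b)) \<longlonglongrightarrow> 0 + 0"
    using ab by (intro tendsto_add) (simp_all add: LIM_zero tendsto_norm_zero)
  then have "(\<lambda>n. norm (vfst (X n) - a) + norm (vsnd (X n) - b)) \<longlonglongrightarrow> 0" by simp
  moreover have "norm (X n - HVec a b) \<le> norm (vfst (X n) - a) + norm (vsnd (X n) - b)" for n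
    using norm_HVec_le[of "vfst (X n) - a" "vsnd (X n) - b"] by (simp add: minus_hvec_def)
  ultimately have "(\<lambda>n. X n - HVec a b) \<longlonglongrightarrow> 0"
    by (intro Lim_null_comparison[of "\<lambda>n. X n - HVec a b"]) simp_all
  then have "X \<longlonglongrightarrow> HVec a b" by (rule LIM_zero_cancel)
  then show "convergent X" by (auto simp: convergent_def)
qed

instantiation hvec :: (cstar_unital) hmod
begin

definition ip_hvec :: "'a hvec \<Rightarrow> 'a hvec \<Rightarrow> 'a hvec" where "ip_hvec x y = HVec (hinner x y) 0"
definition J_hvec :: "'a hvec \<Rightarrow> 'a hvec" where "J_hvec x = HVec (iu * vfst x) (iu * vsnd x)"

instance
proof
  fix x y z :: "'a hvec" and r :: real
  have i1: "a * (iu * b) = iu * (a * b)" for a b :: 'a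
  proof -
    have "a * iu = iu * a" by (rule iu_commute[symmetric])
    then show ?thesis by (simp flip: mult.assoc)
  qed
  have i2: "iu * (iu * a) = - a" for a :: 'a by (simp add: iu_mult_iu flip: mult.assoc)
  have i3: "adj (iu * a) = - (iu * adj a)" for a :: 'a
    by (simp add: adj_mult adj_iu iu_commute)
  show "ip (x + y) z = ip x z + ip y z"
    by (rule hvec_eqI) (simp_all add: ip_hvec_def hvec_sel hinner_add_left)
  show "ip z (x + y) = ip z x + ip z y"
    by (rule hvec_eqI) (simp_all add: ip_hvec_def hvec_sel hinner_add_right)
  show "ip (r *\<^sub>R x) y = r *\<^sub>R ip x y"
    by (rule hvec_eqI) (simp_all add: ip_hvec_def hvec_sel hinner_scaleR_left)
  show "ip x (r *\<^sub>R y) = r *\<^sub>R ip x y"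
    by (rule hvec_eqI) (simp_all add: ip_hvec_def hvec_sel hinner_scaleR_right)
  show "ip (J x) y = - J (ip x y)"
    by (simp add: ip_hvec_def J_hvec_def hinner_def uminus_hvec_def i3 distrib_left mult.assoc)
  show "ip x (J y) = J (ip x y)"
    by (simp add: ip_hvec_def J_hvec_def hinner_def i1 distrib_left)
  show "J (x + y) = J x + J y" by (simp add: J_hvec_def plus_hvec_def distrib_left)
  show "J (r *\<^sub>R x) = r *\<^sub>R J x" by (simp add: J_hvec_def scaleR_hvec_def)
  show "J (J x) = - x" by (simp add: J_hvec_def uminus_hvec_def i2)
  show "norm (ip x x) = (norm x)\<^sup>2" by (simp add: ip_hvec_def norm_hvec_square)
  show "norm (ip x y) \<le> norm x * norm y"
    using hinner_cauchy_schwarz[of x y] by (simp add: ip_hvec_def flip: norm_hvec_def)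
qed

end

text \<open>\<open>mat_unit i j m\<close> is the matrix with the single entry \<open>m\<close> in row \<open>i\<close> and column \<open>j\<close>; the
  second row and column are indexed by \<^term>\<open>True\<close>.\<close>

definition place :: "bool \<Rightarrow> 'm::cstar_unital \<Rightarrow> 'm hvec" where
  "place i m = (if i then HVec 0 m else HVec m 0)"

definition component :: "bool \<Rightarrow> 'm hvec \<Rightarrow> 'm" where
  "component i x = (if i then vsnd x else vfst x)"

definition mat_unit :: "bool \<Rightarrow> bool \<Rightarrow> 'm::cstar_unital \<Rightarrow> 'm hvec adjop" where
  "mat_unit i j m = make_adjop (\<lambda>x. place i (m * component j x)) (\<lambda>x. place j (adj m * component i x))"

lemma component_place: "component i (place j m) = (if i = j then m else 0)"
  by (simp add: component_def place_def)

lemma bounded_linear_place_component: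
  "bounded_linear (\<lambda>x. place i (m * component j x))"
proof (rule bounded_linear_intro[where K = "norm m"])
  show "place i (m * component j (x + y)) = place i (m * component j x) + place i (m * component j y)" for x y
    by (simp add: place_def component_def hvec_defs distrib_left)
  show "place i (m * component j (r *\<^sub>R x)) = r *\<^sub>R place i (m * component j x)" for r x
    by (simp add: place_def component_def hvec_defs)
  show "norm (place i (m * component j x)) \<le> norm x * norm m" for x
  proof -
    have "norm (place i (m * component j x)) \<le> norm m * norm (component j x)"
      by (simp add: place_def norm_mult_ineq)
    also have "\<dots> \<le> norm m * norm x"
      by (intro mult_left_mono) (simp_all add: component_def norm_vfst norm_vsnd)
    finally show ?thesis by (simp add: mult.commute)
  qed
qed

lemma ip_place_component:
  "ip (place i (m * component j x)) y = ip x (place j (adj m * component i y))"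
  by (simp add: ip_hvec_def hinner_def place_def component_def adj_mult mult.assoc)

lemma mat_unit_apply: "adjop_apply (mat_unit i j m) x = place i (m * component j x)"
  unfolding mat_unit_def
  by (rule adjop_apply_make)
    (use bounded_linear_place_component ip_place_component[of j "adj m" i] in \<open>simp_all add: ip_place_component\<close>)

lemma adj_mat_unit: "adj (mat_unit i j m) = mat_unit j i (adj m)"
  unfolding mat_unit_def
  by (subst adj_make_adjop)
    (use bounded_linear_place_component ip_place_component[of j "adj m" i] in \<open>simp_all add: ip_place_component\<close>)

lemma mat_unit_mult: "mat_unit i j m * mat_unit k l n = (if j = k then mat_unit i l (m * n) else 0)"
proof (rule adjop_eqI)
  fix x
  have "place i (0::'a) = 0" for i by (simp add: place_def zero_hvec_def)
  then show "adjop_apply (mat_unit i j m * mat_unit k l n) x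
      = adjop_apply (if j = k then mat_unit i l (m * n) else 0) x"
    by (simp add: adjop_apply_simps mat_unit_apply component_place mult.assoc)
qed

lemma mat_unit_add: "mat_unit i j (m + n) = mat_unit i j m + mat_unit i j n"
  by (rule adjop_eqI)
    (simp add: adjop_apply_simps mat_unit_apply place_def plus_hvec_def distrib_right)

lemma mat_unit_zero: "mat_unit i j 0 = 0"
  using mat_unit_add[of i j 0 0] by simp

lemma mat_unit_sum: "mat_unit i j (\<Sum>k\<in>K. f k) = (\<Sum>k\<in>K. mat_unit i j (f k))"
  by (induction K rule: infinite_finite_induct) (simp_all add: mat_unit_zero mat_unit_add)

lemma mat_unit_scaleC: "mat_unit i j (scaleC c m) = scaleC c (mat_unit i j m)"
  by (rule adjop_eqI)
    (simp add: scaleC_def adjop_apply_simps mat_unit_apply place_def hvec_defs J_hvec_def distrib_right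
      mult.assoc)

lemma norm_place: "norm (place i m) = norm m"
  by (simp add: place_def)

text \<open>The column with the single entry \<open>adj m\<close> witnesses the bound, by the
  C*-identity. This lower bound is what makes the homomorphism out of C*(E) isometric.\<close>

lemma norm_mat_unit_ge: "norm m \<le> norm (mat_unit i j m)"
proof -
  have "norm m * norm m = norm (adjop_apply (mat_unit i j m) (place j (adj m)))"
    by (simp add: mat_unit_apply component_place norm_place norm_mult_adj_self power2_eq_square)
  also have "\<dots> \<le> norm (mat_unit i j m) * norm m"
    using norm_adjop_apply[of "mat_unit i j m" "place j (adj m)"] by (simp add: norm_place)
  finally show ?thesis by (cases "norm m = 0") auto
qed

section \<open>The universal property of graph algebras\<close>

lemma scaleC_add_left: "scaleC (c + d) x = scaleC c x + scaleC d (x::'a::cstar_unital)"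
  by (simp add: scaleC_def scaleR_add_left)

lemma scaleC_add_right: "scaleC c (x + y) = scaleC c x + scaleC c (y::'a::cstar_unital)"
  by (simp add: scaleC_def scaleR_add_right distrib_left)

lemma scaleC_scaleC: "scaleC c (scaleC d x) = scaleC (c * d) (x::'a::cstar_unital)"
proof -
  have "iu * (iu * x) = - x" by (simp add: iu_mult_iu flip: mult.assoc)
  then show ?thesis
    by (simp add: scaleC_def scaleR_add_right scaleR_add_left scaleR_diff_left scaleR_diff_right distrib_left)
qed

lemma scaleC_one: "scaleC 1 x = (x::'a::cstar_unital)"
  by (simp add: scaleC_def)

lemma scaleC_mult_left: "scaleC c x * y = scaleC c (x * (y::'a::cstar_unital))"
  by (simp add: scaleC_def distrib_right mult.assoc)

lemma scaleC_mult_right: "x * scaleC c y = scaleC c (x * (y::'a::cstar_unital))"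
proof -
  have "x * iu = iu * x" by (rule iu_commute[symmetric])
  then have "x * (iu * y) = iu * (x * y)" by (simp flip: mult.assoc)
  then show ?thesis by (simp add: scaleC_def distrib_left)
qed

lemma adj_scaleC: "adj (scaleC c x) = scaleC (cnj c) (adj (x::'a::cstar_unital))"
  by (simp add: scaleC_def adj_add adj_scaleR adj_mult adj_iu iu_commute)

definition ck_relations :: "('v, 'e) pre_digraph \<Rightarrow> ('v \<Rightarrow> 'm::cstar_unital) \<Rightarrow> ('e \<Rightarrow> 'm) \<Rightarrow> bool" where
  "ck_relations G p s \<longleftrightarrow> (\<forall>v\<in>verts G. adj (p v) = p v \<and> p v * p v = p v) \<and>
     (\<forall>v\<in>verts G. \<forall>w\<in>verts G. v \<noteq> w \<longrightarrow> p v * p w = 0) \<and>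
     (\<forall>e\<in>arcs G. s e * adj (s e) * s e = s e) \<and> (\<forall>e\<in>arcs G. adj (s e) * s e = p (head G e)) \<and>
     (\<forall>v\<in>tail G ` arcs G. p v = (\<Sum>e\<in>out_arcs G v. s e * adj (s e)))"

text \<open>The target is left open because A is embedded twice: by \<open>cembed A\<close>, and
  later as a corner next to B, inside the operators that contain B.\<close>

locale isometric_embedding = cstar_algebra A for A :: "'a cstar" (structure) +
  fixes emb :: "'a \<Rightarrow> 'm::cstar_unital"
  assumes emb_add: "x \<in> carrier A \<Longrightarrow> y \<in> carrier A \<Longrightarrow> emb (x \<oplus> y) = emb x + emb y"
    and emb_smult: "x \<in> carrier A \<Longrightarrow> emb (c \<odot> x) = scaleC c (emb x)"
    and emb_mult: "x \<in> carrier A \<Longrightarrow> y \<in> carrier A \<Longrightarrow> emb (x \<otimes> y) = emb x * emb y"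
    and emb_star: "x \<in> carrier A \<Longrightarrow> emb (star A x) = adj (emb x)"
    and norm_emb: "x \<in> carrier A \<Longrightarrow> norm (emb x) = cnorm A x"
begin

lemma emb_zero: "emb \<zero> = 0"
  using emb_add[of \<zero> \<zero>] by simp

lemma emb_minus: "x \<in> carrier A \<Longrightarrow> y \<in> carrier A \<Longrightarrow> emb (x \<ominus> y) = emb x - emb y"
  by (simp add: minus_eq_smult emb_add emb_smult) (simp add: scaleC_def)

lemma emb_inj: "inj_on emb (carrier A)"
proof (rule inj_onI)
  fix x y assume xy: "x \<in> carrier A" "y \<in> carrier A" "emb x = emb y"
  then have "cnorm A (x \<ominus> y) = 0" by (simp add: emb_minus flip: norm_emb)
  then have "x \<ominus> y = \<zero>" using xy by (simp add: cnorm_eq_zero)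
  then have "\<zero> \<oplus> y = (x \<ominus> y) \<oplus> y" by simp
  also have "\<dots> = x" using xy by (simp add: a_minus_def a_assoc l_neg)
  finally show "x = y" using xy by simp
qed

lemma emb_finsum:
  "(\<And>i. i \<in> I \<Longrightarrow> f i \<in> carrier A) \<Longrightarrow> emb (finsum A f I) = (\<Sum>i\<in>I. emb (f i))"
proof (induction I rule: infinite_finite_induct)
  case (insert i I)
  then show ?case by (simp add: finsum_insert Pi_def emb_add)
qed (simp_all add: emb_zero)

lemma norm_converges_iff:
  assumes "\<And>n. X n \<in> carrier A" "L \<in> carrier A"
  shows "norm_converges A (cnorm A) X L \<longleftrightarrow> (\<lambda>n. emb (X n)) \<longlonglongrightarrow> emb L"
  unfolding norm_converges_def LIM_zero_iff[symmetric, of "\<lambda>n. emb (X n)"]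
  unfolding tendsto_norm_zero_iff[symmetric, of "\<lambda>n. emb (X n) - emb L"]
  using assms by (simp add: norm_emb flip: emb_minus)

text \<open>A convergent sequence of embedded elements comes from a Cauchy sequence of A, since the
  embedding is isometric, and A is complete.\<close>

lemma closed_subalgebra_emb: "closed_subalgebra (emb ` carrier A)"
proof -
  have "closed (emb ` carrier A)"
    unfolding closed_sequential_limits
  proof (intro allI impI, elim conjE)
    fix X l assume X: "\<forall>n. X n \<in> emb ` carrier A" and l: "X \<longlonglongrightarrow> l"
    then have "\<forall>n. \<exists>y. y \<in> carrier A \<and> X n = emb y" by blast
    then have "\<exists>Y. \<forall>n. Y n \<in> carrier A \<and> X n = emb (Y n)" by (rule choice)
    then obtain Y where "\<forall>n. Y n \<in> carrier A \<and> X n = emb (Y n)" ..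
    then have Y: "Y n \<in> carrier A" "X n = emb (Y n)" for n by auto
    have "cnorm A (Y m \<ominus> Y n) = norm (X m - X n)" for m n
      using Y by (simp add: emb_minus flip: norm_emb)
    then have "\<forall>e>0. \<exists>k. \<forall>m\<ge>k. \<forall>n\<ge>k. cnorm A (Y m \<ominus> Y n) < e"
      using LIMSEQ_imp_Cauchy[OF l] by (simp add: Cauchy_iff)
    then obtain z where z: "z \<in> carrier A" "norm_converges A (cnorm A) Y z"
      using complete Y(1) unfolding norm_complete_def by blast
    then have "(\<lambda>n. emb (Y n)) \<longlonglongrightarrow> emb z" using norm_converges_iff[of Y z] Y(1) z by simp
    then have "X \<longlonglongrightarrow> emb z" by (simp flip: Y(2))
    then have "l = emb z" using LIMSEQ_unique[OF l] by blast
    then show "l \<in> emb ` carrier A" using z by blast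
  qed
  moreover have "0 \<in> emb ` carrier A" using imageI[OF zero_closed] emb_zero by metis
  moreover have "\<forall>x\<in>carrier A. \<forall>y\<in>carrier A. emb x + emb y \<in> emb ` carrier A"
    by (simp flip: emb_add)
  moreover have "\<forall>c. \<forall>x\<in>carrier A. scaleC c (emb x) \<in> emb ` carrier A"
    by (simp flip: emb_smult)
  moreover have "\<forall>x\<in>carrier A. \<forall>y\<in>carrier A. emb x * emb y \<in> emb ` carrier A"
    by (simp add: mult_closed flip: emb_mult)
  moreover have "\<forall>x\<in>carrier A. adj (emb x) \<in> emb ` carrier A"
    by (simp add: star_closed flip: emb_star)
  ultimately show ?thesis
    unfolding closed_subalgebra_def by blast
qed

lemma emb_ck_family:
  assumes "ck_family G A P S"
  shows "ck_relations G (\<lambda>v. emb (P v)) (\<lambda>e. emb (S e))"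
proof -
  have P: "P v \<in> carrier A" "star A (P v) = P v" "P v \<otimes> P v = P v" if "v \<in> verts G" for v
    using assms that unfolding ck_family_def projection_def by auto
  have S: "S e \<in> carrier A" "S e \<otimes> star A (S e) \<otimes> S e = S e" if "e \<in> arcs G" for e
    using assms that unfolding ck_family_def partial_isometry_def by auto
  have 1: "star A (S e) \<otimes> S e = P (head G e)" if "e \<in> arcs G" for e
    using assms that unfolding ck_family_def by blast
  have 2: "P v \<otimes> P w = \<zero>" if "v \<in> verts G" "w \<in> verts G" "v \<noteq> w" for v w
    using assms that unfolding ck_family_def by blast
  have 3: "P v = finsum A (\<lambda>e. S e \<otimes> star A (S e)) (out_arcs G v)" if "v \<in> tail G ` arcs G" for v
    using assms that unfolding ck_family_def by blast
  show ?thesis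
    unfolding ck_relations_def
  proof (intro conjI ballI impI)
    fix v assume v: "v \<in> verts G"
    show "adj (emb (P v)) = emb (P v)" using P[OF v] by (simp flip: emb_star)
    show "emb (P v) * emb (P v) = emb (P v)" using P[OF v] by (simp flip: emb_mult)
    fix w assume "w \<in> verts G" "v \<noteq> w"
    then show "emb (P v) * emb (P w) = 0"
      using v P 2[of v w] by (simp add: emb_zero flip: emb_mult)
  next
    fix e assume e: "e \<in> arcs G"
    show "emb (S e) * adj (emb (S e)) * emb (S e) = emb (S e)"
      using S[OF e] by (simp add: star_closed mult_closed flip: emb_star emb_mult)
    show "adj (emb (S e)) * emb (S e) = emb (P (head G e))"
      using S[OF e] 1[OF e] by (simp add: star_closed flip: emb_star emb_mult)
  next
    fix v assume v: "v \<in> tail G ` arcs G"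
    have "emb (P v) = (\<Sum>e\<in>out_arcs G v. emb (S e \<otimes> star A (S e)))"
      unfolding 3[OF v] by (rule emb_finsum) (auto simp: S mult_closed star_closed)
    also have "\<dots> = (\<Sum>e\<in>out_arcs G v. emb (S e) * adj (emb (S e)))"
      by (rule sum.cong) (auto simp: S star_closed emb_mult emb_star)
    finally show "emb (P v) = (\<Sum>e\<in>out_arcs G v. emb (S e) * adj (emb (S e)))" .
  qed
qed

lemma emb_generated:
  assumes gen: "\<And>H. cstar_subalgebra A H \<Longrightarrow> P ` V \<subseteq> H \<Longrightarrow> S ` W \<subseteq> H \<Longrightarrow> H = carrier A"
    and K: "closed_subalgebra K" and c: "P ` V \<subseteq> carrier A" "S ` W \<subseteq> carrier A"
    and PS: "\<And>v. v \<in> V \<Longrightarrow> emb (P v) \<in> K" "\<And>e. e \<in> W \<Longrightarrow> emb (S e) \<in> K"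
  shows "emb ` carrier A \<subseteq> K"
proof -
  define H where "H = {x \<in> carrier A. emb x \<in> K}"
  have "cstar_subalgebra A H"
    unfolding cstar_subalgebra_def closed_subspace_def
  proof (intro conjI ballI allI impI)
    show "H \<subseteq> carrier A" by (auto simp: H_def)
    show "\<zero> \<in> H" by (simp add: H_def emb_zero closed_subalgebraD[OF K])
    fix X L assume L: "L \<in> carrier A" and X: "(\<forall>n. X n \<in> H) \<and> norm_converges A (cnorm A) X L"
    then have Xc: "X n \<in> carrier A" "emb (X n) \<in> K" for n by (auto simp: H_def)
    have "(\<lambda>n. emb (X n)) \<longlonglongrightarrow> emb L" using X norm_converges_iff[of X L] Xc(1) L by simp
    then have "emb L \<in> K"
      by (rule closed_sequentially[OF closed_subalgebraD(1)[OF K] Xc(2)])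
    then show "L \<in> H" using L by (simp add: H_def)
  qed (auto simp: H_def emb_add emb_mult emb_star emb_smult mult_closed star_closed
      closed_subalgebraD[OF K])
  moreover have "P ` V \<subseteq> H" "S ` W \<subseteq> H" using c PS by (auto simp: H_def)
  ultimately have "H = carrier A" by (rule gen)
  then show ?thesis by (auto simp: H_def)
qed

lemma inv_emb [simp]: "x \<in> carrier A \<Longrightarrow> inv_into (carrier A) emb (emb x) = x"
  by (rule inv_into_f_f[OF emb_inj])

lemma inv_emb_closed: "s \<in> emb ` carrier A \<Longrightarrow> inv_into (carrier A) emb s \<in> carrier A"
  by (rule inv_into_into)

lemma emb_inv [simp]: "s \<in> emb ` carrier A \<Longrightarrow> emb (inv_into (carrier A) emb s) = s"
  by (rule f_inv_into_f)

lemma emb_eq_iff: "x \<in> carrier A \<Longrightarrow> y \<in> carrier A \<Longrightarrow> emb x = emb y \<longleftrightarrow> x = y"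
  using emb_inj by (auto simp: inj_on_def)

end

lemma isometric_embedding_cembed: "cstar_algebra A \<Longrightarrow> isometric_embedding A (cembed A)"
  by (intro isometric_embedding.intro isometric_embedding_axioms.intro)
    (simp_all add: cstar_algebra.cembed_add cstar_algebra.cembed_smult cstar_algebra.cembed_mult
      cstar_algebra.cembed_star cstar_algebra.norm_cembed)

section \<open>Separable subalgebras and change of the element type\<close>

definition transported_cstar :: "'m::cstar_unital set \<Rightarrow> ('m \<Rightarrow> 'x) \<Rightarrow> 'x cstar" where
  "transported_cstar K j = (let i = inv_into K j in
     \<lparr>carrier = j ` K, mult = \<lambda>x y. j (i x * i y), one = j 0, zero = j 0, add = \<lambda>x y. j (i x + i y),
      smult = \<lambda>c x. j (scaleC c (i x)), star = \<lambda>x. j (adj (i x)), cnorm = \<lambda>x. norm (i x)\<rparr>)"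

locale transport =
  fixes K :: "'m::cstar_unital set" and j :: "'m \<Rightarrow> 'x"
  assumes K: "closed_subalgebra K" and inj: "inj_on j K"
begin

abbreviation "C \<equiv> transported_cstar K j"

lemmas Kd = closed_subalgebraD[OF K]

lemma inv_j [simp]: "x \<in> K \<Longrightarrow> inv_into K j (j x) = x"
  by (rule inv_into_f_f[OF inj])

lemma C_simps [simp]:
  "carrier C = j ` K" "\<zero>\<^bsub>C\<^esub> = j 0"
  "x \<in> K \<Longrightarrow> y \<in> K \<Longrightarrow> j x \<otimes>\<^bsub>C\<^esub> j y = j (x * y)"
  "x \<in> K \<Longrightarrow> y \<in> K \<Longrightarrow> j x \<oplus>\<^bsub>C\<^esub> j y = j (x + y)"
  "x \<in> K \<Longrightarrow> c \<odot>\<^bsub>C\<^esub> j x = j (scaleC c x)"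
  "x \<in> K \<Longrightarrow> star C (j x) = j (adj x)"
  "x \<in> K \<Longrightarrow> cnorm C (j x) = norm x"
  by (simp_all add: transported_cstar_def Let_def)

lemma abelian_group_C: "abelian_group C"
proof (rule abelian_groupI)
  fix x assume "x \<in> carrier C"
  then obtain y where "y \<in> K" "x = j y" by auto
  then show "\<exists>y\<in>carrier C. y \<oplus>\<^bsub>C\<^esub> x = \<zero>\<^bsub>C\<^esub>" by (auto intro!: bexI[of _ "- y"] simp: Kd)
qed (auto simp: Kd add_ac)

lemma minus_C:
  assumes "x \<in> K" "y \<in> K"
  shows "j x \<ominus>\<^bsub>C\<^esub> j y = j (x - y)"
proof -
  interpret abelian_group C by (rule abelian_group_C)
  have "\<ominus>\<^bsub>C\<^esub> j y = j (- y)" using assms by (intro minus_equality) (auto simp: Kd)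
  then show ?thesis using assms by (simp add: a_minus_def Kd)
qed

lemma module_C: "module complex_ring C"
proof (rule moduleI[OF cring_complex_ring abelian_group_C])
qed (auto simp: Kd scaleC_add_left scaleC_add_right scaleC_scaleC scaleC_one)

lemma norm_complete_C: "norm_complete C (cnorm C)"
  unfolding norm_complete_def
proof (intro allI impI, elim conjE)
  fix X :: "nat \<Rightarrow> 'x" assume X: "\<forall>n. X n \<in> carrier C"
    and c: "\<forall>e>0. \<exists>k. \<forall>m\<ge>k. \<forall>n\<ge>k. cnorm C (X m \<ominus>\<^bsub>C\<^esub> X n) < e"
  from X have "\<forall>n. \<exists>y. y \<in> K \<and> X n = j y" by auto
  then have "\<exists>Y. \<forall>n. Y n \<in> K \<and> X n = j (Y n)" by (rule choice)
  then obtain Y where "\<forall>n. Y n \<in> K \<and> X n = j (Y n)" ..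
  then have Y: "Y n \<in> K" "X n = j (Y n)" for n by auto
  have "cnorm C (X m \<ominus>\<^bsub>C\<^esub> X n) = norm (Y m - Y n)" for m n
    using Y by (simp add: minus_C Kd)
  then have "Cauchy Y" using c by (simp add: Cauchy_iff)
  then obtain z where z: "Y \<longlonglongrightarrow> z" by (auto simp: Cauchy_convergent_iff convergent_def)
  then have zK: "z \<in> K" using closed_sequentially[OF Kd(1)] Y by blast
  have "(\<lambda>n. norm (Y n - z)) \<longlonglongrightarrow> 0" using z LIM_zero tendsto_norm_zero by blast
  then have "norm_converges C (cnorm C) X (j z)"
    using Y zK by (simp add: norm_converges_def minus_C Kd)
  then show "\<exists>L\<in>carrier C. norm_converges C (cnorm C) X L" using zK by auto
qed

lemma cstar_algebra_C: "cstar_algebra C"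
proof -
  have j0: "j x = j 0 \<longleftrightarrow> x = 0" if "x \<in> K" for x using inj that Kd(2) by (auto simp: inj_on_def)
  show ?thesis
  proof (rule cstar_algebra.intro[OF module_C], unfold_locales)
    show "norm_complete C (cnorm C)" by (rule norm_complete_C)
  qed (auto simp: Kd mult.assoc distrib_left distrib_right scaleC_mult_left scaleC_mult_right adj_add
      adj_mult adj_scaleC j0 norm_triangle_ineq norm_scaleC norm_mult_ineq norm_adj_mult_self)
qed

lemma finsum_C:
  "(\<And>i. i \<in> I \<Longrightarrow> f i \<in> K) \<Longrightarrow> finsum C (\<lambda>i. j (f i)) I = j (\<Sum>i\<in>I. f i)"
proof (induction I rule: infinite_finite_induct)
  case (insert i I)
  interpret abelian_group C by (rule abelian_group_C)
  have "sum f I \<in> K" using insert by (intro closed_subalgebra_sum[OF K]) auto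
  then show ?case using insert by (simp add: finsum_insert Pi_def)
qed (simp_all add: abelian_monoid.finsum_infinite abelian_monoid.finsum_empty
    abelian_group.axioms(1)[OF abelian_group_C])

lemma ck_family_C:
  assumes "ck_relations G p s" "wf_digraph G"
    and p: "\<And>v. v \<in> verts G \<Longrightarrow> p v \<in> K" and s: "\<And>e. e \<in> arcs G \<Longrightarrow> s e \<in> K"
  shows "ck_family G C (\<lambda>v. j (p v)) (\<lambda>e. j (s e))"
  unfolding ck_family_def projection_def partial_isometry_def
proof (intro conjI ballI impI)
  note ck = assms(1)[unfolded ck_relations_def]
  fix v assume "v \<in> tail G ` arcs G"
  then have "p v = (\<Sum>e\<in>out_arcs G v. s e * adj (s e))" using ck by blast
  moreover have "finsum C (\<lambda>e. j (s e) \<otimes>\<^bsub>C\<^esub> star C (j (s e))) (out_arcs G v)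
    = finsum C (\<lambda>e. j (s e * adj (s e))) (out_arcs G v)"
    using s Kd by (intro abelian_monoid.finsum_cong' abelian_group.axioms(1)[OF abelian_group_C]) auto
  ultimately show "j (p v) = finsum C (\<lambda>e. j (s e) \<otimes>\<^bsub>C\<^esub> star C (j (s e))) (out_arcs G v)"
    using s Kd by (subst (asm) finsum_C) auto
qed (use assms(1)[unfolded ck_relations_def] p s Kd wf_digraph.head_in_verts[OF assms(2)] in auto)

end

text \<open>Polynomials in the generators and their adjoints, with coefficients built from the
  rationals and the imaginary unit. There are only countably many, so their values form a countable
  dense subset of the closed subalgebra that they generate.\<close>

datatype star_term =
  Generator nat | Plus star_term star_term | Times star_term star_term | Adjoint star_term |
  Scale rat star_term | Imag star_term

instance star_term :: countable
  by countable_datatype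

primrec eval_term :: "(nat \<Rightarrow> 'm::cstar_unital) \<Rightarrow> star_term \<Rightarrow> 'm" where
  "eval_term g (Generator n) = g n"
| "eval_term g (Plus t u) = eval_term g t + eval_term g u"
| "eval_term g (Times t u) = eval_term g t * eval_term g u"
| "eval_term g (Adjoint t) = adj (eval_term g t)"
| "eval_term g (Scale r t) = of_rat r *\<^sub>R eval_term g t"
| "eval_term g (Imag t) = iu * eval_term g t"

lemma closed_subalgebra_closure_terms: "closed_subalgebra (closure (range (eval_term g)))"
proof -
  let ?D = "range (eval_term g)"
  let ?K = "closure ?D"
  have seq: "\<exists>X. (\<forall>n. X n \<in> ?D) \<and> X \<longlonglongrightarrow> x" if "x \<in> ?K" for x
    using that by (simp add: closure_sequential)
  have lim: "x \<in> ?K" if "\<And>n. X n \<in> ?D" "X \<longlonglongrightarrow> x" for X x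
    using that by (auto simp: closure_sequential)
  have D1: "x + y \<in> ?D" "x * y \<in> ?D" if xy: "x \<in> ?D" "y \<in> ?D" for x y
  proof -
    obtain t u where "x = eval_term g t" "y = eval_term g u" using xy by blast
    then show "x + y \<in> ?D" "x * y \<in> ?D"
      using rangeI[of "eval_term g" "Plus t u"] rangeI[of "eval_term g" "Times t u"] by simp_all
  qed
  have D2: "adj x \<in> ?D" "of_rat r *\<^sub>R x \<in> ?D" "iu * x \<in> ?D" if x: "x \<in> ?D" for x r
  proof -
    obtain t where "x = eval_term g t" using x by blast
    then show "adj x \<in> ?D" "of_rat r *\<^sub>R x \<in> ?D" "iu * x \<in> ?D"
      using rangeI[of "eval_term g" "Adjoint t"] rangeI[of "eval_term g" "Scale r t"]
        rangeI[of "eval_term g" "Imag t"] by simp_all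
  qed
  have add: "x + y \<in> ?K" if k: "x \<in> ?K" "y \<in> ?K" for x y
  proof -
    obtain X Y where X: "\<forall>n. X n \<in> ?D" "X \<longlonglongrightarrow> x" and Y: "\<forall>n. Y n \<in> ?D" "Y \<longlonglongrightarrow> y"
      using seq[OF k(1)] seq[OF k(2)] by blast
    have "X n + Y n \<in> ?D" for n by (intro D1 X(1)[rule_format] Y(1)[rule_format])
    then show ?thesis by (rule lim[of "\<lambda>n. X n + Y n", OF _ tendsto_add[OF X(2) Y(2)]])
  qed
  have mult: "x * y \<in> ?K" if k: "x \<in> ?K" "y \<in> ?K" for x y
  proof -
    obtain X Y where X: "\<forall>n. X n \<in> ?D" "X \<longlonglongrightarrow> x" and Y: "\<forall>n. Y n \<in> ?D" "Y \<longlonglongrightarrow> y"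
      using seq[OF k(1)] seq[OF k(2)] by blast
    have "X n * Y n \<in> ?D" for n by (intro D1 X(1)[rule_format] Y(1)[rule_format])
    then show ?thesis by (rule lim[of "\<lambda>n. X n * Y n", OF _ tendsto_mult[OF X(2) Y(2)]])
  qed
  have adj: "adj x \<in> ?K" if k: "x \<in> ?K" for x
  proof -
    obtain X where X: "\<forall>n. X n \<in> ?D" "X \<longlonglongrightarrow> x" using seq[OF k] by blast
    have "adj (X n) \<in> ?D" for n by (rule D2(1)[OF X(1)[rule_format]])
    then show ?thesis
      by (rule lim[of "\<lambda>n. adj (X n)", OF _ bounded_linear.tendsto[OF bounded_linear_adj X(2)]])
  qed
  have imag: "iu * x \<in> ?K" if k: "x \<in> ?K" for x
  proof -
    obtain X where X: "\<forall>n. X n \<in> ?D" "X \<longlonglongrightarrow> x" using seq[OF k] by blast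
    have "iu * X n \<in> ?D" for n by (rule D2(3)[OF X(1)[rule_format]])
    then show ?thesis by (rule lim[of "\<lambda>n. iu * X n", OF _ tendsto_mult[OF tendsto_const X(2)]])
  qed
  have scale: "r *\<^sub>R x \<in> ?K" if k: "x \<in> ?K" for r x
  proof -
    obtain X where X: "\<forall>n. X n \<in> ?D" "X \<longlonglongrightarrow> x" using seq[OF k] by blast
    have "r \<in> closure \<rat>" by (simp add: Rats_closure_real)
    then obtain q where q: "\<forall>n. q n \<in> \<rat>" "q \<longlonglongrightarrow> r" by (auto simp: closure_sequential)
    have "q n *\<^sub>R X n \<in> ?D" for n
    proof -
      obtain p where "q n = of_rat p" using q(1) Rats_cases by blast
      then show ?thesis using D2(2)[of "X n" p] X(1) by simp
    qed
    then show ?thesis by (rule lim[of "\<lambda>n. q n *\<^sub>R X n", OF _ tendsto_scaleR[OF q(2) X(2)]])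
  qed
  have "eval_term g (Generator 0) \<in> ?K" by (rule closure_subset[THEN subsetD]) (rule rangeI)
  then have zero: "0 \<in> ?K" using scale[of "eval_term g (Generator 0)" 0] by simp
  show ?thesis
    unfolding closed_subalgebra_def scaleC_def
    by (intro conjI ballI allI add mult adj imag scale zero) simp_all
qed

text \<open>A point of K is determined by its distances to a countable dense set. The sequence of
  these distances is the injection j; no structure has to be respected, as the operations are
  transported along j afterwards.\<close>

lemma separable_closed_subalgebra:
  fixes C :: "'m::cstar_unital set"
  assumes "countable C"
  obtains K and j :: "'m \<Rightarrow> nat \<Rightarrow> complex" where "closed_subalgebra K" "C \<subseteq> K" "inj_on j K"
proof -
  \<comment> \<open>C may be empty; adding 0 gives \<open>from_nat_into\<close> a nonempty set to
    enumerate.\<close>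
  define g where "g = from_nat_into (insert 0 C)"
  have rg: "range g = insert 0 C" unfolding g_def using assms by (intro range_from_nat_into) auto
  define K where "K = closure (range (eval_term g))"
  define j where "j = (\<lambda>x n. complex_of_real (norm (x - eval_term g (from_nat n))))"
  have "C \<subseteq> K"
  proof
    fix x assume "x \<in> C"
    then obtain n where "x = eval_term g (Generator n)" using rg by auto
    moreover have "eval_term g (Generator n) \<in> K"
      unfolding K_def by (rule closure_subset[THEN subsetD]) (rule rangeI)
    ultimately show "x \<in> K" by (simp only:)
  qed
  moreover have "inj_on j K"
  proof (rule inj_onI)
    fix x y assume x: "x \<in> K" and "j x = j y"
    have xy: "norm (x - eval_term g t) = norm (y - eval_term g t)" for t
      using fun_cong[OF \<open>j x = j y\<close>, of "to_nat t"] by (simp add: j_def)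
    have "norm (x - y) \<le> 0 + e" if e: "0 < e" for e
    proof -
      have "\<exists>d\<in>range (eval_term g). dist d x < e / 2"
        using x half_gt_zero[OF e] unfolding K_def closure_approachable by blast
      then obtain t where t: "dist (eval_term g t) x < e / 2" by blast
      have "norm (x - y) \<le> norm (x - eval_term g t) + norm (y - eval_term g t)"
        using norm_triangle_ineq4[of "x - eval_term g t" "y - eval_term g t"] by (simp only: diff_diff_eq2 diff_add_cancel)
      also have "\<dots> \<le> 0 + e" using t by (simp add: xy dist_norm norm_minus_commute)
      finally show ?thesis .
    qed
    then have "norm (x - y) \<le> 0" by (rule field_le_epsilon)
    then show "x = y" by simp
  qed
  ultimately show thesis
    by (intro that[of K j]) (simp_all only: K_def closed_subalgebra_closure_terms)
qed

definition embedded :: "'a cstar \<Rightarrow> 'a cprod adjop set" where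
  "embedded A = cembed A ` carrier A"

text \<open>Frees the universal property from the type \<open>nat \<Rightarrow> complex\<close>: the
  family is enclosed in a separable closed subalgebra K, the homomorphism is obtained into the copy
  of K, and it is composed with the inverse of the injection j.\<close>

lemma graph_algebra_universal:
  fixes q :: "'v \<Rightarrow> 'm::cstar_unital"
  assumes GA: "graph_algebra G A P S" and G: "wf_digraph G" "countable (verts G)" "countable (arcs G)"
    and qt: "ck_relations G q t"
  obtains h where "is_star_hom (embedded A) h"
    "\<And>v. v \<in> verts G \<Longrightarrow> h (cembed A (P v)) = q v" "\<And>e. e \<in> arcs G \<Longrightarrow> h (cembed A (S e)) = t e"
proof -
  interpret A: isometric_embedding A "cembed A"
    using GA by (intro isometric_embedding_cembed) (simp add: graph_algebra_def)
  obtain K and j :: "'m \<Rightarrow> nat \<Rightarrow> complex"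
    where Kj: "closed_subalgebra K" "q ` verts G \<union> t ` arcs G \<subseteq> K" "inj_on j K"
    using separable_closed_subalgebra[of "q ` verts G \<union> t ` arcs G"] G(2,3)
    by (metis countable_Un countable_image)
  interpret transport K j using Kj by unfold_locales
  have "ck_family G C (\<lambda>v. j (q v)) (\<lambda>e. j (t e))"
    by (rule ck_family_C[OF qt G(1)]) (use Kj in auto)
  then have ckC: "cstar_algebra C \<and> ck_family G C (\<lambda>v. j (q v)) (\<lambda>e. j (t e))"
    by (intro conjI cstar_algebra_C)
  have "\<forall>(B :: (nat \<Rightarrow> complex) cstar) Q T. cstar_algebra B \<and> ck_family G B Q T \<longrightarrow>
    (\<exists>h. star_hom A B h \<and> (\<forall>v\<in>verts G. h (P v) = Q v) \<and> (\<forall>e\<in>arcs G. h (S e) = T e))"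
    using GA unfolding graph_algebra_def by (elim conjE)
  from this[rule_format, OF ckC] obtain h where
    h: "star_hom A C h" "\<forall>v\<in>verts G. h (P v) = j (q v)" "\<forall>e\<in>arcs G. h (S e) = j (t e)"
    by (elim exE conjE)
  have "ck_family G A P S" using GA by (simp add: graph_algebra_def)
  then have c: "\<And>v. v \<in> verts G \<Longrightarrow> P v \<in> carrier A" "\<And>e. e \<in> arcs G \<Longrightarrow> S e \<in> carrier A"
    unfolding ck_family_def projection_def partial_isometry_def by auto
  let ?k = "inv_into (carrier A) (cembed A)"
  have k: "?k (cembed A x) = x" if "x \<in> carrier A" for x
    using that by simp
  let ?g = "\<lambda>x. inv_into K j (h (?k x))"
  have hK: "\<exists>y\<in>K. h x = j y" if "x \<in> carrier A" for x using h(1) that unfolding star_hom_def by auto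
  show thesis
  proof
    show "is_star_hom (embedded A) ?g"
      unfolding is_star_hom_def embedded_def
    proof (intro conjI ballI allI; elim imageE; clarify)
      fix a b assume ab: "a \<in> carrier A" "b \<in> carrier A"
      obtain x where x: "x \<in> K" "h a = j x" using hK[OF ab(1)] by blast
      obtain y where y: "y \<in> K" "h b = j y" using hK[OF ab(2)] by blast
      note xy = x y
      have "h (a \<oplus>\<^bsub>A\<^esub> b) = j (x + y)" "h (a \<otimes>\<^bsub>A\<^esub> b) = j (x * y)"
        using h(1) ab xy unfolding star_hom_def by auto
      then show "?g (cembed A a + cembed A b) = ?g (cembed A a) + ?g (cembed A b)"
        "?g (cembed A a * cembed A b) = ?g (cembed A a) * ?g (cembed A b)"
        using ab xy by (simp_all add: k Kd A.mult_closed flip: A.emb_add A.emb_mult)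
    next
      fix c a assume a: "a \<in> carrier A"
      obtain x where x: "x \<in> K" "h a = j x" using hK[OF a] by blast
      have "h (c \<odot>\<^bsub>A\<^esub> a) = j (scaleC c x)" using h(1) a x unfolding star_hom_def by auto
      then show "?g (scaleC c (cembed A a)) = scaleC c (?g (cembed A a))"
        using a x by (simp add: k Kd flip: A.emb_smult)
    next
      fix a assume a: "a \<in> carrier A"
      obtain x where x: "x \<in> K" "h a = j x" using hK[OF a] by blast
      have "h (star A a) = j (adj x)" using h(1) a x unfolding star_hom_def by auto
      then show "?g (adj (cembed A a)) = adj (?g (cembed A a))"
        using a x by (simp add: k Kd A.star_closed flip: A.emb_star)
    qed
    show "?g (cembed A (P v)) = q v" if "v \<in> verts G" for v
      using that h(2) Kj(2) c by (auto simp: k)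
    show "?g (cembed A (S e)) = t e" if "e \<in> arcs G" for e
      using that h(3) Kj(2) c by (auto simp: k)
  qed
qed

section \<open>Imprimitivity bimodules from corners\<close>

text \<open>
  \<open>alpha\<close> identifies \<open>A\<close> with the corner of \<open>B\<close> cut out by the projection \<open>p\<close>, which need not
  lie in \<open>B\<close>.  The corner is full because of \<open>1 = p + u * adj u = p * p + u * p * adj u\<close>.
\<close>

locale full_corner =
  A: isometric_embedding A \<alpha> + B: isometric_embedding B \<beta>
  for A :: "'a cstar" and \<alpha> :: "'a \<Rightarrow> 'm::cstar_unital" and B :: "'b cstar" and \<beta> :: "'b \<Rightarrow> 'm" +
  fixes p u :: 'm
  assumes adj_p: "adj p = p" and pp: "p * p = p"
    and \<alpha>_in: "a \<in> carrier A \<Longrightarrow> \<alpha> a \<in> \<beta> ` carrier B"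
    and p_\<alpha>: "a \<in> carrier A \<Longrightarrow> p * \<alpha> a = \<alpha> a"
    and p_in: "x \<in> \<beta> ` carrier B \<Longrightarrow> p * x \<in> \<beta> ` carrier B"
    and inner_in: "\<lbrakk>x \<in> \<beta> ` carrier B; y \<in> \<beta> ` carrier B; p * x = x; p * y = y\<rbrakk> \<Longrightarrow>
      x * adj y \<in> \<alpha> ` carrier A"
    and u_in: "u \<in> \<beta> ` carrier B" and up: "u * p = u" and full: "p + u * adj u = 1"
    and products_A: "\<lbrakk>closed_subspace A H; \<And>x y. x \<in> carrier A \<Longrightarrow> y \<in> carrier A \<Longrightarrow> x \<otimes>\<^bsub>A\<^esub> y \<in> H\<rbrakk>
      \<Longrightarrow> H = carrier A"
    and products_B: "\<lbrakk>closed_subspace B H'; \<And>b c. b \<in> carrier B \<Longrightarrow> c \<in> carrier B \<Longrightarrow> b \<otimes>\<^bsub>B\<^esub> c \<in> H'\<rbrakk>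
      \<Longrightarrow> H' = carrier B"
begin

text \<open>Equal to p B, the off-diagonal block linking the corner to B.\<close>

definition R :: "'m set" where
  "R = {x \<in> \<beta> ` carrier B. p * x = x}"

text \<open>\<open>morita_equivalent\<close> prescribes the element type; the first component is
  filled with a constant and all information sits in the second.\<close>

definition k :: "'m \<Rightarrow> 'a \<times> 'b" where
  "k x = (\<zero>\<^bsub>A\<^esub>, inv_into (carrier B) \<beta> x)"

definition row_module :: "('a, 'b, 'a \<times> 'b) bimodule" where
  "row_module =
     \<lparr>carrier = k ` R, mult = \<lambda>z w. z, one = k 0, zero = k 0,
      add = \<lambda>z w. k (\<beta> (snd z) + \<beta> (snd w)), smult = \<lambda>c z. k (scaleC c (\<beta> (snd z))),
      lact = \<lambda>a z. k (\<alpha> a * \<beta> (snd z)), ract = \<lambda>z b. k (\<beta> (snd z) * \<beta> b),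
      linner = \<lambda>z w. inv_into (carrier A) \<alpha> (\<beta> (snd z) * adj (\<beta> (snd w))),
      rinner = \<lambda>z w. inv_into (carrier B) \<beta> (adj (\<beta> (snd z)) * \<beta> (snd w))\<rparr>"

lemmas Kd = closed_subalgebraD[OF B.closed_subalgebra_emb]
lemmas Ad = closed_subalgebraD[OF A.closed_subalgebra_emb]

lemma RD: "x \<in> R \<Longrightarrow> x \<in> \<beta> ` carrier B" "x \<in> R \<Longrightarrow> p * x = x"
  by (simp_all add: R_def)

lemma RI: "x \<in> \<beta> ` carrier B \<Longrightarrow> p * x = x \<Longrightarrow> x \<in> R"
  by (simp add: R_def)

lemma beta_k [simp]: "x \<in> R \<Longrightarrow> \<beta> (snd (k x)) = x"
  by (simp add: k_def RD)

lemma R_arith: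
  "0 \<in> R" "x \<in> R \<Longrightarrow> y \<in> R \<Longrightarrow> x + y \<in> R" "x \<in> R \<Longrightarrow> y \<in> R \<Longrightarrow> x - y \<in> R"
  "x \<in> R \<Longrightarrow> - x \<in> R" "x \<in> R \<Longrightarrow> scaleC c x \<in> R"
  "a \<in> carrier A \<Longrightarrow> x \<in> R \<Longrightarrow> \<alpha> a * x \<in> R" "b \<in> carrier B \<Longrightarrow> x \<in> R \<Longrightarrow> x * \<beta> b \<in> R"
proof -
  show "0 \<in> R" by (rule RI) (simp_all add: Kd)
  show "x \<in> R \<Longrightarrow> y \<in> R \<Longrightarrow> x + y \<in> R" by (rule RI) (simp_all add: RD Kd distrib_left)
  show "x \<in> R \<Longrightarrow> y \<in> R \<Longrightarrow> x - y \<in> R" by (rule RI) (simp_all add: RD Kd right_diff_distrib)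
  show "x \<in> R \<Longrightarrow> - x \<in> R" by (rule RI) (simp_all add: RD Kd)
  show "x \<in> R \<Longrightarrow> scaleC c x \<in> R" by (rule RI) (simp_all add: RD Kd scaleC_mult_right)
  show "a \<in> carrier A \<Longrightarrow> x \<in> R \<Longrightarrow> \<alpha> a * x \<in> R"
    by (rule RI) (simp_all add: RD Kd \<alpha>_in p_\<alpha> flip: mult.assoc)
  show "b \<in> carrier B \<Longrightarrow> x \<in> R \<Longrightarrow> x * \<beta> b \<in> R"
    by (rule RI) (simp_all add: RD Kd flip: mult.assoc)
qed

lemma in_A: "x \<in> R \<Longrightarrow> y \<in> R \<Longrightarrow> x * adj y \<in> \<alpha> ` carrier A"
  by (rule inner_in) (simp_all add: RD)

lemma in_B: "x \<in> R \<Longrightarrow> y \<in> R \<Longrightarrow> adj x * y \<in> \<beta> ` carrier B"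
  by (simp add: RD Kd)

lemma M_simps [simp]:
  "carrier row_module = k ` R" "\<zero>\<^bsub>row_module\<^esub> = k 0"
  "x \<in> R \<Longrightarrow> y \<in> R \<Longrightarrow> k x \<oplus>\<^bsub>row_module\<^esub> k y = k (x + y)"
  "x \<in> R \<Longrightarrow> c \<odot>\<^bsub>row_module\<^esub> k x = k (scaleC c x)"
  "x \<in> R \<Longrightarrow> lact row_module a (k x) = k (\<alpha> a * x)"
  "x \<in> R \<Longrightarrow> ract row_module (k x) b = k (x * \<beta> b)"
  "x \<in> R \<Longrightarrow> y \<in> R \<Longrightarrow> linner row_module (k x) (k y) = inv_into (carrier A) \<alpha> (x * adj y)"
  "x \<in> R \<Longrightarrow> y \<in> R \<Longrightarrow> rinner row_module (k x) (k y) = inv_into (carrier B) \<beta> (adj x * y)"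
  by (simp_all add: row_module_def)

lemma abelian_group_M: "abelian_group row_module"
proof (rule abelian_groupI)
  fix x assume "x \<in> carrier row_module"
  then obtain y where "y \<in> R" "x = k y" by auto
  then show "\<exists>y\<in>carrier row_module. y \<oplus>\<^bsub>row_module\<^esub> x = \<zero>\<^bsub>row_module\<^esub>"
    by (auto intro!: bexI[of _ "- y"] simp: R_arith)
qed (auto simp: R_arith add_ac)

lemma minus_M:
  assumes "x \<in> R" "y \<in> R"
  shows "k x \<ominus>\<^bsub>row_module\<^esub> k y = k (x - y)"
proof -
  interpret abelian_group row_module by (rule abelian_group_M)
  have "\<ominus>\<^bsub>row_module\<^esub> k y = k (- y)" using assms by (intro minus_equality) (auto simp: R_arith)
  then show ?thesis using assms by (simp add: a_minus_def R_arith)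
qed

lemma module_M: "module complex_ring row_module"
proof (rule moduleI[OF cring_complex_ring abelian_group_M])
qed (auto simp: R_arith scaleC_add_left scaleC_add_right scaleC_scaleC scaleC_one)

lemma closed_R: "closed R"
proof -
  have "closed ((\<lambda>x. p * x - x) -` {0})"
    by (intro continuous_closed_vimage) (auto intro!: continuous_intros)
  moreover have "R = \<beta> ` carrier B \<inter> (\<lambda>x. p * x - x) -` {0}" by (auto simp: R_def)
  ultimately show ?thesis using Kd(1) by (simp add: closed_Int)
qed

text \<open>Both inner products induce the operator norm on R, by the C*-identity for
  \<open>adj x\<close> and for x, so one argument settles completeness on both sides.\<close>

lemma norm_complete_M:
  assumes N: "\<And>x. x \<in> R \<Longrightarrow> N (k x) = norm x"
  shows "norm_complete row_module N"
  unfolding norm_complete_def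
proof (intro allI impI, elim conjE)
  fix X :: "nat \<Rightarrow> 'a \<times> 'b" assume X: "\<forall>n. X n \<in> carrier row_module"
    and c: "\<forall>e>0. \<exists>k. \<forall>m\<ge>k. \<forall>n\<ge>k. N (X m \<ominus>\<^bsub>row_module\<^esub> X n) < e"
  from X have "\<forall>n. \<exists>y. y \<in> R \<and> X n = k y" by auto
  then have "\<exists>Y. \<forall>n. Y n \<in> R \<and> X n = k (Y n)" by (rule choice)
  then obtain Y where "\<forall>n. Y n \<in> R \<and> X n = k (Y n)" ..
  then have Y: "Y n \<in> R" "X n = k (Y n)" for n by auto
  have "N (X m \<ominus>\<^bsub>row_module\<^esub> X n) = norm (Y m - Y n)" for m n
    using Y by (simp add: minus_M R_arith N)
  then have "Cauchy Y" using c by (simp add: Cauchy_iff)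
  then obtain z where z: "Y \<longlonglongrightarrow> z" by (auto simp: Cauchy_convergent_iff convergent_def)
  then have zR: "z \<in> R" using closed_sequentially[OF closed_R] Y by blast
  have "(\<lambda>n. norm (Y n - z)) \<longlonglongrightarrow> 0" using z LIM_zero tendsto_norm_zero by blast
  then have "norm_converges row_module N X (k z)"
    using Y zR by (simp add: norm_converges_def minus_M R_arith N)
  then show "\<exists>L\<in>carrier row_module. norm_converges row_module N X L" using zR by auto
qed

lemma norm_linner: "x \<in> R \<Longrightarrow> sqrt (cnorm A (linner row_module (k x) (k x))) = norm x"
  by (simp add: in_A A.inv_emb_closed norm_mult_adj_self flip: A.norm_emb)

lemma norm_rinner: "x \<in> R \<Longrightarrow> sqrt (cnorm B (rinner row_module (k x) (k x))) = norm x"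
  by (simp add: in_B B.inv_emb_closed norm_adj_mult_self flip: B.norm_emb)

text \<open>The square root of \<open>x * adj x\<close> lies in \<open>A\<close> although \<open>x\<close> does not.\<close>

lemma positive_linner:
  assumes x: "x \<in> R"
  shows "positive A (inv_into (carrier A) \<alpha> (x * adj x))"
proof -
  have "pos (x * adj x)" using pos_adj_mult_self[of "adj x"] by simp
  then obtain h where h: "selfadj h" "h * h = x * adj x"
    "\<And>K. closed_subalgebra K \<Longrightarrow> x * adj x \<in> K \<Longrightarrow> h \<in> K"
    using pos_sqrt by metis
  have "h \<in> \<alpha> ` carrier A" by (rule h(3)[OF A.closed_subalgebra_emb in_A[OF x x]])
  then obtain a where a: "a \<in> carrier A" "h = \<alpha> a" by blast
  have "\<alpha> (star A a \<otimes>\<^bsub>A\<^esub> a) = x * adj x"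
    using a h(1,2) by (simp add: A.emb_mult A.emb_star A.star_closed selfadj_def)
  then have "inv_into (carrier A) \<alpha> (x * adj x) = star A a \<otimes>\<^bsub>A\<^esub> a"
    using A.inv_emb[of "star A a \<otimes>\<^bsub>A\<^esub> a"] a(1) A.mult_closed A.star_closed by simp
  then show ?thesis unfolding positive_def using a(1) by blast
qed

lemma positive_rinner:
  assumes x: "x \<in> R"
  shows "positive B (inv_into (carrier B) \<beta> (adj x * x))"
proof -
  obtain b where b: "b \<in> carrier B" "x = \<beta> b" using RD(1)[OF x] by blast
  then have "adj x * x = \<beta> (star B b \<otimes>\<^bsub>B\<^esub> b)" by (simp add: B.emb_mult B.emb_star B.star_closed)
  then have "inv_into (carrier B) \<beta> (adj x * x) = star B b \<otimes>\<^bsub>B\<^esub> b"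
    using B.inv_emb[of "star B b \<otimes>\<^bsub>B\<^esub> b"] b(1) B.mult_closed B.star_closed by simp
  then show ?thesis unfolding positive_def using b(1) by blast
qed

lemma inv_\<alpha>_eqI: "s \<in> \<alpha> ` carrier A \<Longrightarrow> a \<in> carrier A \<Longrightarrow> s = \<alpha> a \<Longrightarrow> inv_into (carrier A) \<alpha> s = a"
  by simp

lemma inv_\<beta>_eqI: "s \<in> \<beta> ` carrier B \<Longrightarrow> b \<in> carrier B \<Longrightarrow> s = \<beta> b \<Longrightarrow> inv_into (carrier B) \<beta> s = b"
  by simp

lemmas A_rules = in_A A.inv_emb_closed A.emb_add A.emb_mult A.emb_smult A.emb_star A.mult_closed A.star_closed
lemmas B_rules = in_B B.inv_emb_closed B.emb_add B.emb_mult B.emb_smult B.emb_star B.mult_closed B.star_closed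

text \<open>R contains the image of A, so every product of two elements of A is an inner product,
  and \<open>products_A\<close> applies.\<close>

lemma left_fullness:
  assumes H: "closed_subspace A H"
    and l: "\<And>x y. x \<in> R \<Longrightarrow> y \<in> R \<Longrightarrow> inv_into (carrier A) \<alpha> (x * adj y) \<in> H"
  shows "H = carrier A"
proof (rule products_A[OF H])
  fix a b assume ab: "a \<in> carrier A" "b \<in> carrier A"
  have R: "\<alpha> a \<in> R" if "a \<in> carrier A" for a using that by (intro RI) (simp_all add: \<alpha>_in p_\<alpha>)
  have "inv_into (carrier A) \<alpha> (\<alpha> a * adj (\<alpha> (star A b))) = a \<otimes>\<^bsub>A\<^esub> b"
    using ab by (intro inv_\<alpha>_eqI in_A R) (simp_all add: A_rules)
  then show "a \<otimes>\<^bsub>A\<^esub> b \<in> H" using l[OF R R, of a "star A b"] ab by (simp add: A.star_closed)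
qed

lemma right_fullness:
  assumes H: "closed_subspace B H"
    and r: "\<And>x y. x \<in> R \<Longrightarrow> y \<in> R \<Longrightarrow> inv_into (carrier B) \<beta> (adj x * y) \<in> H"
  shows "H = carrier B"
proof (rule products_B[OF H])
  fix b c assume bc: "b \<in> carrier B" "c \<in> carrier B"
  have pR: "p * s \<in> R" if "s \<in> \<beta> ` carrier B" for s
    using that by (intro RI) (simp_all add: p_in pp flip: mult.assoc)
  \<comment> \<open>The pairs x, y and z, w produce the two summands of b (p + u
    \<open>adj u\<close>) c = b c. The factor p puts all four into R and disappears again by p * p =
    p and u * p = u.\<close>
  define x y z w where "x = p * adj (\<beta> b)" and "y = p * \<beta> c" and "z = p * (adj u * adj (\<beta> b))"
    and "w = p * (adj u * \<beta> c)"
  have R: "x \<in> R" "y \<in> R" "z \<in> R" "w \<in> R"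
    unfolding x_def y_def z_def w_def using bc by (auto intro!: pR simp: Kd u_in)
  have "adj x * y = \<beta> b * (p * p) * \<beta> c"
    by (simp add: x_def y_def adj_mult adj_p mult.assoc)
  moreover have "adj z * w = \<beta> b * (u * (p * p) * adj u) * \<beta> c"
    by (simp add: z_def w_def adj_mult adj_p mult.assoc)
  ultimately have "adj x * y + adj z * w = \<beta> b * (p + u * adj u) * \<beta> c"
    by (simp add: pp up distrib_left distrib_right)
  then have eq: "adj x * y + adj z * w = \<beta> b * \<beta> c" by (simp add: full)
  let ?i = "inv_into (carrier B) \<beta>"
  have "?i (adj x * y) \<oplus>\<^bsub>B\<^esub> ?i (adj z * w) \<in> H"
    using r R H unfolding closed_subspace_def by simp
  moreover have "?i (adj x * y) \<oplus>\<^bsub>B\<^esub> ?i (adj z * w) = b \<otimes>\<^bsub>B\<^esub> c"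
    using R bc eq by (subst B.emb_eq_iff[symmetric]) (simp_all add: B_rules)
  ultimately show "b \<otimes>\<^bsub>B\<^esub> c \<in> H" by simp
qed

lemma left_hilbert_module_M: "left_hilbert_module A row_module"
proof (rule left_hilbert_module.intro)
  show "cstar_algebra A" by unfold_locales
  show "module complex_ring row_module" by (rule module_M)
  show "left_hilbert_module_axioms A row_module"
  proof
    fix z assume "z \<in> carrier row_module" "linner row_module z z = \<zero>\<^bsub>A\<^esub>"
    then obtain x where x: "x \<in> R" "z = k x" "inv_into (carrier A) \<alpha> (x * adj x) = \<zero>\<^bsub>A\<^esub>" by auto
    then have "x * adj x = 0" using A.emb_inv[OF in_A[of x x]] by (simp add: A.emb_zero)
    then have "x = 0" using adj_mult_self_eq_0[of "adj x"] by (metis adj_adj adj_zero)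
    then show "z = \<zero>\<^bsub>row_module\<^esub>" using x by simp
  next
    show "norm_complete row_module (\<lambda>x. sqrt (cnorm A (linner row_module x x)))"
      by (rule norm_complete_M) (rule norm_linner)
  next
    fix H assume H: "closed_subspace A H"
      and l: "\<And>x y. \<lbrakk>x \<in> carrier row_module; y \<in> carrier row_module\<rbrakk> \<Longrightarrow> linner row_module x y \<in> H"
    show "H = carrier A"
    proof (rule left_fullness[OF H])
      fix x y assume "x \<in> R" "y \<in> R"
      then show "inv_into (carrier A) \<alpha> (x * adj y) \<in> H" using l[of "k x" "k y"] by simp
    qed
  next
    fix x y z assume "x \<in> carrier row_module" "y \<in> carrier row_module" "z \<in> carrier row_module"
    then obtain x' y' z' where s: "x' \<in> R" "x = k x'" "y' \<in> R" "y = k y'" "z' \<in> R" "z = k z'" by auto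
    show "linner row_module (x \<oplus>\<^bsub>row_module\<^esub> y) z = linner row_module x z \<oplus>\<^bsub>A\<^esub> linner row_module y z"
      using s by (simp add: R_arith) (intro inv_\<alpha>_eqI; simp add: R_arith A_rules distrib_right flip: distrib_right)
  next
    fix x y c assume "x \<in> carrier row_module" "y \<in> carrier row_module"
    then obtain x' y' where s: "x' \<in> R" "x = k x'" "y' \<in> R" "y = k y'" by auto
    show "linner row_module (c \<odot>\<^bsub>row_module\<^esub> x) y = c \<odot>\<^bsub>A\<^esub> linner row_module x y"
      using s by (simp add: R_arith) (intro inv_\<alpha>_eqI; simp add: R_arith A_rules scaleC_mult_left Ad)
    show "star A (linner row_module x y) = linner row_module y x"
      using s by (simp add: R_arith) (intro inv_\<alpha>_eqI[symmetric]; simp add: R_arith A_rules adj_mult)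
  next
    fix a x y assume a: "a \<in> carrier A" and "x \<in> carrier row_module" "y \<in> carrier row_module"
    then obtain x' y' where s: "x' \<in> R" "x = k x'" "y' \<in> R" "y = k y'" by auto
    show "linner row_module (lact row_module a x) y = a \<otimes>\<^bsub>A\<^esub> linner row_module x y"
      using s a by (simp add: R_arith) (intro inv_\<alpha>_eqI; simp add: R_arith A_rules mult.assoc Ad)
  qed (auto simp: R_arith A_rules scaleC_mult_left scaleC_mult_right distrib_left distrib_right mult.assoc
      positive_linner)
qed

lemma right_hilbert_module_M: "right_hilbert_module B row_module"
proof (rule right_hilbert_module.intro)
  show "cstar_algebra B" by unfold_locales
  show "module complex_ring row_module" by (rule module_M)
  show "right_hilbert_module_axioms B row_module"
  proof
    fix z assume "z \<in> carrier row_module" "rinner row_module z z = \<zero>\<^bsub>B\<^esub>"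
    then obtain x where x: "x \<in> R" "z = k x" "inv_into (carrier B) \<beta> (adj x * x) = \<zero>\<^bsub>B\<^esub>" by auto
    then have "adj x * x = 0" using B.emb_inv[OF in_B[of x x]] by (simp add: B.emb_zero)
    then have "x = 0" by (simp add: adj_mult_self_eq_0)
    then show "z = \<zero>\<^bsub>row_module\<^esub>" using x by simp
  next
    show "norm_complete row_module (\<lambda>x. sqrt (cnorm B (rinner row_module x x)))"
      by (rule norm_complete_M) (rule norm_rinner)
  next
    fix H assume H: "closed_subspace B H"
      and r: "\<And>x y. \<lbrakk>x \<in> carrier row_module; y \<in> carrier row_module\<rbrakk> \<Longrightarrow> rinner row_module x y \<in> H"
    show "H = carrier B"
    proof (rule right_fullness[OF H])
      fix x y assume "x \<in> R" "y \<in> R"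
      then show "inv_into (carrier B) \<beta> (adj x * y) \<in> H" using r[of "k x" "k y"] by simp
    qed
  next
    fix x y z assume "x \<in> carrier row_module" "y \<in> carrier row_module" "z \<in> carrier row_module"
    then obtain x' y' z' where s: "x' \<in> R" "x = k x'" "y' \<in> R" "y = k y'" "z' \<in> R" "z = k z'" by auto
    show "rinner row_module z (x \<oplus>\<^bsub>row_module\<^esub> y) = rinner row_module z x \<oplus>\<^bsub>B\<^esub> rinner row_module z y"
      using s by (simp add: R_arith) (intro inv_\<beta>_eqI; simp add: R_arith B_rules flip: distrib_left)
  next
    fix x y c assume "x \<in> carrier row_module" "y \<in> carrier row_module"
    then obtain x' y' where s: "x' \<in> R" "x = k x'" "y' \<in> R" "y = k y'" by auto
    show "rinner row_module x (c \<odot>\<^bsub>row_module\<^esub> y) = c \<odot>\<^bsub>B\<^esub> rinner row_module x y"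
      using s by (simp add: R_arith) (intro inv_\<beta>_eqI; simp add: R_arith B_rules scaleC_mult_right Kd)
    show "star B (rinner row_module x y) = rinner row_module y x"
      using s by (simp add: R_arith) (intro inv_\<beta>_eqI[symmetric]; simp add: R_arith B_rules adj_mult)
  next
    fix b x y assume b: "b \<in> carrier B" and "x \<in> carrier row_module" "y \<in> carrier row_module"
    then obtain x' y' where s: "x' \<in> R" "x = k x'" "y' \<in> R" "y = k y'" by auto
    show "rinner row_module x (ract row_module y b) = rinner row_module x y \<otimes>\<^bsub>B\<^esub> b"
      using s b by (simp add: R_arith) (intro inv_\<beta>_eqI; simp add: R_arith B_rules mult.assoc Kd RD)
  qed (auto simp: R_arith B_rules scaleC_mult_left scaleC_mult_right distrib_left distrib_right mult.assoc
      positive_rinner)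
qed

lemma imprimitivity_bimodule_M: "imprimitivity_bimodule A B row_module"
proof (rule imprimitivity_bimodule.intro[OF left_hilbert_module_M right_hilbert_module_M])
  show "imprimitivity_bimodule_axioms A B row_module"
  proof
    fix a x b assume "a \<in> carrier A" "x \<in> carrier row_module" "b \<in> carrier B"
    then show "lact row_module a (ract row_module x b) = ract row_module (lact row_module a x) b"
      by (auto simp: R_arith mult.assoc)
  next
    fix a x y assume "a \<in> carrier A" "x \<in> carrier row_module" "y \<in> carrier row_module"
    moreover have "adj (\<alpha> a) * s \<in> R" if "s \<in> R" for s
      using R_arith(6)[of "star A a" s] that \<open>a \<in> carrier A\<close> by (simp add: A.emb_star A.star_closed)
    ultimately show "rinner row_module (lact row_module a x) y = rinner row_module x (lact row_module (star A a) y)"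
      by (auto simp: R_arith A_rules adj_mult mult.assoc)
  next
    fix b x y assume "b \<in> carrier B" "x \<in> carrier row_module" "y \<in> carrier row_module"
    moreover have "s * adj (\<beta> b) \<in> R" if "s \<in> R" for s
      using R_arith(7)[of "star B b" s] that \<open>b \<in> carrier B\<close> by (simp add: B.emb_star B.star_closed)
    ultimately show "linner row_module (ract row_module x b) y = linner row_module x (ract row_module y (star B b))"
      by (auto simp: R_arith B_rules adj_mult mult.assoc)
  next
    fix x y z assume "x \<in> carrier row_module" "y \<in> carrier row_module" "z \<in> carrier row_module"
    then show "lact row_module (linner row_module x y) z = ract row_module x (rinner row_module y z)"
      by (auto simp: R_arith in_A in_B mult.assoc)
  qed
qed

lemma morita: "morita_equivalent A B"
  unfolding morita_equivalent_def using imprimitivity_bimodule_M by blast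

end

section \<open>Cuntz-Krieger families and in-splittings\<close>

text \<open>Takes the place of an approximate unit. Each generator is itself a product: a projection
  is its own square, and a partial isometry S e is the product of its range projection with S e. As
  H need not be closed under adjoints, the subalgebra used is formed by those elements of H whose
  adjoints lie in H too.\<close>

lemma graph_algebra_products:
  assumes GA: "graph_algebra G A P S" and H: "closed_subspace A H"
    and prods: "\<And>x y. x \<in> carrier A \<Longrightarrow> y \<in> carrier A \<Longrightarrow> x \<otimes>\<^bsub>A\<^esub> y \<in> H"
  shows "H = carrier A"
proof -
  have "cstar_algebra A" using GA by (simp add: graph_algebra_def)
  then interpret A: isometric_embedding A "cembed A" by (rule isometric_embedding_cembed)
  have Hc: "H \<subseteq> carrier A" and H0: "\<zero>\<^bsub>A\<^esub> \<in> H"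
    and Hadd: "\<And>x y. x \<in> H \<Longrightarrow> y \<in> H \<Longrightarrow> x \<oplus>\<^bsub>A\<^esub> y \<in> H"
    and Hsm: "\<And>c x. x \<in> H \<Longrightarrow> c \<odot>\<^bsub>A\<^esub> x \<in> H"
    and Hcl: "\<And>X L. L \<in> carrier A \<Longrightarrow> (\<forall>n. X n \<in> H) \<and> norm_converges A (cnorm A) X L \<Longrightarrow> L \<in> H"
    using H unfolding closed_subspace_def by blast+
  define H' where "H' = {x \<in> H. star A x \<in> H}"
  have H'D: "x \<in> H' \<Longrightarrow> x \<in> H" "x \<in> H' \<Longrightarrow> star A x \<in> H" "x \<in> H' \<Longrightarrow> x \<in> carrier A" for x
    using Hc by (auto simp: H'_def)
  have prod_in: "x \<otimes>\<^bsub>A\<^esub> y \<in> H'" if "x \<in> carrier A" "y \<in> carrier A" for x y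
    using that prods[of x y] prods[of "star A y" "star A x"]
    by (simp add: H'_def A.star_mult A.star_closed)
  have "cstar_subalgebra A H'"
    unfolding cstar_subalgebra_def closed_subspace_def
  proof (intro conjI ballI allI impI)
    show "H' \<subseteq> carrier A" using H'D(3) by blast
    show "\<zero>\<^bsub>A\<^esub> \<in> H'" using H0 by (simp add: H'_def)
    fix X L assume L: "L \<in> carrier A" and X: "(\<forall>n. X n \<in> H') \<and> norm_converges A (cnorm A) X L"
    then have Xc: "X n \<in> H" "star A (X n) \<in> H" "X n \<in> carrier A" for n using H'D by auto
    have "(\<lambda>n. cembed A (X n)) \<longlonglongrightarrow> cembed A L"
      using X A.norm_converges_iff[of X L] Xc L by simp
    then have "(\<lambda>n. adj (cembed A (X n))) \<longlonglongrightarrow> adj (cembed A L)"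
      by (rule bounded_linear.tendsto[OF bounded_linear_adj])
    then have "norm_converges A (cnorm A) (\<lambda>n. star A (X n)) (star A L)"
      using A.norm_converges_iff[of "\<lambda>n. star A (X n)" "star A L"] Xc(3) L
      by (simp add: A.star_closed A.emb_star)
    then have "star A L \<in> H"
      using Xc(2) by (intro Hcl[of _ "\<lambda>n. star A (X n)"]) (simp_all add: A.star_closed L)
    moreover have "L \<in> H" using Hcl[OF L, of X] X Xc(1) by simp
    ultimately show "L \<in> H'" by (simp add: H'_def)
  next
    fix x y assume xy: "x \<in> H'" "y \<in> H'"
    show "x \<oplus>\<^bsub>A\<^esub> y \<in> H'" using H'D[OF xy(1)] H'D[OF xy(2)] by (simp add: H'_def A.star_add Hadd)
    show "x \<otimes>\<^bsub>A\<^esub> y \<in> H'" using H'D(3) xy by (intro prod_in) blast+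
  next
    fix c x assume x: "x \<in> H'"
    show "c \<odot>\<^bsub>A\<^esub> x \<in> H'" using H'D[OF x] by (simp add: H'_def A.star_smult Hsm)
    show "star A x \<in> H'" using H'D[OF x] by (simp add: H'_def A.star_star)
  qed
  moreover have "P v \<in> H'" if "v \<in> verts G" for v
  proof -
    have "P v \<in> carrier A" "P v = P v \<otimes>\<^bsub>A\<^esub> P v"
      using GA that by (auto simp: graph_algebra_def ck_family_def projection_def)
    then show ?thesis using prod_in[of "P v" "P v"] by simp
  qed
  moreover have "S e \<in> H'" if "e \<in> arcs G" for e
  proof -
    have "S e \<in> carrier A" "S e \<otimes>\<^bsub>A\<^esub> star A (S e) \<otimes>\<^bsub>A\<^esub> S e = S e"
      using GA that by (auto simp: graph_algebra_def ck_family_def partial_isometry_def)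
    then show ?thesis
      using prod_in[of "S e \<otimes>\<^bsub>A\<^esub> star A (S e)" "S e"] by (simp add: A.mult_closed A.star_closed)
  qed
  moreover have "\<forall>H. cstar_subalgebra A H \<and> P ` verts G \<subseteq> H \<and> S ` arcs G \<subseteq> H \<longrightarrow> H = carrier A"
    using GA unfolding graph_algebra_def by (elim conjE)
  ultimately have "H' = carrier A" by (simp add: image_subset_iff)
  then show ?thesis using Hc H'D(1) by blast
qed

text \<open>Compressing 1 = (1 - q) + q by f i expresses f i as f i plus a sum of positive elements,
  which therefore all vanish. The summand from 1 - q gives the first claim, the one from f j the
  second.\<close>

lemma projections_sum:
  fixes f :: "'i \<Rightarrow> 'm::cstar_unital"
  assumes I: "finite I" and f: "\<And>i. i \<in> I \<Longrightarrow> adj (f i) = f i" "\<And>i. i \<in> I \<Longrightarrow> f i * f i = f i"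
    and q: "q = (\<Sum>i\<in>I. f i)" "q * q = q" and i: "i \<in> I"
  shows "q * f i = f i" and "\<And>j. j \<in> I \<Longrightarrow> j \<noteq> i \<Longrightarrow> f j * f i = 0"
proof -
  have aq: "adj q = q" using f(1) by (simp add: q(1) adj_sum)
  define c where "c = adj ((1 - q) * f i) * ((1 - q) * f i)"
  define g where "g j = adj (f j * f i) * (f j * f i)" for j
  have pc: "pos c" and pg: "pos (g j)" for j by (simp_all only: c_def g_def pos_adj_mult_self)
  have "(1 - q) * (1 - q) = 1 - q" by (simp add: left_diff_distrib right_diff_distrib q(2))
  then have "c = f i * ((1 - q) * f i)"
    by (simp add: c_def adj_mult adj_diff aq f(1)[OF i] mult.assoc) (metis mult.assoc)
  then have c: "c = f i - f i * (q * f i)" using f(2)[OF i] by (simp add: left_diff_distrib right_diff_distrib)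
  have g: "g j = f i * (f j * f i)" if j: "j \<in> I" for j
  proof -
    have "g j = f i * (f j * f j) * f i" by (simp add: g_def adj_mult f(1) i j mult.assoc)
    then show ?thesis using f(2)[OF j] by (simp add: mult.assoc)
  qed
  have "f i * (q * f i) = (\<Sum>j\<in>I. f i * (f j * f i))"
    by (simp add: q(1) sum_distrib_left sum_distrib_right)
  also have "\<dots> = f i * (f i * f i) + (\<Sum>j\<in>I - {i}. f i * (f j * f i))" by (rule sum.remove[OF I i])
  also have "\<dots> = f i + (\<Sum>j\<in>I - {i}. g j)" using f(2)[OF i] g by simp
  finally have s: "c + (\<Sum>j\<in>I - {i}. g j) = 0" using c by simp
  have ps: "pos (\<Sum>j\<in>J. g j)" for J by (rule pos_sum) (rule pg)
  have "c = 0" by (rule pos_add_eq_0[OF pc ps s])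
  then have "(1 - q) * f i = 0" unfolding c_def adj_mult_self_eq_0 .
  then show "q * f i = f i" by (simp add: left_diff_distrib)
  fix j assume j: "j \<in> I" "j \<noteq> i"
  have "(\<Sum>j\<in>I - {i}. g j) = 0" using s \<open>c = 0\<close> by simp
  then have "g j + (\<Sum>k\<in>I - {i} - {j}. g k) = 0" using j I by (subst (asm) sum.remove[of _ j]) auto
  then have "g j = 0" by (rule pos_add_eq_0[OF pg ps])
  then show "f j * f i = 0" unfolding g_def adj_mult_self_eq_0 .
qed

locale ck_system =
  fixes G :: "('v, 'e) pre_digraph" and p :: "'v \<Rightarrow> 'm::cstar_unital" and s :: "'e \<Rightarrow> 'm"
  assumes wf: "wf_digraph G" and fin: "v \<in> verts G \<Longrightarrow> finite (out_arcs G v)"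
    and ck: "ck_relations G p s"
begin

lemmas ck_rules = ck[unfolded ck_relations_def]

lemma adj_p: "v \<in> verts G \<Longrightarrow> adj (p v) = p v"
  and p_idem: "v \<in> verts G \<Longrightarrow> p v * p v = p v"
  using bspec[OF conjunct1[OF ck_rules], of v] by simp_all

lemma p_orth: "v \<in> verts G \<Longrightarrow> w \<in> verts G \<Longrightarrow> v \<noteq> w \<Longrightarrow> p v * p w = 0"
  using conjunct1[OF conjunct2[OF ck_rules]] by simp

lemma s_partial: "e \<in> arcs G \<Longrightarrow> s e * adj (s e) * s e = s e"
  using bspec[OF conjunct1[OF conjunct2[OF conjunct2[OF ck_rules]]], of e] .

lemma adj_s_s: "e \<in> arcs G \<Longrightarrow> adj (s e) * s e = p (head G e)"
  using bspec[OF conjunct1[OF conjunct2[OF conjunct2[OF conjunct2[OF ck_rules]]]], of e] .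

lemma p_sum: "v \<in> tail G ` arcs G \<Longrightarrow> p v = (\<Sum>e\<in>out_arcs G v. s e * adj (s e))"
  using bspec[OF conjunct2[OF conjunct2[OF conjunct2[OF conjunct2[OF ck_rules]]]], of v] .

lemma s_p_head: "e \<in> arcs G \<Longrightarrow> s e * p (head G e) = s e"
  using s_partial[of e] adj_s_s[of e] by (simp add: mult.assoc)

lemma s_p_other:
  assumes "e \<in> arcs G" "w \<in> verts G" "w \<noteq> head G e"
  shows "s e * p w = 0"
proof -
  have "s e * p (head G e) * p w = 0"
    using p_orth[of "head G e" w] assms wf_digraph.head_in_verts[OF wf] by (simp add: mult.assoc)
  then show ?thesis using s_p_head assms(1) by simp
qed

lemma range_projection:
  assumes "e \<in> arcs G"
  shows "adj (s e * adj (s e)) = s e * adj (s e)" "s e * adj (s e) * (s e * adj (s e)) = s e * adj (s e)"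
proof -
  show "adj (s e * adj (s e)) = s e * adj (s e)" by (simp add: adj_mult)
  have "s e * adj (s e) * (s e * adj (s e)) = (s e * adj (s e) * s e) * adj (s e)"
    by (simp only: mult.assoc)
  then show "s e * adj (s e) * (s e * adj (s e)) = s e * adj (s e)" using s_partial assms by simp
qed

lemma p_tail_s:
  assumes e: "e \<in> arcs G"
  shows "p (tail G e) * s e = s e"
proof -
  have v: "tail G e \<in> verts G" by (rule wf_digraph.tail_in_verts[OF wf e])
  have "p (tail G e) * (s e * adj (s e)) = s e * adj (s e)"
  proof (rule projections_sum(1)[where f = "\<lambda>e. s e * adj (s e)" and I = "out_arcs G (tail G e)"])
    show "finite (out_arcs G (tail G e))" by (rule fin[OF v])
    show "p (tail G e) = (\<Sum>e\<in>out_arcs G (tail G e). s e * adj (s e))" using e by (intro p_sum) simp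
  qed (use e range_projection p_idem[OF v] in auto)
  then have "p (tail G e) * (s e * adj (s e)) * s e = s e * adj (s e) * s e" by simp
  then show ?thesis using s_partial[OF e] by (simp add: mult.assoc)
qed

lemma p_other_s:
  assumes "e \<in> arcs G" "w \<in> verts G" "w \<noteq> tail G e"
  shows "p w * s e = 0"
proof -
  have "p w * p (tail G e) * s e = 0"
    using p_orth[of w "tail G e"] assms wf_digraph.tail_in_verts[OF wf] by simp
  then show ?thesis using p_tail_s[OF assms(1)] by (simp add: mult.assoc)
qed

lemma adj_s_s_orth:
  assumes e: "e \<in> arcs G" and f: "f \<in> arcs G" and "tail G e = tail G f" "e \<noteq> f"
  shows "adj (s e) * s f = 0"
proof -
  have v: "tail G f \<in> verts G" by (rule wf_digraph.tail_in_verts[OF wf f])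
  have "(s e * adj (s e)) * (s f * adj (s f)) = 0"
  proof (rule projections_sum(2)[where f = "\<lambda>e. s e * adj (s e)" and I = "out_arcs G (tail G f)"])
    show "finite (out_arcs G (tail G f))" by (rule fin[OF v])
    show "p (tail G f) = (\<Sum>e\<in>out_arcs G (tail G f). s e * adj (s e))" using f by (intro p_sum) simp
  qed (use assms range_projection p_idem[OF v] in auto)
  then have "adj (s e) * ((s e * adj (s e)) * (s f * adj (s f))) * s f = 0" by simp
  moreover have "adj (s e) * (s e * adj (s e)) = adj (s e)"
  proof -
    have "adj (s e * adj (s e) * s e) = adj (s e)" using s_partial[OF e] by simp
    then show ?thesis by (simp add: adj_mult mult.assoc)
  qed
  moreover have "adj (s e) * ((s e * adj (s e)) * (s f * adj (s f))) * s f
    = (adj (s e) * (s e * adj (s e))) * ((s f * adj (s f)) * s f)"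
    by (simp only: mult.assoc)
  ultimately show ?thesis using s_partial[OF f] by simp
qed

end

section \<open>In-splittings and their Cuntz-Krieger families\<close>

text \<open>
  \<open>F\<close> is an in-splitting of \<open>E\<close>: the maps \<open>\<sigma>\<close> and \<open>\<epsilon>\<close> form a graph morphism \<open>F \<rightarrow> E\<close> which
  restricts to bijections between the edges leaving \<open>w\<close> and those leaving \<open>\<sigma> w\<close>.  It is injective on
  vertices except that \<open>\<sigma> w1 = \<sigma> w2\<close>.
\<close>

locale in_splitting =
  fixes E :: "('v, 'e) pre_digraph" and F :: "('w, 'f) pre_digraph"
    and \<sigma> :: "'w \<Rightarrow> 'v" and \<epsilon> :: "'f \<Rightarrow> 'e" and w1 w2 :: 'w
  assumes wf_E: "wf_digraph E" and wf_F: "wf_digraph F"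
    and tails: "v \<in> verts E \<Longrightarrow> v \<in> tail E ` arcs E"
    and fin_E: "v \<in> verts E \<Longrightarrow> finite (out_arcs E v)"
    and \<sigma>_verts: "w \<in> verts F \<Longrightarrow> \<sigma> w \<in> verts E"
    and \<sigma>_surj: "v \<in> verts E \<Longrightarrow> \<exists>w\<in>verts F. w \<noteq> w2 \<and> \<sigma> w = v"
    and w12: "w1 \<in> verts F" "w2 \<in> verts F" "w1 \<noteq> w2" "\<sigma> w1 = \<sigma> w2"
    and \<sigma>_inj: "\<lbrakk>w \<in> verts F; w' \<in> verts F; w \<noteq> w2; w' \<noteq> w2; \<sigma> w = \<sigma> w'\<rbrakk> \<Longrightarrow> w = w'"
    and \<epsilon>_arcs: "f \<in> arcs F \<Longrightarrow> \<epsilon> f \<in> arcs E"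
    and \<epsilon>_tail: "f \<in> arcs F \<Longrightarrow> tail E (\<epsilon> f) = \<sigma> (tail F f)"
    and \<epsilon>_head: "f \<in> arcs F \<Longrightarrow> head E (\<epsilon> f) = \<sigma> (head F f)"
    and lift: "\<lbrakk>e \<in> arcs E; w \<in> verts F; \<sigma> w = tail E e\<rbrakk> \<Longrightarrow> \<exists>f\<in>arcs F. tail F f = w \<and> \<epsilon> f = e"
    and lift_unique: "\<lbrakk>f \<in> arcs F; g \<in> arcs F; tail F f = tail F g; \<epsilon> f = \<epsilon> g\<rbrakk> \<Longrightarrow> f = g"
    and head_unique: "\<lbrakk>f \<in> arcs F; g \<in> arcs F; \<epsilon> f = \<epsilon> g\<rbrakk> \<Longrightarrow> head F f = head F g"
begin

lemma bij_\<epsilon>: "w \<in> verts F \<Longrightarrow> bij_betw \<epsilon> (out_arcs F w) (out_arcs E (\<sigma> w))"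
  unfolding bij_betw_def
proof
  assume w: "w \<in> verts F"
  show "inj_on \<epsilon> (out_arcs F w)" by (rule inj_onI) (auto intro: lift_unique)
  show "\<epsilon> ` out_arcs F w = out_arcs E (\<sigma> w)"
  proof
    show "\<epsilon> ` out_arcs F w \<subseteq> out_arcs E (\<sigma> w)" using \<epsilon>_arcs \<epsilon>_tail by auto
    show "out_arcs E (\<sigma> w) \<subseteq> \<epsilon> ` out_arcs F w"
    proof
      fix e assume "e \<in> out_arcs E (\<sigma> w)"
      then obtain f where "f \<in> arcs F" "tail F f = w" "\<epsilon> f = e" using lift[of e w] w by auto
      then show "e \<in> \<epsilon> ` out_arcs F w" by auto
    qed
  qed
qed

lemma fin_F: "w \<in> verts F \<Longrightarrow> finite (out_arcs F w)"
  using bij_betw_finite[OF bij_\<epsilon>] fin_E \<sigma>_verts by blast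

lemma tails_F: "w \<in> verts F \<Longrightarrow> w \<in> tail F ` arcs F"
proof -
  assume w: "w \<in> verts F"
  obtain e where "e \<in> arcs E" "\<sigma> w = tail E e" using tails[OF \<sigma>_verts[OF w]] by blast
  then show ?thesis using lift[of e w] w by auto
qed

lemma verts_F: "f \<in> arcs F \<Longrightarrow> tail F f \<in> verts F" "f \<in> arcs F \<Longrightarrow> head F f \<in> verts F"
  using wf_digraph.tail_in_verts[OF wf_F] wf_digraph.head_in_verts[OF wf_F] by auto

lemma verts_E: "e \<in> arcs E \<Longrightarrow> tail E e \<in> verts E" "e \<in> arcs E \<Longrightarrow> head E e \<in> verts E"
  using wf_digraph.tail_in_verts[OF wf_E] wf_digraph.head_in_verts[OF wf_E] by auto

text \<open>The only distinct vertices identified by \<sigma> are w1 and w2, and these occupy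
  different diagonal places, so orthogonality survives. The row of an edge depends only on its tail
  and the column only on its head, as the relations of an edge with its two ends require.\<close>

lemma matrix_family:
  assumes ck: "ck_relations E p s"
  shows "ck_relations F (\<lambda>w. mat_unit (w = w2) (w = w2) (p (\<sigma> w)))
    (\<lambda>f. mat_unit (tail F f = w2) (head F f = w2) (s (\<epsilon> f)))"
proof -
  interpret E: ck_system E p s by (rule ck_system.intro[OF wf_E fin_E ck])
  show ?thesis
    unfolding ck_relations_def
  proof (intro conjI ballI impI)
    fix w assume w: "w \<in> verts F"
    note v = \<sigma>_verts[OF w]
    show "adj (mat_unit (w = w2) (w = w2) (p (\<sigma> w))) = mat_unit (w = w2) (w = w2) (p (\<sigma> w))"
      by (simp add: adj_mat_unit E.adj_p[OF v])
    show "mat_unit (w = w2) (w = w2) (p (\<sigma> w)) * mat_unit (w = w2) (w = w2) (p (\<sigma> w))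
      = mat_unit (w = w2) (w = w2) (p (\<sigma> w))"
      by (simp add: mat_unit_mult E.p_idem[OF v])
    fix w' assume w': "w' \<in> verts F" "w \<noteq> w'"
    show "mat_unit (w = w2) (w = w2) (p (\<sigma> w)) * mat_unit (w' = w2) (w' = w2) (p (\<sigma> w')) = 0"
    proof (cases "(w = w2) = (w' = w2)")
      case True
      then have "\<sigma> w \<noteq> \<sigma> w'" using \<sigma>_inj[of w w'] w w' by blast
      then have "p (\<sigma> w) * p (\<sigma> w') = 0" using v \<sigma>_verts[OF w'(1)] by (intro E.p_orth)
      then show ?thesis by (simp add: mat_unit_mult mat_unit_zero)
    qed (simp add: mat_unit_mult)
  next
    fix f assume f: "f \<in> arcs F"
    note e = \<epsilon>_arcs[OF f]
    let ?t = "mat_unit (tail F f = w2) (head F f = w2) (s (\<epsilon> f))"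
    show "?t * adj ?t * ?t = ?t" by (simp add: adj_mat_unit mat_unit_mult E.s_partial[OF e])
    show "adj ?t * ?t = mat_unit (head F f = w2) (head F f = w2) (p (\<sigma> (head F f)))"
      by (simp add: adj_mat_unit mat_unit_mult E.adj_s_s[OF e] \<epsilon>_head[OF f])
  next
    fix w assume "w \<in> tail F ` arcs F"
    then have w: "w \<in> verts F" using verts_F by blast
    have "p (\<sigma> w) = (\<Sum>e\<in>out_arcs E (\<sigma> w). s e * adj (s e))"
      by (rule E.p_sum[OF tails[OF \<sigma>_verts[OF w]]])
    also have "\<dots> = (\<Sum>f\<in>out_arcs F w. s (\<epsilon> f) * adj (s (\<epsilon> f)))"
      by (rule sum.reindex_bij_betw[OF bij_\<epsilon>[OF w], symmetric])
    finally have "mat_unit (w = w2) (w = w2) (p (\<sigma> w))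
      = (\<Sum>f\<in>out_arcs F w. mat_unit (w = w2) (w = w2) (s (\<epsilon> f) * adj (s (\<epsilon> f))))"
      by (simp add: mat_unit_sum)
    also have "\<dots> = (\<Sum>f\<in>out_arcs F w. mat_unit (tail F f = w2) (head F f = w2) (s (\<epsilon> f)) *
        adj (mat_unit (tail F f = w2) (head F f = w2) (s (\<epsilon> f))))"
      by (rule sum.cong) (auto simp: adj_mat_unit mat_unit_mult)
    finally show "mat_unit (w = w2) (w = w2) (p (\<sigma> w))
      = (\<Sum>f\<in>out_arcs F w. mat_unit (tail F f = w2) (head F f = w2) (s (\<epsilon> f)) *
        adj (mat_unit (tail F f = w2) (head F f = w2) (s (\<epsilon> f))))" .
  qed
qed

text \<open>A section of \<sigma> avoiding w2; over \<sigma> w2 it takes the value w1.\<close>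

definition \<tau> :: "'v \<Rightarrow> 'w" where
  "\<tau> v = (SOME w. w \<in> verts F \<and> w \<noteq> w2 \<and> \<sigma> w = v)"

text \<open>The lift of e that starts at the chosen vertex. It may still end at w2, which is why its
  partial isometry has to be corrected in \<open>s'\<close>.\<close>

definition \<eta> :: "'e \<Rightarrow> 'f" where
  "\<eta> e = (SOME f. f \<in> arcs F \<and> tail F f = \<tau> (tail E e) \<and> \<epsilon> f = e)"

lemma \<tau>: "v \<in> verts E \<Longrightarrow> \<tau> v \<in> verts F \<and> \<tau> v \<noteq> w2 \<and> \<sigma> (\<tau> v) = v"
proof -
  assume "v \<in> verts E"
  then have "\<exists>w. w \<in> verts F \<and> w \<noteq> w2 \<and> \<sigma> w = v" using \<sigma>_surj[of v] by blast
  then show ?thesis unfolding \<tau>_def by (rule someI_ex)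
qed

lemma \<tau>_\<sigma>: "w \<in> verts F \<Longrightarrow> w \<noteq> w2 \<Longrightarrow> \<tau> (\<sigma> w) = w"
  using \<tau>[of "\<sigma> w"] \<sigma>_verts[of w] \<sigma>_inj[of "\<tau> (\<sigma> w)" w] by blast

lemma \<tau>_w2: "\<tau> (\<sigma> w2) = w1"
  using \<tau>_\<sigma>[OF w12(1,3)] w12(4) by simp

lemma \<eta>: "e \<in> arcs E \<Longrightarrow> \<eta> e \<in> arcs F \<and> tail F (\<eta> e) = \<tau> (tail E e) \<and> \<epsilon> (\<eta> e) = e"
proof -
  assume e: "e \<in> arcs E"
  then have "\<exists>f. f \<in> arcs F \<and> tail F f = \<tau> (tail E e) \<and> \<epsilon> f = e"
    using lift[OF e, of "\<tau> (tail E e)"] \<tau>[OF verts_E(1)[OF e]] by blast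
  then show ?thesis unfolding \<eta>_def by (rule someI_ex)
qed

lemma \<eta>_\<epsilon>: "f \<in> arcs F \<Longrightarrow> tail F f \<noteq> w2 \<Longrightarrow> \<eta> (\<epsilon> f) = f"
  using \<eta>[of "\<epsilon> f"] \<epsilon>_arcs[of f] \<epsilon>_tail[of f] \<tau>_\<sigma>[of "tail F f"] verts_F[of f]
  by (intro lift_unique) auto

lemma head_\<eta>_\<epsilon>: "f \<in> arcs F \<Longrightarrow> head F (\<eta> (\<epsilon> f)) = head F f"
  using \<eta>[of "\<epsilon> f"] \<epsilon>_arcs[of f] by (intro head_unique) auto

lemma \<eta>_\<epsilon>_w2: "f \<in> out_arcs F w2 \<Longrightarrow> \<eta> (\<epsilon> f) \<in> out_arcs F w1"
  using \<eta>[of "\<epsilon> f"] \<epsilon>_arcs[of f] \<epsilon>_tail[of f] \<tau>_w2 by auto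

lemma bij_\<eta>: "v \<in> verts E \<Longrightarrow> bij_betw \<eta> (out_arcs E v) (out_arcs F (\<tau> v))"
proof (rule bij_betw_byWitness[where f' = \<epsilon>])
  assume v: "v \<in> verts E"
  show "\<forall>e\<in>out_arcs E v. \<epsilon> (\<eta> e) = e" using \<eta> by auto
  show "\<forall>f\<in>out_arcs F (\<tau> v). \<eta> (\<epsilon> f) = f" using \<eta>_\<epsilon> \<tau>[OF v] by auto
  show "\<eta> ` out_arcs E v \<subseteq> out_arcs F (\<tau> v)" using \<eta> by auto
  show "\<epsilon> ` out_arcs F (\<tau> v) \<subseteq> out_arcs E v" using \<epsilon>_arcs \<epsilon>_tail \<tau>[OF v] by auto
qed

lemma bij_\<eta>_\<epsilon>: "bij_betw (\<lambda>f. \<eta> (\<epsilon> f)) (out_arcs F w2) (out_arcs F w1)"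
  using bij_betw_trans[OF bij_\<epsilon>[OF w12(2)] bij_\<eta>[OF \<sigma>_verts[OF w12(2)]]]
  by (simp add: \<tau>_w2 comp_def)

end

locale split_family = in_splitting E F \<sigma> \<epsilon> w1 w2 + ck_system F q t
  for E :: "('v, 'e) pre_digraph" and F :: "('w, 'f) pre_digraph" and \<sigma> \<epsilon> w1 w2
    and q :: "'w \<Rightarrow> 'm::cstar_unital" and t :: "'f \<Rightarrow> 'm"
begin

text \<open>A partial isometry with initial projection \<open>q w1\<close> and final projection \<open>q w2\<close>.\<close>

definition U :: 'm where
  "U = (\<Sum>f\<in>out_arcs F w2. t f * adj (t (\<eta> (\<epsilon> f))))"

text \<open>Multiplication by U moves the initial projection of an edge ending at w2 from q w2 to q
  w1, the one retained for \<sigma> w2.\<close>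

definition s' :: "'e \<Rightarrow> 'm" where
  "s' e = t (\<eta> e) * (if head F (\<eta> e) = w2 then U else 1)"

lemma adj_U: "adj U = (\<Sum>f\<in>out_arcs F w2. t (\<eta> (\<epsilon> f)) * adj (t f))"
  by (simp add: U_def adj_sum adj_mult)

text \<open>Distinct edges leaving w2 have orthogonal ranges, so a single term survives. In it,
  \<open>head_\<eta>_\<epsilon>\<close> ensures that the two copies of the edge have the same
  initial projection.\<close>

lemma adj_U_t:
  assumes g: "g \<in> out_arcs F w2"
  shows "adj U * t g = t (\<eta> (\<epsilon> g))"
proof -
  have "adj U * t g = (\<Sum>f\<in>out_arcs F w2. t (\<eta> (\<epsilon> f)) * (adj (t f) * t g))"
    by (simp add: adj_U sum_distrib_right mult.assoc)
  also have "\<dots> = (\<Sum>f\<in>out_arcs F w2. if f = g then t (\<eta> (\<epsilon> g)) else 0)"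
  proof (rule sum.cong)
    fix f assume f: "f \<in> out_arcs F w2"
    show "t (\<eta> (\<epsilon> f)) * (adj (t f) * t g) = (if f = g then t (\<eta> (\<epsilon> g)) else 0)"
    proof (cases "f = g")
      case True
      have "t (\<eta> (\<epsilon> g)) * p' = t (\<eta> (\<epsilon> g))" if "p' = q (head F g)" for p'
        using s_p_head[of "\<eta> (\<epsilon> g)"] \<eta>_\<epsilon>_w2[OF g] head_\<eta>_\<epsilon>[of g] g that by simp
      then show ?thesis using True adj_s_s[of g] g by simp
    next
      case False
      then have "adj (t f) * t g = 0" using f g by (intro adj_s_s_orth) auto
      then show ?thesis using False by simp
    qed
  qed simp
  also have "\<dots> = t (\<eta> (\<epsilon> g))" using fin_F[OF w12(2)] g by simp
  finally show ?thesis .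
qed

lemma U_adj_U: "U * adj U = q w2"
proof -
  have "U * adj U = (\<Sum>f\<in>out_arcs F w2. U * (t (\<eta> (\<epsilon> f)) * adj (t f)))"
    by (simp add: adj_U sum_distrib_left)
  also have "\<dots> = (\<Sum>f\<in>out_arcs F w2. t f * adj (t f))"
  proof (rule sum.cong)
    fix f assume f: "f \<in> out_arcs F w2"
    have "U * t (\<eta> (\<epsilon> f)) = (\<Sum>g\<in>out_arcs F w2. t g * (adj (t (\<eta> (\<epsilon> g))) * t (\<eta> (\<epsilon> f))))"
      by (simp add: U_def sum_distrib_right mult.assoc)
    also have "\<dots> = (\<Sum>g\<in>out_arcs F w2. if g = f then t f else 0)"
    proof (rule sum.cong)
      fix g assume g: "g \<in> out_arcs F w2"
      show "t g * (adj (t (\<eta> (\<epsilon> g))) * t (\<eta> (\<epsilon> f))) = (if g = f then t f else 0)"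
      proof (cases "g = f")
        case True
        have "t f * q (head F f) = t f" using s_p_head[of f] f by simp
        then show ?thesis
          using True adj_s_s[of "\<eta> (\<epsilon> f)"] \<eta>_\<epsilon>_w2[OF f] head_\<eta>_\<epsilon>[of f] f by simp
      next
        case False
        then have "\<eta> (\<epsilon> g) \<noteq> \<eta> (\<epsilon> f)"
          using bij_betw_imp_inj_on[OF bij_\<eta>_\<epsilon>] f g by (auto dest: inj_onD)
        then have "adj (t (\<eta> (\<epsilon> g))) * t (\<eta> (\<epsilon> f)) = 0"
          using \<eta>_\<epsilon>_w2[OF f] \<eta>_\<epsilon>_w2[OF g] by (intro adj_s_s_orth) auto
        then show ?thesis using False by simp
      qed
    qed simp
    also have "\<dots> = t f" using fin_F[OF w12(2)] f by simp
    finally show "U * (t (\<eta> (\<epsilon> f)) * adj (t f)) = t f * adj (t f)" by (simp flip: mult.assoc)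
  qed simp
  also have "\<dots> = q w2" by (rule p_sum[OF tails_F[OF w12(2)], symmetric])
  finally show ?thesis .
qed

lemma adj_U_U: "adj U * U = q w1"
proof -
  have "adj U * U = (\<Sum>f\<in>out_arcs F w2. (adj U * t f) * adj (t (\<eta> (\<epsilon> f))))"
    by (subst (2) U_def) (simp add: sum_distrib_left mult.assoc)
  also have "\<dots> = (\<Sum>f\<in>out_arcs F w2. t (\<eta> (\<epsilon> f)) * adj (t (\<eta> (\<epsilon> f))))"
    by (rule sum.cong) (simp_all add: adj_U_t)
  also have "\<dots> = (\<Sum>f\<in>out_arcs F w1. t f * adj (t f))"
    by (rule sum.reindex_bij_betw[OF bij_\<eta>_\<epsilon>])
  also have "\<dots> = q w1" by (rule p_sum[OF tails_F[OF w12(1)], symmetric])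
  finally show ?thesis .
qed

lemma q_U: "w \<in> verts F \<Longrightarrow> q w * U = (if w = w2 then U else 0)"
proof -
  assume w: "w \<in> verts F"
  have "q w * (t f * adj (t (\<eta> (\<epsilon> f)))) = (if w = w2 then t f * adj (t (\<eta> (\<epsilon> f))) else 0)"
    if f: "f \<in> out_arcs F w2" for f
    using f p_tail_s[of f] p_other_s[of f w] w by (simp flip: mult.assoc)
  then have "q w * U = (\<Sum>f\<in>out_arcs F w2. if w = w2 then t f * adj (t (\<eta> (\<epsilon> f))) else 0)"
    unfolding U_def sum_distrib_left by (intro sum.cong) auto
  then show ?thesis by (simp add: U_def)
qed

lemma U_q: "w \<in> verts F \<Longrightarrow> U * q w = (if w = w1 then U else 0)"
proof -
  assume w: "w \<in> verts F"
  have "q w * (t (\<eta> (\<epsilon> f)) * adj (t f)) = (if w = w1 then t (\<eta> (\<epsilon> f)) * adj (t f) else 0)"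
    if f: "f \<in> out_arcs F w2" for f
    using \<eta>_\<epsilon>_w2[OF f] p_tail_s[of "\<eta> (\<epsilon> f)"] p_other_s[of "\<eta> (\<epsilon> f)" w] w by (simp flip: mult.assoc)
  then have "q w * adj U = (\<Sum>f\<in>out_arcs F w2. if w = w1 then t (\<eta> (\<epsilon> f)) * adj (t f) else 0)"
    unfolding adj_U sum_distrib_left by (intro sum.cong) auto
  then have "q w * adj U = (if w = w1 then adj U else 0)" by (simp add: adj_U)
  then have "adj (q w * adj U) = (if w = w1 then U else 0)" by simp
  then show ?thesis by (simp add: adj_mult adj_p[OF w])
qed

lemma adj_s'_s': "e \<in> arcs E \<Longrightarrow> adj (s' e) * s' e = q (\<tau> (head E e))"
proof -
  assume e: "e \<in> arcs E"
  note h = \<eta>[OF e]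
  have he: "head E e = \<sigma> (head F (\<eta> e))" using \<epsilon>_head[of "\<eta> e"] h by simp
  show ?thesis
  proof (cases "head F (\<eta> e) = w2")
    case True
    have "adj (s' e) * s' e = adj U * (adj (t (\<eta> e)) * t (\<eta> e)) * U"
      using True by (simp add: s'_def adj_mult mult.assoc)
    also have "\<dots> = adj U * (q w2 * U)" using adj_s_s[of "\<eta> e"] h True by (simp add: mult.assoc)
    also have "\<dots> = q w1" using q_U[OF w12(2)] adj_U_U by simp
    finally show ?thesis using he True \<tau>_w2 by simp
  next
    case False
    then have "adj (s' e) * s' e = q (head F (\<eta> e))" using adj_s_s[of "\<eta> e"] h by (simp add: s'_def)
    then show ?thesis using he \<tau>_\<sigma>[OF verts_F(2) False] h by simp
  qed
qed

lemma s'_q: "e \<in> arcs E \<Longrightarrow> s' e * q (\<tau> (head E e)) = s' e"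
proof -
  assume e: "e \<in> arcs E"
  note h = \<eta>[OF e]
  have he: "head E e = \<sigma> (head F (\<eta> e))" using \<epsilon>_head[of "\<eta> e"] h by simp
  show ?thesis
  proof (cases "head F (\<eta> e) = w2")
    case True
    then show ?thesis using he \<tau>_w2 U_q[OF w12(1)] by (simp add: s'_def mult.assoc)
  next
    case False
    then show ?thesis using he \<tau>_\<sigma>[OF verts_F(2) False] h s_p_head[of "\<eta> e"] by (simp add: s'_def)
  qed
qed

text \<open>Redirecting leaves the range projections unchanged, because U * \<open>adj U\<close> = q
  w2 is absorbed by t (\<eta> e). Hence the sum relation at v is that of F at \<tau> v.\<close>

lemma s'_adj_s': "e \<in> arcs E \<Longrightarrow> s' e * adj (s' e) = t (\<eta> e) * adj (t (\<eta> e))"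
proof (cases "head F (\<eta> e) = w2")
  case True
  assume e: "e \<in> arcs E"
  have "s' e * adj (s' e) = t (\<eta> e) * (U * adj U) * adj (t (\<eta> e))"
    using True by (simp add: s'_def adj_mult mult.assoc)
  also have "\<dots> = t (\<eta> e) * adj (t (\<eta> e))"
    using s_p_head[of "\<eta> e"] \<eta>[OF e] True by (simp add: U_adj_U)
  finally show ?thesis .
qed (simp add: s'_def)

lemma reduced_family: "ck_relations E (\<lambda>v. q (\<tau> v)) s'"
  unfolding ck_relations_def
proof (intro conjI ballI impI)
  fix v assume v: "v \<in> verts E"
  show "adj (q (\<tau> v)) = q (\<tau> v)" "q (\<tau> v) * q (\<tau> v) = q (\<tau> v)" using \<tau>[OF v] adj_p p_idem by auto
  fix w assume w: "w \<in> verts E" "v \<noteq> w"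
  then have "\<tau> v \<noteq> \<tau> w" using \<tau>[OF v] \<tau>[OF w(1)] by metis
  then show "q (\<tau> v) * q (\<tau> w) = 0" using \<tau>[OF v] \<tau>[OF w(1)] by (intro p_orth) auto
next
  fix e assume e: "e \<in> arcs E"
  show "adj (s' e) * s' e = q (\<tau> (head E e))" by (rule adj_s'_s'[OF e])
  show "s' e * adj (s' e) * s' e = s' e" using adj_s'_s'[OF e] s'_q[OF e] by (simp add: mult.assoc)
next
  fix v assume "v \<in> tail E ` arcs E"
  then have v: "v \<in> verts E" using verts_E by blast
  have "q (\<tau> v) = (\<Sum>f\<in>out_arcs F (\<tau> v). t f * adj (t f))" using \<tau>[OF v] tails_F by (intro p_sum) auto
  also have "\<dots> = (\<Sum>e\<in>out_arcs E v. t (\<eta> e) * adj (t (\<eta> e)))"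
    by (rule sum.reindex_bij_betw[OF bij_\<eta>[OF v], symmetric])
  also have "\<dots> = (\<Sum>e\<in>out_arcs E v. s' e * adj (s' e))"
    by (rule sum.cong) (auto simp: s'_adj_s')
  finally show "q (\<tau> v) = (\<Sum>e\<in>out_arcs E v. s' e * adj (s' e))" .
qed

end

section \<open>Comparison of the two graph algebras\<close>

lemma graph_algebra_generated:
  assumes GA: "graph_algebra G A P S" and K: "closed_subalgebra K"
    and PS: "\<And>v. v \<in> verts G \<Longrightarrow> cembed A (P v) \<in> K" "\<And>e. e \<in> arcs G \<Longrightarrow> cembed A (S e) \<in> K"
  shows "embedded A \<subseteq> K"
proof -
  have "cstar_algebra A" using GA by (simp add: graph_algebra_def)
  then interpret A: isometric_embedding A "cembed A" by (rule isometric_embedding_cembed)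
  have "\<forall>H. cstar_subalgebra A H \<and> P ` verts G \<subseteq> H \<and> S ` arcs G \<subseteq> H \<longrightarrow> H = carrier A"
    using GA unfolding graph_algebra_def by (elim conjE)
  then have gen: "H = carrier A" if "cstar_subalgebra A H" "P ` verts G \<subseteq> H" "S ` arcs G \<subseteq> H" for H
    using that by simp
  have c: "P ` verts G \<subseteq> carrier A" "S ` arcs G \<subseteq> carrier A"
    using GA by (auto simp: graph_algebra_def ck_family_def projection_def partial_isometry_def)
  show ?thesis unfolding embedded_def by (rule A.emb_generated[OF gen K c PS])
qed

lemma is_star_hom_comp:
  assumes "is_star_hom K h" "is_star_hom L g" "\<And>x. x \<in> K \<Longrightarrow> h x \<in> L"
  shows "is_star_hom K (\<lambda>x. g (h x))"
  using assms unfolding is_star_hom_def by simp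

lemma is_star_hom_sum:
  assumes h: "is_star_hom K h" and K: "closed_subalgebra K" and f: "\<And>i. i \<in> I \<Longrightarrow> f i \<in> K"
  shows "h (\<Sum>i\<in>I. f i) = (\<Sum>i\<in>I. h (f i))"
  using f
proof (induction I rule: infinite_finite_induct)
  case (insert i I)
  have "sum f I \<in> K" using insert.prems by (intro closed_subalgebra_sum[OF K]) auto
  then show ?case using insert by (simp add: is_star_homD[OF h K])
qed (simp_all add: is_star_homD[OF h K])

lemma is_star_hom_mat_unit: "is_star_hom K (mat_unit False False)"
  unfolding is_star_hom_def by (simp add: mat_unit_add mat_unit_scaleC mat_unit_mult adj_mat_unit)

lemma in_splitting_morita_equivalent:
  fixes A :: "'a cstar" and B :: "'b cstar"
  assumes split: "in_splitting E F \<sigma> \<epsilon> w1 w2"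
    and count: "countable (verts E)" "countable (arcs E)" "countable (verts F)" "countable (arcs F)"
    and GA: "graph_algebra E A P S" and GB: "graph_algebra F B Q T"
  shows "morita_equivalent A B"
proof -
  interpret in_splitting E F \<sigma> \<epsilon> w1 w2 by (rule split)
  have "cstar_algebra A" using GA by (simp add: graph_algebra_def)
  then interpret A: isometric_embedding A "cembed A" by (rule isometric_embedding_cembed)
  have "cstar_algebra B" using GB by (simp add: graph_algebra_def)
  then interpret B: isometric_embedding B "cembed B" by (rule isometric_embedding_cembed)
  define p s q t where "p = (\<lambda>v. cembed A (P v))" and "s = (\<lambda>e. cembed A (S e))"
    and "q = (\<lambda>w. cembed B (Q w))" and "t = (\<lambda>f. cembed B (T f))"
  have ckA: "ck_relations E p s" and ckB: "ck_relations F q t"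
    unfolding p_def s_def q_def t_def using GA GB
    by (auto simp: graph_algebra_def intro!: A.emb_ck_family B.emb_ck_family)
  interpret EA: ck_system E p s by (rule ck_system.intro[OF wf_E fin_E ckA])
  interpret FB: ck_system F q t by (rule ck_system.intro[OF wf_F fin_F ckB])
  interpret split_family E F \<sigma> \<epsilon> w1 w2 q t ..

  have KA: "closed_subalgebra (embedded A)" and KB: "closed_subalgebra (embedded B)"
    unfolding embedded_def by (rule A.closed_subalgebra_emb B.closed_subalgebra_emb)+
  note Bd = closed_subalgebraD[OF KB]
  have "ck_family E A P S" "ck_family F B Q T" using GA GB by (simp_all add: graph_algebra_def)
  then have p_in: "v \<in> verts E \<Longrightarrow> p v \<in> embedded A" and s_in: "e \<in> arcs E \<Longrightarrow> s e \<in> embedded A"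
    and q_in: "w \<in> verts F \<Longrightarrow> q w \<in> embedded B" and t_in: "f \<in> arcs F \<Longrightarrow> t f \<in> embedded B" for v e w f
    by (auto simp: ck_family_def projection_def partial_isometry_def embedded_def p_def s_def q_def t_def)
  have ut_in: "t f * adj (t (\<eta> (\<epsilon> f))) \<in> embedded B" if "f \<in> out_arcs F w2" for f
    using that \<eta>_\<epsilon>_w2[OF that] by (auto intro!: Bd t_in)
  have U_in: "U \<in> embedded B" unfolding U_def by (rule closed_subalgebra_sum[OF KB ut_in])
  have s'_in: "s' e \<in> embedded B" if "e \<in> arcs E" for e
    using \<eta>[OF that] U_in by (auto simp: s'_def intro!: Bd t_in)

  obtain \<phi> where \<phi>: "is_star_hom (embedded A) \<phi>" "\<And>v. v \<in> verts E \<Longrightarrow> \<phi> (p v) = q (\<tau> v)"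
    "\<And>e. e \<in> arcs E \<Longrightarrow> \<phi> (s e) = s' e"
    using graph_algebra_universal[OF GA wf_E count(1,2) reduced_family] unfolding p_def s_def by blast
  obtain \<psi> where \<psi>: "is_star_hom (embedded B) \<psi>"
    "\<And>w. w \<in> verts F \<Longrightarrow> \<psi> (q w) = mat_unit (w = w2) (w = w2) (p (\<sigma> w))"
    "\<And>f. f \<in> arcs F \<Longrightarrow> \<psi> (t f) = mat_unit (tail F f = w2) (head F f = w2) (s (\<epsilon> f))"
    using graph_algebra_universal[OF GB wf_F count(3,4) matrix_family[OF ckA]] unfolding q_def t_def by blast
  note \<phi>d = is_star_homD[OF \<phi>(1) KA] and \<psi>d = is_star_homD[OF \<psi>(1) KB]

  \<comment> \<open>Z is the corner complementary to q w2, described without the unit. The universal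
    property does not say where \<phi> takes its values; checking generators against Z shows that
    they lie in \<open>embedded B\<close>, so that \<psi> can be applied, and in the corner.\<close>
  define Z where "Z = {x \<in> embedded B. q w2 * x = 0 \<and> x * q w2 = 0}"
  have aq: "adj (q w2) = q w2" by (rule FB.adj_p[OF w12(2)])
  have Z: "closed_subalgebra Z"
  proof -
    have "closed ((\<lambda>x. q w2 * x) -` {0})" "closed ((\<lambda>x. x * q w2) -` {0})"
      by (intro continuous_closed_vimage; auto intro!: continuous_intros)+
    moreover have "Z = embedded B \<inter> ((\<lambda>x. q w2 * x) -` {0} \<inter> (\<lambda>x. x * q w2) -` {0})"
      by (auto simp: Z_def)
    ultimately have "closed Z" using Bd(1) by (simp add: closed_Int)
    moreover have "adj x \<in> Z" if "x \<in> Z" for x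
    proof -
      have "q w2 * adj x = adj (x * q w2)" "adj x * q w2 = adj (q w2 * x)" by (simp_all add: adj_mult aq)
      then show ?thesis using that Bd(6)[of x] by (simp add: Z_def)
    qed
    moreover have "x * y \<in> Z" if "x \<in> Z" "y \<in> Z" for x y
    proof -
      have "q w2 * (x * y) = 0" using that by (simp add: Z_def flip: mult.assoc)
      moreover have "x * y * q w2 = 0" using that by (simp add: Z_def mult.assoc)
      ultimately show ?thesis using that Bd(5)[of x y] by (simp add: Z_def)
    qed
    moreover have "scaleC c 0 = (0 :: 'b cprod adjop)" for c by (simp add: scaleC_def)
    then have "scaleC c x \<in> Z" if "x \<in> Z" for c x
      using that Bd(4)[of x c] by (simp add: Z_def scaleC_mult_left scaleC_mult_right)
    moreover have "x + y \<in> Z" if "x \<in> Z" "y \<in> Z" for x y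
      using that Bd(3)[of x y] by (simp add: Z_def distrib_left distrib_right)
    moreover have "0 \<in> Z" using Bd(2) by (simp add: Z_def)
    ultimately show ?thesis by (simp add: closed_subalgebra_def)
  qed
  have "embedded A \<subseteq> {x \<in> embedded A. \<phi> x \<in> Z}"
  proof (rule graph_algebra_generated[OF GA closed_subalgebra_vimage[OF \<phi>(1) KA Z]])
    fix v assume v: "v \<in> verts E"
    have "q w2 * q (\<tau> v) = 0" "q (\<tau> v) * q w2 = 0"
      using \<tau>[OF v] w12(2) by (auto intro!: FB.p_orth)
    then show "cembed A (P v) \<in> {x \<in> embedded A. \<phi> x \<in> Z}"
      using p_in[OF v] \<phi>(2)[OF v] q_in \<tau>[OF v] by (simp add: Z_def p_def)
  next
    fix e assume e: "e \<in> arcs E"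
    have "q w2 * t (\<eta> e) = 0"
      using \<eta>[OF e] \<tau>[OF verts_E(1)[OF e]] w12(2) by (intro FB.p_other_s) auto
    then have "q w2 * s' e = 0" by (simp add: s'_def flip: mult.assoc)
    moreover have "q (\<tau> (head E e)) * q w2 = 0"
      using \<tau>[OF verts_E(2)[OF e]] w12(2) by (intro FB.p_orth) auto
    then have "s' e * q (\<tau> (head E e)) * q w2 = 0" by (simp add: mult.assoc)
    then have "s' e * q w2 = 0" by (simp add: s'_q[OF e])
    ultimately show "cembed A (S e) \<in> {x \<in> embedded A. \<phi> x \<in> Z}"
      using s_in[OF e] \<phi>(3)[OF e] s'_in[OF e] by (simp add: Z_def s_def)
  qed
  then have \<phi>_Z: "\<phi> x \<in> embedded B" "q w2 * \<phi> x = 0" "\<phi> x * q w2 = 0" if "x \<in> embedded A" for x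
    using that by (auto simp: Z_def)

  have \<psi>\<phi>: "is_star_hom (embedded A) (\<lambda>x. \<psi> (\<phi> x))" by (rule is_star_hom_comp[OF \<phi>(1) \<psi>(1) \<phi>_Z(1)])
  \<comment> \<open>U leads from the place of w1, the first one, to that of w2, the second one, so
    its image is off-diagonal.\<close>
  have \<psi>_U: "\<psi> U = mat_unit True False (p (\<sigma> w2))"
  proof -
    have "\<psi> U = (\<Sum>f\<in>out_arcs F w2. \<psi> (t f * adj (t (\<eta> (\<epsilon> f)))))"
      unfolding U_def by (rule is_star_hom_sum[OF \<psi>(1) KB ut_in])
    also have "\<dots> = (\<Sum>f\<in>out_arcs F w2. mat_unit True False (s (\<epsilon> f) * adj (s (\<epsilon> f))))"
    proof (rule sum.cong)
      fix f assume f: "f \<in> out_arcs F w2"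
      have g: "\<eta> (\<epsilon> f) \<in> arcs F" "tail F (\<eta> (\<epsilon> f)) = w1" "\<epsilon> (\<eta> (\<epsilon> f)) = \<epsilon> f"
        using \<eta>_\<epsilon>_w2[OF f] \<eta>[OF \<epsilon>_arcs[of f]] f by auto
      have "\<psi> (t f * adj (t (\<eta> (\<epsilon> f)))) = \<psi> (t f) * adj (\<psi> (t (\<eta> (\<epsilon> f))))"
        using f g t_in Bd by (simp add: \<psi>d)
      also have "\<dots> = mat_unit True False (s (\<epsilon> f) * adj (s (\<epsilon> f)))"
        using f g w12(3) head_\<eta>_\<epsilon>[of f] by (simp add: \<psi>(3) adj_mat_unit mat_unit_mult)
      finally show "\<psi> (t f * adj (t (\<eta> (\<epsilon> f)))) = mat_unit True False (s (\<epsilon> f) * adj (s (\<epsilon> f)))" .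
    qed simp
    also have "\<dots> = mat_unit True False (\<Sum>f\<in>out_arcs F w2. s (\<epsilon> f) * adj (s (\<epsilon> f)))"
      by (simp add: mat_unit_sum)
    also have "(\<Sum>f\<in>out_arcs F w2. s (\<epsilon> f) * adj (s (\<epsilon> f))) = (\<Sum>e\<in>out_arcs E (\<sigma> w2). s e * adj (s e))"
      by (rule sum.reindex_bij_betw[OF bij_\<epsilon>[OF w12(2)]])
    also have "\<dots> = p (\<sigma> w2)" by (rule EA.p_sum[OF tails[OF \<sigma>_verts[OF w12(2)]], symmetric])
    finally show ?thesis .
  qed
  have "embedded A \<subseteq> {x \<in> embedded A. \<psi> (\<phi> x) = mat_unit False False x}"
  proof (rule graph_algebra_generated[OF GA closed_subalgebra_equalizer[OF \<psi>\<phi> is_star_hom_mat_unit KA]])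
    fix v assume v: "v \<in> verts E"
    have "\<psi> (\<phi> (p v)) = mat_unit False False (p v)" using \<tau>[OF v] by (simp add: \<phi>(2)[OF v] \<psi>(2))
    then show "cembed A (P v) \<in> {x \<in> embedded A. \<psi> (\<phi> x) = mat_unit False False x}"
      using p_in[OF v] by (simp add: p_def)
  next
    fix e assume e: "e \<in> arcs E"
    note h = \<eta>[OF e]
    have tl: "tail F (\<eta> e) \<noteq> w2" using h \<tau>[OF verts_E(1)[OF e]] by simp
    have "\<psi> (s' e) = mat_unit False False (s e)"
    proof (cases "head F (\<eta> e) = w2")
      case True
      have he: "head E e = \<sigma> w2" using \<epsilon>_head[of "\<eta> e"] h True by simp
      \<comment> \<open>The image of t (\<eta> e) has its entry in the first row and second column,
        and that of U in the second row and first column. The correction by U thus brings the edge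
        back to the first diagonal place.\<close>
      have "\<psi> (s' e) = \<psi> (t (\<eta> e)) * \<psi> U" using True h t_in U_in by (simp add: s'_def \<psi>d)
      also have "\<dots> = mat_unit False False (s e * p (head E e))"
        using h tl True he by (simp add: \<psi>(3) \<psi>_U mat_unit_mult)
      finally show ?thesis using EA.s_p_head[OF e] by simp
    next
      case False
      then show ?thesis using h tl by (simp add: s'_def \<psi>(3))
    qed
    then show "cembed A (S e) \<in> {x \<in> embedded A. \<psi> (\<phi> x) = mat_unit False False x}"
      using s_in[OF e] \<phi>(3)[OF e] by (simp add: s_def)
  qed
  then have \<psi>\<phi>_eq: "\<psi> (\<phi> x) = mat_unit False False x" if "x \<in> embedded A" for x using that by blast
  have iso: "norm (\<phi> x) = norm x" if x: "x \<in> embedded A" for x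
  proof (rule antisym)
    show "norm (\<phi> x) \<le> norm x" by (rule star_hom_contractive[OF \<phi>(1) KA x])
    have "norm x \<le> norm (\<psi> (\<phi> x))" unfolding \<psi>\<phi>_eq[OF x] by (rule norm_mat_unit_ge)
    also have "\<dots> \<le> norm (\<phi> x)" by (rule star_hom_contractive[OF \<psi>(1) KB \<phi>_Z(1)[OF x]])
    finally show "norm x \<le> norm (\<phi> x)" .
  qed

  define \<alpha> where "\<alpha> = (\<lambda>a. \<phi> (cembed A a))"
  have emb_in: "cembed A a \<in> embedded A" if "a \<in> carrier A" for a using that by (simp add: embedded_def)
  interpret \<alpha>: isometric_embedding A \<alpha>
    by unfold_locales
      (simp_all add: \<alpha>_def A.emb_add A.emb_smult A.emb_mult A.emb_star A.norm_emb emb_in \<phi>d iso)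
  note Cd = closed_subalgebraD[OF \<alpha>.closed_subalgebra_emb]
  have C_im: "\<phi> x \<in> \<alpha> ` carrier A" if "x \<in> embedded A" for x
    using that by (auto simp: embedded_def \<alpha>_def)
  have C_gen: "q (\<tau> v) \<in> \<alpha> ` carrier A" if "v \<in> verts E" for v
    using C_im[OF p_in[OF that]] \<phi>(2)[OF that] by simp
  have C_gen': "s' e \<in> \<alpha> ` carrier A" if "e \<in> arcs E" for e
    using C_im[OF s_in[OF that]] \<phi>(3)[OF that] by simp

  \<comment> \<open>In general r lies outside \<open>embedded B\<close>, but its products with
    elements of \<open>embedded B\<close> lie inside.\<close>
  define r where "r = 1 - q w2"
  have ar: "adj r = r" and rr: "r * r = r"
    using FB.p_idem[OF w12(2)] aq by (simp_all add: r_def adj_diff left_diff_distrib right_diff_distrib)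
  have full: "r + U * adj U = 1" by (simp add: r_def U_adj_U)
  have Ur: "U * r = U" using U_q[OF w12(2)] w12(3) by (simp add: r_def right_diff_distrib)

  \<comment> \<open>Compressing by \<open>r\<close> and \<open>U\<close> is multiplicative in the sense of matrices by \<open>full\<close>, so \<open>D\<close> is
    an algebra and it suffices to consider generators.\<close>
  define D where "D = {z \<in> embedded B. \<forall>g\<in>{r, U}. \<forall>h\<in>{r, U}. adj g * z * h \<in> \<alpha> ` carrier A}"
  have D: "closed_subalgebra D"
  proof -
    have "closed ((\<lambda>z. adj g * z * h) -` (\<alpha> ` carrier A))" for g h
      by (rule continuous_closed_vimage[OF Cd(1)]) (auto intro!: continuous_intros)
    then have "closed (embedded B \<inter> (\<Inter>g\<in>{r, U}. \<Inter>h\<in>{r, U}. (\<lambda>z. adj g * z * h) -` (\<alpha> ` carrier A)))"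
      by (intro closed_Int Bd(1) closed_INT ballI)
    moreover have "D = embedded B \<inter> (\<Inter>g\<in>{r, U}. \<Inter>h\<in>{r, U}. (\<lambda>z. adj g * z * h) -` (\<alpha> ` carrier A))"
      by (auto simp: D_def)
    ultimately have "closed D" by simp
    moreover have "adj z \<in> D" if z: "z \<in> D" for z
    proof -
      have "adj g * adj z * h = adj (adj h * z * g)" for g h by (simp add: adj_mult mult.assoc)
      then have "adj g * adj z * h \<in> \<alpha> ` carrier A" if "g \<in> {r, U}" "h \<in> {r, U}" for g h
        using z that Cd(6) by (simp only: D_def mem_Collect_eq)
      then show ?thesis using z Bd(6)[of z] by (simp add: D_def)
    qed
    moreover have "z * y \<in> D" if z: "z \<in> D" and y: "y \<in> D" for z y
    proof -
      have "adj g * (z * y) * h \<in> \<alpha> ` carrier A" if gh: "g \<in> {r, U}" "h \<in> {r, U}" for g h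
      proof -
        have "adj g * (z * y) * h = adj g * z * (r * r + U * adj U) * y * h"
          by (simp add: rr full mult.assoc)
        also have "\<dots> = (adj g * z * r) * (adj r * y * h) + (adj g * z * U) * (adj U * y * h)"
          by (simp add: ar distrib_left distrib_right mult.assoc)
        also have "\<dots> \<in> \<alpha> ` carrier A"
          by (rule Cd(3)[OF Cd(5) Cd(5)]) (use z y gh in \<open>auto simp: D_def\<close>)
        finally show ?thesis .
      qed
      then show ?thesis using z y Bd(5)[of z y] by (simp add: D_def)
    qed
    moreover have "scaleC c z \<in> D" if "z \<in> D" for c z
      using that Bd(4)[of z c] Cd(4) by (simp add: D_def scaleC_mult_left scaleC_mult_right)
    moreover have "z + y \<in> D" if "z \<in> D" "y \<in> D" for z y
      using that Bd(3)[of z y] Cd(3) by (simp add: D_def distrib_left distrib_right)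
    moreover have "0 \<in> D" using Bd(2) Cd(2) by (simp add: D_def)
    ultimately show ?thesis by (simp add: closed_subalgebra_def)
  qed
  have "embedded B \<subseteq> D"
  proof (rule graph_algebra_generated[OF GB D])
    fix w assume w: "w \<in> verts F"
    show "cembed B (Q w) \<in> D"
    proof (cases "w = w2")
      case True
      have "r * q w2 = 0" "q w2 * r = 0"
        using FB.p_idem[OF w12(2)] by (simp_all add: r_def left_diff_distrib right_diff_distrib)
      moreover from this have "adj U * q w2 * r = 0" by (simp add: mult.assoc)
      moreover have "adj U * q w2 * U = q (\<tau> (\<sigma> w2))"
        using q_U[OF w12(2)] by (simp add: mult.assoc adj_U_U \<tau>_w2)
      ultimately have "q w2 \<in> D"
        using q_in[OF w12(2)] C_gen[OF \<sigma>_verts[OF w12(2)]] Cd(2) by (simp add: D_def ar)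
      then show ?thesis using True by (simp add: q_def)
    next
      case False
      have "q w2 * q w = 0" "q w * q w2 = 0" using False w w12(2) by (auto intro!: FB.p_orth)
      then have "r * q w = q w" "q w * r = q w" by (simp_all add: r_def left_diff_distrib right_diff_distrib)
      moreover have qU: "q w * U = 0" using q_U[OF w] False by simp
      moreover have "adj U * q w = 0"
      proof -
        have "adj (q w * U) = 0" using qU by simp
        then show ?thesis by (simp add: adj_mult FB.adj_p[OF w])
      qed
      ultimately have "q w \<in> D"
        using q_in[OF w] C_gen[OF \<sigma>_verts[OF w]] \<tau>_\<sigma>[OF w False] Cd(2) by (simp add: D_def ar)
      then show ?thesis by (simp add: q_def)
    qed
  next
    fix f assume f: "f \<in> arcs F"
    let ?f = "\<eta> (\<epsilon> f)"
    have h: "?f \<in> arcs F" "head F ?f = head F f" using \<eta>[OF \<epsilon>_arcs[OF f]] head_\<eta>_\<epsilon>[OF f] by auto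
    \<comment> \<open>Multiplying t f on the left by r or \<open>adj U\<close> gives 0 or t of the
      lift of \<epsilon> f that starts at the chosen vertex. Multiplying the latter on the right by
      r or U gives 0 or \<open>s' (\<epsilon> f)\<close>, which is the image of an edge of E. So all
      four compressions of t f lie in the image of A.\<close>
    have left: "adj g * t f \<in> {0, t ?f}" if "g \<in> {r, U}" for g
    proof (cases "tail F f = w2")
      case True
      have "q w2 * t f = t f" using FB.p_tail_s[OF f] True by simp
      then have "r * t f = 0" by (simp add: r_def left_diff_distrib)
      then show ?thesis using that adj_U_t[of f] f True by (auto simp: ar)
    next
      case False
      have "q w2 * t f = 0" using FB.p_other_s[OF f w12(2)] False by simp
      then have "r * t f = t f" by (simp add: r_def left_diff_distrib)
      moreover have "adj U * t f = 0"
      proof -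
        have "adj (q w2 * U) = adj U" using q_U[OF w12(2)] by simp
        then have "adj U * q w2 = adj U" by (simp add: adj_mult aq)
        then have "adj U * t f = adj U * (q w2 * t f)" by (metis mult.assoc)
        then show ?thesis using \<open>q w2 * t f = 0\<close> by simp
      qed
      ultimately show ?thesis using that \<eta>_\<epsilon>[OF f False] by (auto simp: ar)
    qed
    have right: "t ?f * g \<in> {0, s' (\<epsilon> f)}" if "g \<in> {r, U}" for g
    proof (cases "head F f = w2")
      case True
      have "t ?f * q w2 = t ?f" using FB.s_p_head[OF h(1)] h(2) True by simp
      then have "t ?f * r = 0" by (simp add: r_def right_diff_distrib)
      then show ?thesis using that h(2) True by (auto simp: s'_def)
    next
      case False
      have "t ?f * q w2 = 0" using FB.s_p_other[OF h(1) w12(2)] h(2) False by simp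
      then have "t ?f * r = t ?f" by (simp add: r_def right_diff_distrib)
      moreover have "t ?f * U = 0"
      proof -
        have "q w2 * U = U" using q_U[OF w12(2)] by simp
        then have "t ?f * U = t ?f * q w2 * U" by (simp add: mult.assoc)
        then show ?thesis using \<open>t ?f * q w2 = 0\<close> by simp
      qed
      ultimately show ?thesis using that h(2) False by (auto simp: s'_def)
    qed
    have "adj g * t f * g' \<in> \<alpha> ` carrier A" if "g \<in> {r, U}" "g' \<in> {r, U}" for g g'
      using left[OF that(1)] right[OF that(2)] Cd(2) C_gen'[OF \<epsilon>_arcs[OF f]] by auto
    then have "t f \<in> D" using t_in[OF f] by (simp add: D_def)
    then show "cembed B (T f) \<in> D" by (simp add: t_def)
  qed
  then have compress: "r * z * r \<in> \<alpha> ` carrier A" if "z \<in> embedded B" for z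
    using that by (auto simp: D_def ar)

  interpret full_corner A \<alpha> B "cembed B" r U
  proof (unfold_locales, goal_cases)
    case 1 show ?case by (rule ar)
  next
    case 2 show ?case by (rule rr)
  next
    case (3 a) then show ?case using \<phi>_Z(1)[OF emb_in[of a]] by (simp add: \<alpha>_def embedded_def)
  next
    case (4 a) then show ?case
      using \<phi>_Z(2)[OF emb_in[of a]] by (simp add: \<alpha>_def r_def left_diff_distrib)
  next
    case (5 x) then show ?case
      using Bd(9)[of x "q w2 * x"] Bd(5)[OF q_in[OF w12(2)], of x]
      by (simp add: r_def left_diff_distrib embedded_def)
  next
    case (6 x y)
    \<comment> \<open>Since r fixes x and y from the left, \<open>x * adj y\<close> equals its own
      compression by r, which lies in the image of A.\<close>
    have "adj y = adj y * r" using arg_cong[OF 6(4), of adj] by (simp add: adj_mult ar)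
    then have "x * adj y = r * (x * adj y) * r" by (metis 6(3) mult.assoc)
    moreover have "x * adj y \<in> embedded B" using 6(1,2) Bd by (simp add: embedded_def)
    ultimately show ?case using compress by metis
  next
    case 7 show ?case using U_in by (simp add: embedded_def)
  next
    case 8 show ?case by (rule Ur)
  next
    case 9 show ?case by (rule full)
  next
    case (10 H) then show ?case by (intro graph_algebra_products[OF GA]) auto
  next
    case (11 H) then show ?case by (intro graph_algebra_products[OF GB]) auto
  qed
  show ?thesis by (rule morita)
qed

section \<open>From reverse explosions to in-splittings\<close>

lemma reverse_explosion_in_splitting:
  fixes E :: "('v, 'e) pre_digraph" and F :: "('v, 'f) pre_digraph"
  assumes E: "countable_graph E" "row_finite E" "no_sinks E"
    and ex: "explosion_wrt (reverse_graph E) v M1 M2 v1 v2 (reverse_graph F)"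
  shows "\<exists>\<sigma> \<epsilon>. in_splitting E F \<sigma> \<epsilon> v1 v2"
proof -
  have v: "v \<in> verts E" "v1 \<noteq> v2" "v1 \<in> verts E \<Longrightarrow> v1 = v" "v2 \<in> verts E \<Longrightarrow> v2 = v"
    and vF: "verts F = insert v1 (insert v2 (verts E - {v}))"
    using ex unfolding explosion_wrt_def by (auto simp: reverse_graph_def)
  have M: "e \<in> M1 \<or> e \<in> M2 \<longleftrightarrow> e \<in> arcs E \<and> head E e = v" "\<not> (e \<in> M1 \<and> e \<in> M2)" for e
  proof -
    have "out_arcs (reverse_graph E) v = M1 \<union> M2" "M1 \<inter> M2 = {}" using ex by (auto simp: explosion_wrt_def)
    then show "e \<in> M1 \<or> e \<in> M2 \<longleftrightarrow> e \<in> arcs E \<and> head E e = v" "\<not> (e \<in> M1 \<and> e \<in> M2)"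
      by (auto simp: reverse_graph_def out_arcs_def set_eq_iff)
  qed
  interpret E: countable_graph E by (rule E(1))
  interpret F': countable_graph "reverse_graph F" using ex by (simp add: explosion_wrt_def)
  have wfF: "wf_digraph F"
    using F'.tail_in_verts F'.head_in_verts by (simp add: wf_digraph_def reverse_graph_def)
  have F_unique: "f = g" if "f \<in> arcs F" "g \<in> arcs F" "tail F f = tail F g" "head F f = head F g" for f g
    using F'.no_multi_arcs[of f g] that by (simp add: reverse_graph_def arc_to_ends_def)
  have E_unique: "f = g" if "f \<in> arcs E" "g \<in> arcs E" "tail E f = tail E g" "head E f = head E g" for f g
    using E.no_multi_arcs[of f g] that by (simp add: arc_to_ends_def)
  \<comment> \<open>One of v1 and v2 may be v itself, so both are tested before the remaining
    vertices are left fixed.\<close>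
  define \<sigma> where "\<sigma> w = (if w = v1 \<or> w = v2 then v else w)" for w
  \<comment> \<open>The common head of all copies of e in F. For an edge entering v it records
    whether e belongs to M1 or to M2.\<close>
  define r where "r e = (if head E e = v then if e \<in> M1 then v1 else v2 else head E e)" for e
  have s1: "\<sigma> u = u" "u \<in> verts F" "u \<noteq> v1" "u \<noteq> v2" if "u \<in> verts E" "u \<noteq> v" for u
    using that v by (auto simp: \<sigma>_def vF)
  have s2: "\<sigma> v1 = v" "\<sigma> v2 = v" by (simp_all add: \<sigma>_def)
  have s3: "w = v1 \<or> w = v2" if "w \<in> verts F" "\<sigma> w = v" for w
    using that by (auto simp: \<sigma>_def vF split: if_splits)
  have s4: "\<sigma> w \<in> verts E" if "w \<in> verts F" for w
    using that v by (auto simp: \<sigma>_def vF)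
  have s5: "\<sigma> w = w" if "w \<noteq> v1" "w \<noteq> v2" for w using that by (simp add: \<sigma>_def)
  have sr: "\<sigma> (r e) = head E e" if "e \<in> arcs E" for e
    using s1(1)[OF E.head_in_verts[OF that]] s2 by (simp add: r_def)
  have r1: "r e = v1" if "e \<in> M1" for e using that M(1)[of e] by (simp add: r_def)
  have r2: "r e = v2" if "e \<in> M2" for e using that M(1)[of e] M(2)[of e] by (auto simp: r_def)
  have r3: "r e = head E e" if "head E e \<noteq> v" for e using that by (simp add: r_def)
  have ends: "arcs_ends (reverse_graph F) =
       {(head E e, tail E e) | e. e \<in> arcs E \<and> head E e \<noteq> v \<and> tail E e \<noteq> v} \<union>
       {(head E e, v1) | e. e \<in> arcs E \<and> head E e \<noteq> v \<and> tail E e = v} \<union>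
       {(head E e, v2) | e. e \<in> arcs E \<and> head E e \<noteq> v \<and> tail E e = v} \<union>
       {(v1, tail E e) | e. e \<in> M1 \<and> tail E e \<noteq> v} \<union>
       {(v2, tail E e) | e. e \<in> M2 \<and> tail E e \<noteq> v} \<union>
       (if \<exists>e\<in>M1. tail E e = v then {(v1, v1), (v1, v2)} else {}) \<union>
       (if \<exists>e\<in>M2. tail E e = v then {(v2, v2), (v2, v1)} else {})"
    using ex unfolding explosion_wrt_def by (elim conjE) (simp only: reverse_graph_def pre_digraph.simps)
  have w12: "v1 \<in> verts F" "v2 \<in> verts F" by (simp_all add: vF)
  \<comment> \<open>Together with \<open>up\<close> this says that the ends in the reversed F are
    exactly the pairs (r e, w) with w a vertex of F over the tail of e. The last two sets of
    \<open>ends\<close> fit in as well: a loop at v has one copy starting at v1 and one at v2, with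
    a common head.\<close>
  have down: "\<exists>e\<in>arcs E. tail E e = \<sigma> w \<and> w \<in> verts F \<and> x = r e" if "(x, w) \<in> arcs_ends (reverse_graph F)" for x w
    using that unfolding ends
  proof (elim UnE)
    assume "(x, w) \<in> {(head E e, tail E e) | e. e \<in> arcs E \<and> head E e \<noteq> v \<and> tail E e \<noteq> v}"
    then obtain e where e: "e \<in> arcs E" "head E e \<noteq> v" "tail E e \<noteq> v" "x = head E e" "w = tail E e" by blast
    then show ?thesis using s1[OF E.tail_in_verts[OF e(1)] e(3)] r3[OF e(2)] by (intro bexI[of _ e]) simp_all
  next
    assume "(x, w) \<in> {(head E e, v1) | e. e \<in> arcs E \<and> head E e \<noteq> v \<and> tail E e = v}"
    then obtain e where e: "e \<in> arcs E" "head E e \<noteq> v" "tail E e = v" "x = head E e" "w = v1" by blast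
    then show ?thesis using s2 w12 r3[OF e(2)] by (intro bexI[of _ e]) simp_all
  next
    assume "(x, w) \<in> {(head E e, v2) | e. e \<in> arcs E \<and> head E e \<noteq> v \<and> tail E e = v}"
    then obtain e where e: "e \<in> arcs E" "head E e \<noteq> v" "tail E e = v" "x = head E e" "w = v2" by blast
    then show ?thesis using s2 w12 r3[OF e(2)] by (intro bexI[of _ e]) simp_all
  next
    assume "(x, w) \<in> {(v1, tail E e) | e. e \<in> M1 \<and> tail E e \<noteq> v}"
    then obtain e where e: "e \<in> M1" "tail E e \<noteq> v" "x = v1" "w = tail E e" by blast
    have a: "e \<in> arcs E" using M(1)[of e] e(1) by blast
    show ?thesis using e a s1[OF E.tail_in_verts[OF a] e(2)] r1[OF e(1)] by (intro bexI[of _ e]) simp_all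
  next
    assume "(x, w) \<in> {(v2, tail E e) | e. e \<in> M2 \<and> tail E e \<noteq> v}"
    then obtain e where e: "e \<in> M2" "tail E e \<noteq> v" "x = v2" "w = tail E e" by blast
    have a: "e \<in> arcs E" using M(1)[of e] e(1) by blast
    show ?thesis using e a s1[OF E.tail_in_verts[OF a] e(2)] r2[OF e(1)] by (intro bexI[of _ e]) simp_all
  next
    assume a: "(x, w) \<in> (if \<exists>e\<in>M1. tail E e = v then {(v1, v1), (v1, v2)} else {})"
    then obtain e where e: "e \<in> M1" "tail E e = v" by (auto split: if_splits)
    have "x = v1" "w = v1 \<or> w = v2" using a by (auto split: if_splits)
    then show ?thesis using e M(1)[of e] s2 w12 r1[OF e(1)] by (intro bexI[of _ e]) auto
  next
    assume a: "(x, w) \<in> (if \<exists>e\<in>M2. tail E e = v then {(v2, v2), (v2, v1)} else {})"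
    then obtain e where e: "e \<in> M2" "tail E e = v" by (auto split: if_splits)
    have "x = v2" "w = v1 \<or> w = v2" using a by (auto split: if_splits)
    then show ?thesis using e M(1)[of e] s2 w12 r2[OF e(1)] by (intro bexI[of _ e]) auto
  qed
  have up: "(r e, w) \<in> arcs_ends (reverse_graph F)" if e: "e \<in> arcs E" and w: "w \<in> verts F" "\<sigma> w = tail E e" for e w
  proof -
    have wt: "w = tail E e" if "tail E e \<noteq> v" using that w s2 s5[of w] by metis
    have wv: "w = v1 \<or> w = v2" if "tail E e = v" using that w s3 by metis
    consider "head E e \<noteq> v" | "e \<in> M1" | "e \<in> M2" using M(1)[of e] e by blast
    then show ?thesis
    proof cases
      case 1
      then show ?thesis using e wt wv r3[of e] unfolding ends by (cases "tail E e = v") auto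
    next
      case 2
      then show ?thesis using wt wv r1[of e] unfolding ends by (cases "tail E e = v") auto
    next
      case 3
      then show ?thesis using wt wv r2[of e] unfolding ends by (cases "tail E e = v") auto
    qed
  qed
  \<comment> \<open>Only one edge qualifies: \<sigma> (r e) recovers the head of e, and E has no
    multiple edges.\<close>
  define \<epsilon> where "\<epsilon> f = (SOME e. e \<in> arcs E \<and> tail E e = \<sigma> (tail F f) \<and> head F f = r e)" for f
  have \<epsilon>: "\<epsilon> f \<in> arcs E \<and> tail E (\<epsilon> f) = \<sigma> (tail F f) \<and> head F f = r (\<epsilon> f)" if "f \<in> arcs F" for f
  proof -
    have "(head F f, tail F f) \<in> arcs_ends (reverse_graph F)"
      using that by (auto simp: arcs_ends_def arc_to_ends_def reverse_graph_def)
    then have "\<exists>e. e \<in> arcs E \<and> tail E e = \<sigma> (tail F f) \<and> head F f = r e" using down by blast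
    then show ?thesis unfolding \<epsilon>_def by (rule someI_ex)
  qed
  have r_unique: "e = e'" if "e \<in> arcs E" "e' \<in> arcs E" "tail E e = tail E e'" "r e = r e'" for e e'
    using that sr[of e] sr[of e'] by (intro E_unique) simp_all
  have "in_splitting E F \<sigma> \<epsilon> v1 v2"
  proof
    show "tail F f \<in> verts F" "head F f \<in> verts F" if "f \<in> arcs F" for f
      using wf_digraph.tail_in_verts[OF wfF that] wf_digraph.head_in_verts[OF wfF that] .
    show "u \<in> tail E ` arcs E" if "u \<in> verts E" for u
    proof -
      have "out_arcs E u \<noteq> {}" using E(3) that by (simp add: no_sinks_def)
      then obtain e where "e \<in> out_arcs E u" by blast
      then show ?thesis by auto
    qed
    show "finite (out_arcs E u)" if "u \<in> verts E" for u using E(2) that by (simp add: row_finite_def)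
    show "\<sigma> w \<in> verts E" if "w \<in> verts F" for w by (rule s4[OF that])
    show "\<exists>w\<in>verts F. w \<noteq> v2 \<and> \<sigma> w = u" if "u \<in> verts E" for u
    proof (cases "u = v")
      case True then show ?thesis using v(2) s2 w12 by (intro bexI[of _ v1]) auto
    next
      case False then show ?thesis using s1[OF that] by (intro bexI[of _ u]) auto
    qed
    show "v1 \<in> verts F" "v2 \<in> verts F" "v1 \<noteq> v2" "\<sigma> v1 = \<sigma> v2" using w12 v(2) s2 by auto
    show "w = w'" if w: "w \<in> verts F" "w' \<in> verts F" "w \<noteq> v2" "w' \<noteq> v2" "\<sigma> w = \<sigma> w'" for w w'
      using w s3[of w] s3[of w'] s5[of w] s5[of w'] s2 by metis
    show "\<epsilon> f \<in> arcs E" "tail E (\<epsilon> f) = \<sigma> (tail F f)" "head E (\<epsilon> f) = \<sigma> (head F f)" if "f \<in> arcs F" for f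
      using \<epsilon>[OF that] sr[of "\<epsilon> f"] by simp_all
    show "\<exists>f\<in>arcs F. tail F f = w \<and> \<epsilon> f = e" if e: "e \<in> arcs E" "w \<in> verts F" "\<sigma> w = tail E e" for e w
    proof -
      obtain f where f: "f \<in> arcs F" "tail F f = w" "head F f = r e"
        using up[OF e] by (auto simp: arcs_ends_def arc_to_ends_def reverse_graph_def)
      have "\<epsilon> f = e" using \<epsilon>[OF f(1)] f e by (intro r_unique) simp_all
      then show ?thesis using f by blast
    qed
    show "f = g" if "f \<in> arcs F" "g \<in> arcs F" "tail F f = tail F g" "\<epsilon> f = \<epsilon> g" for f g
      using \<epsilon>[OF that(1)] \<epsilon>[OF that(2)] that by (intro F_unique) simp_all
    show "head F f = head F g" if "f \<in> arcs F" "g \<in> arcs F" "\<epsilon> f = \<epsilon> g" for f g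
      using \<epsilon>[OF that(1)] \<epsilon>[OF that(2)] that by simp
  qed
  then show ?thesis by blast
qed

theorem corollary6p10:
  fixes E :: "('v, 'e) pre_digraph" and F :: "('v, 'f) pre_digraph"
    and A :: "'a cstar" and B :: "'b cstar"
  assumes "countable_graph E" and "row_finite E" and "no_sinks E"
    and "reverse_explosion E F"
    and "graph_algebra E A P S"
    and "graph_algebra F B Q T"
  shows "morita_equivalent A B"
proof -
  obtain v M1 M2 v1 v2 where ex: "explosion_wrt (reverse_graph E) v M1 M2 v1 v2 (reverse_graph F)"
    using assms(4) unfolding reverse_explosion_def explosion_at_def by blast
  obtain \<sigma> \<epsilon> where "in_splitting E F \<sigma> \<epsilon> v1 v2"
    using reverse_explosion_in_splitting[OF assms(1-3) ex] by blast
  moreover have "countable_graph (reverse_graph F)" using ex by (simp add: explosion_wrt_def)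
  then have "countable (verts F)" "countable (arcs F)"
    using countable_graph.countable_verts countable_graph.countable_arcs
    by (fastforce simp: reverse_graph_def)+
  ultimately show ?thesis
    using countable_graph.countable_verts[OF assms(1)] countable_graph.countable_arcs[OF assms(1)] assms(5,6)
    by (intro in_splitting_morita_equivalent)
qed

end
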